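(* Let $d\ge 1$ be an integer and let $\mu$ be a positive half-integer, i.e. $\mu=m/2$ for some positive integer $m$. Then there exist positive constants $b_{d,\mu}$ and $c_{d,\mu}$, depending only on $d$ and $\mu$, such that for every integer $n\ge 1$ and every cubature formula of degree $2n$ with positive weights $(\lambda_\alpha)_{\alpha\in A}$ and nodes $(x_\alpha)_{\alpha\in A}\subset B^d$ on the ball $B^d$ with respect to the Gegenbauer weight function $\mathbf{w}_\mu(\mathbf{x})=(1-\|\mathbf{x}\|^2)^{\mu-1/2}$, the hyperinterpolation operator $$\mathcal{L}_{2n}(f)(\mathbf{x})=\sum_{\alpha\in A}\lambda_\alpha\,\mathbf{K}_n(\mathbf{w}_\mu;x_\alpha,\mathbf{x})\,f(x_\alpha),\qquad f\in C(B^d),$$ satisfies $$b_{d,\mu}\,n^{(d-1)/2+\mu}\le \|\mathcal{L}_{2n}\|\le c_{d,\mu}\,n^{(d-1)/2+\mu}.$$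
   Context: $B^d=\{\mathbf{x}\in\mathbb{R}^d:\|\mathbf{x}\|\le 1\}$ is the closed Euclidean unit ball, and $C(B^d)$ is the space of continuous real functions on $B^d$ with the uniform norm $\|\cdot\|_{C(B^d)}$. $\Pi_n^d$ is the space of polynomials in $d$ real variables of total degree at most $n$. A cubature formula of degree $N$ on $B^d$ with respect to a weight function $\mathbf{w}$ consists of positive weights $\lambda_\alpha>0$ and nodes $x_\alpha\in B^d$, with $\alpha$ in a finite index set $A$, such that $\sum_{\alpha\in A}\lambda_\alpha f(x_\alpha)=\int_{B^d}f(\mathbf{x})\,\mathbf{w}(\mathbf{x})\,d\mathbf{x}$ for all polynomials $f$ of total degree at most $N$. $\mathbf{K}_n(\mathbf{w}_\mu;\cdot,\cdot)$ is the reproducing kernel of $\Pi_n^d$ with respect to $\mathbf{w}_\mu$: $\mathbf{K}_n(\mathbf{w}_\mu;\mathbf{x},\mathbf{y})=\sum_j p_j(\mathbf{x})p_j(\mathbf{y})$ for any orthonormal basis $(p_j)$ of $\Pi_n^d$ with respect to the inner product $\int_{B^d}fg\,\mathbf{w}_\mu\,d\mathbf{x}$; equivalently, it is the kernel, in $\Pi_n^d$ in each variable, with $f(\mathbf{x})=\int_{B^d}\mathbf{K}_n(\mathbf{w}_\mu;\mathbf{x},\mathbf{y})f(\mathbf{y})\mathbf{w}_\mu(\mathbf{y})\,d\mathbf{y}$ for all $f\in\Pi_n^d$. The Lebesgue constant of an operator $\mathcal{L}$ on $C(B^d)$ is $\|\mathcal{L}\|=\sup\{\|\mathcal{L}f\|_{C(B^d)}: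 f\in C(B^d),\ \|f\|_{C(B^d)}\le 1\}$. The subscript $2n$ in $\mathcal{L}_{2n}$ refers to the degree of the cubature formula; the kernel used is $\mathbf{K}_n$. *)

theory Defs
  imports "HOL-Analysis.Analysis"
begin

definition multi_indices :: "nat \<Rightarrow> ('n::finite \<Rightarrow> nat) set" where
  "multi_indices n = {a. (\<Sum>i\<in>UNIV. a i) \<le> n}"

lemma finite_multi_indices: "finite (multi_indices n :: ('n::finite \<Rightarrow> nat) set)"
proof (rule finite_subset)
  show "multi_indices n \<subseteq> (\<Pi>\<^sub>E i\<in>(UNIV::'n set). {..n})"
  proof
    fix a :: "'n \<Rightarrow> nat"
    assume "a \<in> multi_indices n"
    then have sum_le: "(\<Sum>i\<in>UNIV. a i) \<le> n"
      by (simp add: multi_indices_def)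
    have "a i \<le> n" for i
      using member_le_sum[of i UNIV a] sum_le by simp
    then show "a \<in> (\<Pi>\<^sub>E i\<in>(UNIV::'n set). {..n})"
      by (simp add: PiE_def)
  qed
qed (simp add: finite_PiE)

text \<open>The space of real polynomials in \<open>CARD('n)\<close> variables of total degree at most \<open>n\<close>.
  Polynomials are identified with the functions they induce on the whole space.\<close>

definition poly_space :: "nat \<Rightarrow> (real ^ 'n \<Rightarrow> real) set" where
  "poly_space n =
    {f. \<exists>c. f = (\<lambda>x. \<Sum>a\<in>multi_indices n. c a * (\<Prod>i\<in>UNIV. (x $ i) ^ a i))}"

abbreviation unit_ball :: "(real ^ 'n) set" where
  "unit_ball \<equiv> cball 0 1"

definition ball_integral :: "(real ^ 'n \<Rightarrow> real) \<Rightarrow> (real ^ 'n \<Rightarrow> real) \<Rightarrow> real" where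
  "ball_integral w f = (LINT x:unit_ball|lborel. f x * w x)"

text \<open>Since \<open>0 powr 0 = 0\<close>, for \<open>\<mu> = 1/2\<close> this is \<open>1\<close> inside the ball and \<open>0\<close> on the
  bounding sphere; the sphere is a null set, so no integral is affected.\<close>

definition gegenbauer_weight :: "real \<Rightarrow> real ^ 'n \<Rightarrow> real" where
  "gegenbauer_weight \<mu> x = (1 - (norm x)\<^sup>2) powr (\<mu> - 1 / 2)"

definition cubature_formula ::
  "(real ^ 'n \<Rightarrow> real) \<Rightarrow> nat \<Rightarrow> 'i set \<Rightarrow> ('i \<Rightarrow> real) \<Rightarrow> ('i \<Rightarrow> real ^ 'n) \<Rightarrow> bool" where
  "cubature_formula w N A l x \<longleftrightarrow>
    finite A \<and> (\<forall>\<alpha>\<in>A. l \<alpha> > 0 \<and> x \<alpha> \<in> unit_ball) \<and>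
    (\<forall>f\<in>poly_space N. (\<Sum>\<alpha>\<in>A. l \<alpha> * f (x \<alpha>)) = ball_integral w f)"

text \<open>The functions \<open>p 0, \<dots>, p (N - 1)\<close> form an orthonormal basis of \<open>poly_space n\<close>;
  linear independence follows from orthonormality.\<close>

definition orthonormal_basis ::
  "(real ^ 'n \<Rightarrow> real) \<Rightarrow> nat \<Rightarrow> nat \<Rightarrow> (nat \<Rightarrow> real ^ 'n \<Rightarrow> real) \<Rightarrow> bool" where
  "orthonormal_basis w n N p \<longleftrightarrow>
    (\<forall>j<N. p j \<in> poly_space n) \<and>
    (\<forall>f\<in>poly_space n. \<exists>c. f = (\<lambda>x. \<Sum>j<N. c j * p j x)) \<and>
    (\<forall>i<N. \<forall>j<N. ball_integral w (\<lambda>x. p i x * p j x) = (if i = j then 1 else 0))"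

text \<open>The sum does not depend on the orthonormal basis, which justifies the definite description.\<close>

definition reproducing_kernel ::
  "(real ^ 'n \<Rightarrow> real) \<Rightarrow> nat \<Rightarrow> real ^ 'n \<Rightarrow> real ^ 'n \<Rightarrow> real" where
  "reproducing_kernel w n =
    (THE K. \<exists>N p. orthonormal_basis w n N p \<and> K = (\<lambda>x y. \<Sum>j<N. p j x * p j y))"

definition hyperinterpolation ::
  "(real ^ 'n \<Rightarrow> real) \<Rightarrow> nat \<Rightarrow> 'i set \<Rightarrow> ('i \<Rightarrow> real) \<Rightarrow> ('i \<Rightarrow> real ^ 'n) \<Rightarrow>
    (real ^ 'n \<Rightarrow> real) \<Rightarrow> real ^ 'n \<Rightarrow> real" where
  "hyperinterpolation w n A l x f y =
    (\<Sum>\<alpha>\<in>A. l \<alpha> * reproducing_kernel w n (x \<alpha>) y * f (x \<alpha>))"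

definition ball_norm :: "(real ^ 'n \<Rightarrow> real) \<Rightarrow> real" where
  "ball_norm f = (SUP x\<in>unit_ball. \<bar>f x\<bar>)"

text \<open>Elements of \<open>C(B^d)\<close> are represented by functions on the whole space that are continuous on
  the ball; values outside the ball are arbitrary and not used. The real-valued supremum is
  meaningful for operators that are bounded on \<open>C(B^d)\<close>, as hyperinterpolation operators are.\<close>

definition lebesgue_constant :: "((real ^ 'n \<Rightarrow> real) \<Rightarrow> (real ^ 'n \<Rightarrow> real)) \<Rightarrow> real" where
  "lebesgue_constant L =
    (SUP f\<in>{f. continuous_on unit_ball f \<and> ball_norm f \<le> 1}. ball_norm (L f))"

end

theory Submission
  imports Defs
begin

text \<open>For half-integer \<open>\<mu>\<close> the measure \<open>w\<^sub>\<mu> dx\<close> is the projection to the ball of the rotation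
  invariant measure on the sphere of dimension \<open>D = d + 2 \<mu>\<close>, so the kernel \<open>K\<^sub>n\<close> is an average, over
  fibres, of the zonal polynomial \<open>k\<^sub>n = C\<^sub>n + C\<^bsub>n-1\<^esub>\<close> with Gegenbauer polynomials of parameter
  \<open>\<nu> = (D + 1) / 2\<close>. The sphere itself is avoided: the needed rotation invariance is encoded in two
  recurrences for moments, which follow from integration by parts on the ball and on the fibre.

  Upper bound: \<open>C\<^sup>\<nu>\<^sub>n = (\<Sum>k\<le>n. C\<^sup>\<sigma>\<^sub>k C\<^sup>\<sigma>\<^bsub>n-k\<^esub>)\<close> with \<open>\<sigma> = \<nu> / 2\<close>, hence
  \<open>\<bar>C\<^sup>\<nu>\<^sub>n\<bar> \<le> (\<Sum>k\<le>n. (C\<^sup>\<sigma>\<^sub>k)\<^sup>2)\<close>. The majorant has degree \<open>2 n\<close>, so every cubature formula of degree \<open>2 n\<close>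
  integrates it exactly, and its integral is of order \<open>n\<^bsup>\<nu>-1\<^esup>\<close>, where \<open>\<nu> - 1 = (d - 1) / 2 + \<mu>\<close>.

  Lower bound: at a boundary point \<open>e\<close> the kernel is a multiple of \<open>k\<^sub>n (x \<bullet> e)\<close>, and
  \<open>\<bar>k\<^sub>n t\<bar> + \<bar>k\<^sub>n (- t)\<bar> \<ge> \<bar>C\<^sub>n t\<bar> + \<bar>C\<^bsub>n-1\<^esub> t\<bar>\<close>, which is at least a multiple of \<open>n\<^bsup>\<nu>-1\<^esup>\<close> for all
  \<open>t\<close> in \<open>[-1, 1]\<close> by a Turan-type monotonicity. So the sum over the nodes is large at
  \<open>e\<close> or at \<open>- e\<close>.\<close>

section \<open>Gegenbauer polynomials\<close>

text \<open>A cubature formula tests functions only at its nodes, so the sums of \<lambda> |K_n| can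
  be compared with an integral only through a polynomial majorant. The obvious one, the square of
  k_n combined with Cauchy-Schwarz, gives n^(D/2) at boundary points and loses a factor n^(1/2).
  Halving the parameter avoids this loss: for its own weight sin^(2 \<sigma>), with 2 \<sigma> =
  \<nu>, the square of C^\<sigma>_k has an integral of order k^(\<nu> - 2), and these orders add up
  to n^(\<nu> - 1). However, the measure of the sphere in one coordinate is sin^(D - 1), and D - 1
  >= 2 \<sigma> only for D >= 3. The remaining case D = 2, that is d = 1 and \<mu> = 1/2, needs an
  estimate of its own.

  The sphere enters only through one fact: the operator in Gegenbauer's equation is symmetric for
  every bilinear form that satisfies the two moment recurrences. Orthogonality, the values on the
  diagonal and the reproducing property all follow from it. The same abstract result serves the
  integrals over the ball and the norms in one variable.\<close>

fun gegenbauer :: "real \<Rightarrow> nat \<Rightarrow> real poly" where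
  "gegenbauer l 0 = 1"
| "gegenbauer l (Suc 0) = [:0, 2 * l:]"
| "gegenbauer l (Suc (Suc n)) =
     smult (1 / (n + 2)) (smult (2 * (real n + 1 + l)) (pCons 0 (gegenbauer l (Suc n)))
       - smult (real n + 2 * l) (gegenbauer l n))"

declare gegenbauer.simps(3) [simp del]

lemma poly_gegenbauer_rec:
  "(real n + 2) * poly (gegenbauer l (Suc (Suc n))) x =
     2 * (real n + 1 + l) * x * poly (gegenbauer l (Suc n)) x - (real n + 2 * l) * poly (gegenbauer l n) x"
  by (simp add: gegenbauer.simps(3) field_simps)

lemma poly_pderiv_gegenbauer_rec:
  "(real n + 2) * poly (pderiv (gegenbauer l (Suc (Suc n)))) x =
     2 * (real n + 1 + l) * (poly (gegenbauer l (Suc n)) x + x * poly (pderiv (gegenbauer l (Suc n))) x)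
       - (real n + 2 * l) * poly (pderiv (gegenbauer l n)) x"
  by (simp add: gegenbauer.simps(3) pderiv_smult pderiv_diff pderiv_pCons field_simps)

text \<open>The two identities need a joint induction: each one at n + 1 comes from the other one at
  n. The link is the differentiated recurrence, which the first identity reduces to d2 = d0 + 2 (n +
  1 + l) c1.\<close>

lemma gegenbauer_deriv_aux:
  fixes l x :: real
  shows "x * poly (pderiv (gegenbauer l (Suc n))) x =
           (n + 1) * poly (gegenbauer l (Suc n)) x + poly (pderiv (gegenbauer l n)) x
       \<and> x * poly (pderiv (gegenbauer l n)) x =
           poly (pderiv (gegenbauer l (Suc n))) x - (real n + 2 * l) * poly (gegenbauer l n) x"
proof (induction n)
  case 0
  then show ?case by (simp add: pderiv_pCons)
next
  case (Suc n)
  define c0 c1 c2 where "c0 = poly (gegenbauer l n) x" and "c1 = poly (gegenbauer l (Suc n)) x"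
    and "c2 = poly (gegenbauer l (Suc (Suc n))) x"
  define d0 d1 d2 where "d0 = poly (pderiv (gegenbauer l n)) x"
    and "d1 = poly (pderiv (gegenbauer l (Suc n))) x"
    and "d2 = poly (pderiv (gegenbauer l (Suc (Suc n)))) x"
  have r: "(real n + 2) * c2 = 2 * (real n + 1 + l) * x * c1 - (real n + 2 * l) * c0"
    unfolding c0_def c1_def c2_def using poly_gegenbauer_rec[of n l x] by simp
  have r': "(real n + 2) * d2 = 2 * (real n + 1 + l) * (c1 + x * d1) - (real n + 2 * l) * d0"
    unfolding c1_def d0_def d1_def d2_def using poly_pderiv_gegenbauer_rec[of n l x] by simp
  have i1: "x * d1 = (real n + 1) * c1 + d0" and i2: "x * d0 = d1 - (real n + 2 * l) * c0"
    using Suc unfolding c0_def c1_def d0_def d1_def by auto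
  have "(real n + 2) * d2 = (real n + 2) * (d0 + 2 * (real n + 1 + l) * c1)"
    unfolding r' i1 by (simp add: algebra_simps)
  then have d2: "d2 = d0 + 2 * (real n + 1 + l) * c1"
    by simp
  have "x * d2 = (real n + 2) * c2 + d1"
    unfolding d2 r using i2 by (simp add: algebra_simps)
  moreover have "x * d1 = d2 - (real n + 1 + 2 * l) * c1"
    unfolding d2 i1 by (simp add: algebra_simps)
  ultimately show ?case
    unfolding c1_def c2_def d1_def d2_def by (simp add: algebra_simps)
qed

lemmas x_pderiv_gegenbauer_Suc = gegenbauer_deriv_aux [THEN conjunct1]
  and x_pderiv_gegenbauer = gegenbauer_deriv_aux [THEN conjunct2]

lemma pderiv_gegenbauer_Suc_Suc:
  fixes l x :: real
  shows "poly (pderiv (gegenbauer l (Suc (Suc n)))) x =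
     poly (pderiv (gegenbauer l n)) x + 2 * (real n + 1 + l) * poly (gegenbauer l (Suc n)) x"
  using x_pderiv_gegenbauer_Suc[of x l n] x_pderiv_gegenbauer[of x l "Suc n"]
  by (simp add: algebra_simps)

text \<open>The two derivative identities combine to (1 - x^2) C_n' = (n + 2 l) x C_n - (n + 1)
  C_(n+1). Differentiating this once and eliminating the derivative of C_(n+1) leaves an equation in
  C_n alone.\<close>

lemma gegenbauer_ode:
  fixes l x :: real
  shows "(1 - x\<^sup>2) * poly (pderiv (pderiv (gegenbauer l n))) x
     - (2 * l + 1) * x * poly (pderiv (gegenbauer l n)) x
     + n * (real n + 2 * l) * poly (gegenbauer l n) x = 0"
proof -
  let ?c = "gegenbauer l n" and ?c1 = "gegenbauer l (Suc n)"
  have *: "[:1, 0, -1:] * pderiv ?c = smult (real n + 2 * l) (pCons 0 ?c) - smult (real n + 1) ?c1"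
  proof (rule poly_ext)
    fix x :: real
    show "poly ([:1, 0, -1:] * pderiv ?c) x = poly (smult (real n + 2 * l) (pCons 0 ?c) - smult (real n + 1) ?c1) x"
      using x_pderiv_gegenbauer_Suc[of x l n] arg_cong[OF x_pderiv_gegenbauer[of x l n], of "(*) x"]
      by (simp add: algebra_simps)
  qed
  have "poly (pderiv ([:1, 0, -1:] * pderiv ?c)) x =
      (1 - x\<^sup>2) * poly (pderiv (pderiv ?c)) x - 2 * x * poly (pderiv ?c) x"
    unfolding pderiv_mult by (simp add: pderiv_pCons algebra_simps power2_eq_square)
  moreover have "poly (pderiv (smult (real n + 2 * l) (pCons 0 ?c) - smult (real n + 1) ?c1)) x =
      (real n + 2 * l) * (poly ?c x + x * poly (pderiv ?c) x) - (real n + 1) * poly (pderiv ?c1) x"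
    by (simp add: pderiv_smult pderiv_diff pderiv_pCons algebra_simps)
  moreover have "poly (pderiv ?c1) x = x * poly (pderiv ?c) x + (real n + 2 * l) * poly ?c x"
    using x_pderiv_gegenbauer[of x l n] by simp
  ultimately have "(1 - x\<^sup>2) * poly (pderiv (pderiv ?c)) x - 2 * x * poly (pderiv ?c) x =
      (real n + 2 * l) * (poly ?c x + x * poly (pderiv ?c) x)
        - (real n + 1) * (x * poly (pderiv ?c) x + (real n + 2 * l) * poly ?c x)"
    by (simp only: *)
  then show ?thesis
    by (simp add: algebra_simps)
qed

text \<open>Eliminating the undifferentiated polynomial between the two relations \<open>a\<close>
  and \<open>b\<close> shows that the derivatives obey the three-term recurrence of parameter l +
  1.\<close>

lemma pderiv_gegenbauer:
  "pderiv (gegenbauer l (Suc n)) = smult (2 * l) (gegenbauer (l + 1) n)"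
proof (induction n rule: less_induct)
  case (less n)
  show ?case
  proof (rule poly_ext)
    fix x :: real
    consider "n = 0" | "n = 1" | k where "n = Suc (Suc k)"
      by (metis One_nat_def old.nat.exhaust)
    then show "poly (pderiv (gegenbauer l (Suc n))) x = poly (smult (2 * l) (gegenbauer (l + 1) n)) x"
    proof cases
      case 1 then show ?thesis by (simp add: pderiv_pCons)
    next
      case 2 then show ?thesis
        by (simp add: gegenbauer.simps(3) numeral_2_eq_2 pderiv_pCons pderiv_smult pderiv_diff field_simps)
    next
      case 3
      define d where "d j = poly (pderiv (gegenbauer l j)) x" for j
      have e: "d (Suc j) = 2 * l * poly (gegenbauer (l + 1) j) x" if "j < n" for j
        using less.IH[OF that] by (simp add: d_def)
      have a: "x * d (k + 2) = d (k + 3) - (k + 2 + 2 * l) * poly (gegenbauer l (k + 2)) x"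
        using x_pderiv_gegenbauer[of x l "k + 2"] by (simp add: d_def eval_nat_numeral algebra_simps)
      have b: "d (k + 3) = d (k + 1) + 2 * (k + 2 + l) * poly (gegenbauer l (k + 2)) x"
        using pderiv_gegenbauer_Suc_Suc[of l "k+1" x] by (simp add: d_def eval_nat_numeral algebra_simps)
      have "(real k + 2) * d (k + 3) = 2 * (k + 2 + l) * (x * d (k + 2)) - (k + 2 * l + 2) * d (k + 1)"
        unfolding a b by (simp add: algebra_simps)
      also have "\<dots> = 2 * l * ((real k + 2) * poly (gegenbauer (l + 1) (Suc (Suc k))) x)"
        using e[of "Suc k"] e[of k] 3 unfolding poly_gegenbauer_rec
        by (simp add: algebra_simps)
      finally have "(real k + 2) * d (k + 3) = (real k + 2) * (2 * l * poly (gegenbauer (l + 1) n) x)"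
        by (simp add: 3)
      then have "d (k + 3) = 2 * l * poly (gegenbauer (l + 1) n) x"
        by simp
      then show ?thesis by (simp add: d_def 3 eval_nat_numeral)
    qed
  qed
qed

text \<open>The summands are the zonal harmonics of the sphere of dimension 2 l + 1 with normalised
  surface measure, as functions of the inner product of two points.\<close>

definition gegenbauer_kernel :: "real \<Rightarrow> nat \<Rightarrow> real poly" where
  "gegenbauer_kernel l n = (\<Sum>k\<le>n. smult ((k + l) / l) (gegenbauer l k))"

text \<open>By \<open>pderiv_gegenbauer_Suc_Suc\<close> the sum telescopes to C'_(n+1) + C'_n, up to
  the factor 2 l, and differentiation raises the parameter by one. The successor is there because
  C_(n-1) has to exist.\<close>

lemma poly_gegenbauer_kernel:
  fixes l x :: real
  assumes "l > 0"
  shows "poly (gegenbauer_kernel l (Suc n)) x =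
    poly (gegenbauer (l + 1) (Suc n)) x + poly (gegenbauer (l + 1) n) x"
proof -
  have "2 * l * poly (gegenbauer_kernel l n) x =
      poly (pderiv (gegenbauer l (Suc n))) x + poly (pderiv (gegenbauer l n)) x" for n
  proof (induction n)
    case 0
    then show ?case using assms by (simp add: gegenbauer_kernel_def pderiv_pCons)
  next
    case (Suc n)
    have "2 * l * poly (gegenbauer_kernel l (Suc n)) x =
        2 * l * poly (gegenbauer_kernel l n) x + 2 * (real n + 1 + l) * poly (gegenbauer l (Suc n)) x"
      using assms by (simp add: gegenbauer_kernel_def field_simps)
    then show ?case
      using Suc pderiv_gegenbauer_Suc_Suc[of l n x] by simp
  qed
  from this[of "Suc n"] have "2 * l * poly (gegenbauer_kernel l (Suc n)) x =
      2 * l * (poly (gegenbauer (l + 1) (Suc n)) x + poly (gegenbauer (l + 1) n) x)"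
    by (simp add: pderiv_gegenbauer algebra_simps)
  with assms show ?thesis by simp
qed

lemma poly_gegenbauer_minus:
  "poly (gegenbauer l n) (- x) = (-1) ^ n * poly (gegenbauer l n) x"
  by (induction l n rule: gegenbauer.induct) (simp_all add: gegenbauer.simps(3) algebra_simps)

lemma poly_gegenbauer_1:
  "poly (gegenbauer l n) 1 = pochhammer (2 * l) n / fact n"
proof (induction l n rule: gegenbauer.induct)
  case (3 l n)
  define p where "p = pochhammer (2 * l) n / fact n"
  have p1: "pochhammer (2 * l) (Suc n) / fact (Suc n) = (2 * l + n) / (n + 1) * p"
    by (simp add: p_def pochhammer_Suc)
  have p2: "pochhammer (2 * l) (Suc (Suc n)) / fact (Suc (Suc n)) = (2 * l + n + 1) / (n + 2) * ((2 * l + n) / (n + 1) * p)"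
    by (simp add: p_def pochhammer_Suc divide_simps)
  have "(real n + 2) * poly (gegenbauer l (Suc (Suc n))) 1 =
      2 * (real n + 1 + l) * ((2 * l + n) / (n + 1) * p) - (real n + 2 * l) * p"
    unfolding poly_gegenbauer_rec 3 p1 by (simp add: p_def)
  also have "\<dots> = (real n + 2) * ((2 * l + n + 1) / (n + 2) * ((2 * l + n) / (n + 1) * p))"
    by (simp add: divide_simps) (simp add: algebra_simps)
  finally show ?case
    unfolding p2 by (subst (asm) mult_cancel_left) auto
qed auto

lemma coeff_gegenbauer_eq_0: "n < i \<Longrightarrow> coeff (gegenbauer l n) i = 0"
  by (induction l n arbitrary: i rule: gegenbauer.induct)
     (auto simp: gegenbauer.simps(3) coeff_pCons split: nat.splits)

lemma degree_gegenbauer_le: "degree (gegenbauer l n) \<le> n"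
  by (rule degree_le) (simp add: coeff_gegenbauer_eq_0)

lemma coeff_gegenbauer_pos: "l > 0 \<Longrightarrow> coeff (gegenbauer l n) n > 0"
  by (induction l n rule: gegenbauer.induct)
     (auto simp: gegenbauer.simps(3) coeff_gegenbauer_eq_0 intro!: divide_pos_pos)

section \<open>Generating function and the majorant by squares\<close>

definition gegenbauer_fps :: "real \<Rightarrow> real \<Rightarrow> real fps" where
  "gegenbauer_fps l x = Abs_fps (\<lambda>n. poly (gegenbauer l n) x)"

text \<open>The differential equation is the logarithmic derivative of (1 - 2 x T + T^2)^(-l),
  cleared of the denominator. An equivalence is wanted because \<open>gegenbauer_fps_mult\<close>
  uses both directions: from recurrence to equation for the factors, and back for the
  product.\<close>

lemma gegenbauer_fps_ode_iff:
  fixes G :: "real fps" and l x :: real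
  shows "(1 - fps_const (2 * x) * fps_X + fps_X ^ 2) * fps_deriv G = fps_const (2 * l) * (fps_const x - fps_X) * G
    \<longleftrightarrow> fps_nth G 1 = 2 * l * x * fps_nth G 0 \<and>
      (\<forall>n. (real n + 2) * fps_nth G (n + 2) = 2 * (real n + 1 + l) * x * fps_nth G (n + 1) - (real n + 2 * l) * fps_nth G n)"
  (is "?A = ?B \<longleftrightarrow> _")
proof -
  have A: "?A = fps_deriv G - fps_const (2 * x) * (fps_X * fps_deriv G) + fps_X * (fps_X * fps_deriv G)"
    by (simp add: algebra_simps power2_eq_square)
  have B: "?B = fps_const (2 * l * x) * G - fps_const (2 * l) * (fps_X * G)"
    by (simp add: algebra_simps fps_const_mult[symmetric] del: fps_const_mult)
  have n0: "fps_nth ?A 0 = fps_nth ?B 0 \<longleftrightarrow> fps_nth G 1 = 2 * l * x * fps_nth G 0"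
    unfolding A B by simp
  have n1: "fps_nth ?A (Suc n) = fps_nth ?B (Suc n) \<longleftrightarrow>
     (real n + 2) * fps_nth G (n + 2) = 2 * (real n + 1 + l) * x * fps_nth G (n + 1) - (real n + 2 * l) * fps_nth G n" for n
    unfolding A B by (cases n) (auto simp: algebra_simps)
  show ?thesis
    unfolding fps_eq_iff[of ?A] using n0 n1 by (metis not0_implies_Suc)
qed

text \<open>Logarithmic derivatives add under multiplication, so the product solves the equation of
  parameter a + b. Its constant term 1 then determines every coefficient.\<close>

lemma gegenbauer_fps_mult:
  "gegenbauer_fps a x * gegenbauer_fps b x = gegenbauer_fps (a + b) x"
proof -
  let ?Q = "1 - fps_const (2 * x) * fps_X + fps_X ^ 2 :: real fps"
  have ode: "?Q * fps_deriv (gegenbauer_fps l x) = fps_const (2 * l) * (fps_const x - fps_X) * gegenbauer_fps l x" for l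
    unfolding gegenbauer_fps_ode_iff using poly_gegenbauer_rec[of _ l x] by (simp add: gegenbauer_fps_def)
  define H where "H = gegenbauer_fps a x * gegenbauer_fps b x"
  have "?Q * fps_deriv H = (?Q * fps_deriv (gegenbauer_fps a x)) * gegenbauer_fps b x
      + gegenbauer_fps a x * (?Q * fps_deriv (gegenbauer_fps b x))"
    by (simp add: H_def algebra_simps)
  also have "\<dots> = fps_const (2 * (a + b)) * (fps_const x - fps_X) * H"
    unfolding ode H_def by (simp add: algebra_simps flip: fps_const_add fps_const_mult)
  finally have H1: "fps_nth H 1 = 2 * (a + b) * x * fps_nth H 0"
    and H2: "(real n + 2) * fps_nth H (n + 2) = 2 * (real n + 1 + (a + b)) * x * fps_nth H (n + 1) - (real n + 2 * (a + b)) * fps_nth H n" for n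
    unfolding gegenbauer_fps_ode_iff by blast+
  have H0: "fps_nth H 0 = 1"
    by (simp add: H_def gegenbauer_fps_def)
  have "fps_nth H n = poly (gegenbauer (a + b) n) x \<and> fps_nth H (Suc n) = poly (gegenbauer (a + b) (Suc n)) x" for n
  proof (induction n)
    case 0
    then show ?case using H0 H1 by simp
  next
    case (Suc n)
    have "(real n + 2) * fps_nth H (n + 2) = (real n + 2) * poly (gegenbauer (a + b) (n + 2)) x"
      using H2[of n] Suc poly_gegenbauer_rec[of n "a + b" x] by simp
    with Suc show ?case by simp
  qed
  then show ?thesis
    by (simp add: H_def gegenbauer_fps_def fps_eq_iff)
qed

lemma poly_gegenbauer_add:
  "poly (gegenbauer (a + b) n) x = (\<Sum>k\<le>n. poly (gegenbauer a k) x * poly (gegenbauer b (n - k)) x)"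
proof -
  have "poly (gegenbauer (a + b) n) x = fps_nth (gegenbauer_fps a x * gegenbauer_fps b x) n"
    unfolding gegenbauer_fps_mult by (simp add: gegenbauer_fps_def)
  then show ?thesis
    by (simp add: fps_mult_nth gegenbauer_fps_def atLeast0AtMost)
qed

text \<open>The arithmetic-geometric inequality is applied to each product of the convolution;
  reversing the index shows that both halves give the same sum. The room between n and N lets one
  majorant serve two consecutive polynomials.\<close>

lemma abs_gegenbauer_le_sum_squares:
  fixes l x :: real
  assumes "n \<le> N"
  shows "\<bar>poly (gegenbauer l n) x\<bar> \<le> (\<Sum>k\<le>N. (poly (gegenbauer (l / 2) k) x)\<^sup>2)"
proof -
  let ?c = "\<lambda>k. poly (gegenbauer (l / 2) k) x"
  have "\<bar>poly (gegenbauer l n) x\<bar> = \<bar>\<Sum>k\<le>n. ?c k * ?c (n - k)\<bar>"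
    using poly_gegenbauer_add[of "l / 2" "l / 2" n x] by simp
  also have "\<dots> \<le> (\<Sum>k\<le>n. ((?c k)\<^sup>2 + (?c (n - k))\<^sup>2) / 2)"
  proof (intro order_trans[OF sum_abs] sum_mono)
    fix k
    show "\<bar>?c k * ?c (n - k)\<bar> \<le> ((?c k)\<^sup>2 + (?c (n - k))\<^sup>2) / 2"
      using sum_squares_bound[of "\<bar>?c k\<bar>" "\<bar>?c (n - k)\<bar>"] by (simp add: abs_mult)
  qed
  also have "\<dots> = ((\<Sum>k\<le>n. (?c k)\<^sup>2) + (\<Sum>k\<le>n. (?c (n - k))\<^sup>2)) / 2"
    by (simp add: sum.distrib sum_divide_distrib[symmetric])
  also have "(\<Sum>k\<le>n. (?c (n - k))\<^sup>2) = (\<Sum>k\<le>n. (?c k)\<^sup>2)"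
    by (simp add: sum.nat_diff_reindex atMost_atLeast0 sum.atLeastAtMost_rev[of "\<lambda>k. (?c k)\<^sup>2" 0 n])
  also have "(\<Sum>k\<le>n. (?c k)\<^sup>2) \<le> (\<Sum>k\<le>N. (?c k)\<^sup>2)"
    using assms by (intro sum_mono2) auto
  finally show ?thesis by simp
qed

section \<open>Bilinear forms compatible with Gegenbauer's equation\<close>

definition poly_linear :: "(real poly \<Rightarrow> real) \<Rightarrow> bool" where
  "poly_linear f \<longleftrightarrow> (\<forall>p q. f (p + q) = f p + f q) \<and> (\<forall>c p. f (smult c p) = c * f p)"

lemma poly_linearI:
  "(\<And>p q. f (p + q) = f p + f q) \<Longrightarrow> (\<And>c p. f (smult c p) = c * f p) \<Longrightarrow> poly_linear f"
  by (simp add: poly_linear_def)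

lemma poly_linear_add: "poly_linear f \<Longrightarrow> f (p + q) = f p + f q"
  and poly_linear_smult: "poly_linear f \<Longrightarrow> f (smult c p) = c * f p"
  by (simp_all add: poly_linear_def)

lemma poly_linear_0: "poly_linear f \<Longrightarrow> f 0 = 0"
  using poly_linear_smult[of f 0 0] by simp

lemma poly_linear_diff: "poly_linear f \<Longrightarrow> f (p - q) = f p - f q"
  using poly_linear_add[of f p "smult (-1) q"] poly_linear_smult[of f "-1" q] by simp

lemma poly_linear_sum:
  assumes "poly_linear f"
  shows "f (\<Sum>i\<in>A. g i) = (\<Sum>i\<in>A. f (g i))"
  by (induction A rule: infinite_finite_induct) (simp_all add: assms poly_linear_0 poly_linear_add)

lemma poly_linear_expand:
  assumes "poly_linear f" "degree p \<le> n"
  shows "f p = (\<Sum>i\<le>n. coeff p i * f (monom 1 i))"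
proof -
  have "f p = f (\<Sum>i\<le>n. smult (coeff p i) (monom 1 i))"
    using poly_as_sum_of_monoms'[OF assms(2)] by (simp add: smult_monom)
  then show ?thesis
    by (simp add: poly_linear_sum[OF assms(1)] poly_linear_smult[OF assms(1)])
qed

lemma poly_linear_eqI:
  assumes "poly_linear f" "poly_linear g" "\<And>n. f (monom 1 n) = g (monom 1 n)"
  shows "f p = g p"
  using poly_linear_expand[OF assms(1) order_refl, of p] poly_linear_expand[OF assms(2) order_refl, of p] assms(3)
  by simp

definition moment_functional :: "(nat \<Rightarrow> real) \<Rightarrow> real poly \<Rightarrow> real" where
  "moment_functional f p = (\<Sum>i\<le>degree p. coeff p i * f i)"

lemma moment_functional_eq:
  assumes "degree p \<le> n"
  shows "moment_functional f p = (\<Sum>i\<le>n. coeff p i * f i)"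
  unfolding moment_functional_def using assms
  by (intro sum.mono_neutral_left) (auto simp: coeff_eq_0)

lemma poly_linear_moment_functional: "poly_linear (moment_functional f)"
proof (rule poly_linearI)
  fix p q :: "real poly"
  have "degree (p + q) \<le> max (degree p) (degree q)"
    by (rule degree_add_le_max)
  then show "moment_functional f (p + q) = moment_functional f p + moment_functional f q"
    by (simp add: moment_functional_eq[where n="max (degree p) (degree q)"] algebra_simps sum.distrib)
next
  fix c and p :: "real poly"
  show "moment_functional f (smult c p) = c * moment_functional f p"
    by (simp add: moment_functional_eq[where n="degree p"] degree_smult_le sum_distrib_left algebra_simps)
qed

lemma moment_functional_monom: "moment_functional f (monom c n) = c * f n"
proof -
  have "moment_functional f (monom c n) = (\<Sum>i\<le>n. coeff (monom c n) i * f i)"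
    by (intro moment_functional_eq degree_monom_le)
  also have "\<dots> = (\<Sum>i\<le>n. if n = i then c * f i else 0)"
    by (intro sum.cong) auto
  finally show ?thesis by simp
qed

definition bilinear_form :: "(nat \<Rightarrow> nat \<Rightarrow> real) \<Rightarrow> real poly \<Rightarrow> real poly \<Rightarrow> real" where
  "bilinear_form B g h = moment_functional (\<lambda>i. moment_functional (B i) h) g"

lemma bilinear_form_swap: "bilinear_form B g h = bilinear_form (\<lambda>i j. B j i) h g"
  unfolding bilinear_form_def moment_functional_def
  unfolding sum_distrib_left by (subst sum.swap) (simp add: mult.left_commute)

lemma poly_linear_bilinear_form_left: "poly_linear (\<lambda>g. bilinear_form B g h)"
  unfolding bilinear_form_def by (rule poly_linear_moment_functional)

lemma poly_linear_bilinear_form_right: "poly_linear (\<lambda>h. bilinear_form B g h)"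
  by (subst bilinear_form_swap) (rule poly_linear_bilinear_form_left)

lemma bilinear_form_monom: "bilinear_form B (monom c i) (monom d j) = c * d * B i j"
  unfolding bilinear_form_def by (simp add: moment_functional_monom)

text \<open>Since leading coefficients are positive, the polynomials with index below k span
  everything of degree below k. The bound is put on coefficients rather than on the degree so that
  the zero polynomial is covered at k = 0, where the induction starts.\<close>

lemma poly_linear_gegenbauer_eq_0:
  assumes "poly_linear f" "l > 0" "\<And>j. j < k \<Longrightarrow> f (gegenbauer l j) = 0" "\<And>i. i \<ge> k \<Longrightarrow> coeff p i = 0"
  shows "f p = 0"
  using assms(3,4)
proof (induction k arbitrary: p)
  case 0
  then have "p = 0" by (simp add: poly_eq_iff)
  then show ?case using poly_linear_0[OF assms(1)] by simp
next
  case (Suc k)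
  define c where "c = coeff p k / coeff (gegenbauer l k) k"
  have *: "coeff (p - smult c (gegenbauer l k)) i = 0" if "i \<ge> k" for i
    using Suc.prems(2)[of i] that coeff_gegenbauer_pos[OF assms(2), of k] coeff_gegenbauer_eq_0[of k i l]
    by (cases "i = k") (auto simp: c_def)
  have "f (p - smult c (gegenbauer l k)) = 0"
    by (rule Suc.IH) (use Suc.prems(1) * in auto)
  then show ?case
    using Suc.prems(1)[of k] by (simp add: poly_linear_diff[OF assms(1)] poly_linear_smult[OF assms(1)])
qed

text \<open>This is the Laplace-Beltrami operator of the sphere of dimension 2 l + 1, acting on
  functions of X . Y with Y fixed.\<close>

definition gegenbauer_op :: "real \<Rightarrow> real poly \<Rightarrow> real poly" where
  "gegenbauer_op l p = pderiv (pderiv p) - pCons 0 (pCons 0 (pderiv (pderiv p)))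
     - smult (2 * l + 1) (pCons 0 (pderiv p))"

lemma gegenbauer_op_add: "gegenbauer_op l (p + q) = gegenbauer_op l p + gegenbauer_op l q"
  by (rule poly_ext) (simp add: gegenbauer_op_def pderiv_add algebra_simps)

lemma gegenbauer_op_smult: "gegenbauer_op l (smult c p) = smult c (gegenbauer_op l p)"
  by (rule poly_ext) (simp add: gegenbauer_op_def pderiv_smult algebra_simps)

lemma gegenbauer_op_monom:
  "gegenbauer_op l (monom 1 n) = monom (real n * (real n - 1)) (n - 2) - monom (real n * (n + 2 * l)) n"
proof -
  consider "n = 0" | "n = 1" | k where "n = Suc (Suc k)"
    by (metis One_nat_def old.nat.exhaust)
  then show ?thesis
    by cases (auto simp: gegenbauer_op_def pderiv_monom poly_monom algebra_simps intro!: poly_ext)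
qed

lemma gegenbauer_op_gegenbauer:
  "gegenbauer_op l (gegenbauer l n) = smult (- (real n * (n + 2 * l))) (gegenbauer l n)"
proof (rule poly_ext)
  fix x
  show "poly (gegenbauer_op l (gegenbauer l n)) x = poly (smult (- (real n * (n + 2 * l))) (gegenbauer l n)) x"
    using gegenbauer_ode[of x l n] by (simp add: gegenbauer_op_def algebra_simps power2_eq_square)
qed

text \<open>The model case is the form \<open>(g, h) \<mapsto> \<integral> g (X \<bullet> Y) h (X \<bullet> Z) dX\<close> on a sphere of dimension
  \<open>2 * l + 1\<close>, with \<open>v = Y \<bullet> Z\<close>; the two rules are integration by parts along the tangential
  parts of \<open>Y\<close> and \<open>Z\<close>.\<close>

locale gegenbauer_form =
  fixes l v :: real and B :: "nat \<Rightarrow> nat \<Rightarrow> real"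
  assumes l_pos: "l > 0"
    and left_rule: "\<And>N k. (real N + k + 2 * l + 1) * B (Suc N) k = N * B (N - 1) k + k * v * B N (k - 1)"
    and right_rule: "\<And>N k. (real N + k + 2 * l + 1) * B N (Suc k) = k * B N (k - 1) + N * v * B (N - 1) k"
begin

abbreviation form :: "real poly \<Rightarrow> real poly \<Rightarrow> real" where
  "form \<equiv> bilinear_form B"

lemmas form_left = poly_linear_bilinear_form_left[of B]
  and form_right = poly_linear_bilinear_form_right[of B]

lemmas form_simps =
  poly_linear_add[OF form_left] poly_linear_add[OF form_right]
  poly_linear_diff[OF form_left] poly_linear_diff[OF form_right]
  poly_linear_smult[OF form_left] poly_linear_smult[OF form_right]
  poly_linear_0[OF form_left] poly_linear_0[OF form_right]

text \<open>Green's formula for monomials. In the model the tangential gradients of g (X . Y) and h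
  (X . Z) have inner product g' h' (v - (X . Y) (X . Z)), so \<open>R\<close> is minus the Dirichlet
  form. Each locale rule moves the operator off one of the two arguments.\<close>

lemma form_op_monom:
  fixes N k :: nat
  defines "R \<equiv> form (pCons 0 (pderiv (monom 1 N))) (pCons 0 (pderiv (monom 1 k)))
        - v * form (pderiv (monom 1 N)) (pderiv (monom 1 k))"
  shows "form (gegenbauer_op l (monom 1 N)) (monom 1 k) = R"
    and "form (monom 1 N) (gegenbauer_op l (monom 1 k)) = R"
proof -
  have X: "pCons 0 (monom (of_nat n * 1 :: real) (n - 1)) = monom (real n) n" for n by (cases n) (simp_all flip: monom_Suc)
  have R: "R = real N * k * B N k - v * (real N * k * B (N - 1) (k - 1))"
    unfolding R_def pderiv_monom X bilinear_form_monom by simp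
  show "form (gegenbauer_op l (monom 1 N)) (monom 1 k) = R"
    unfolding R gegenbauer_op_monom using arg_cong[OF left_rule[of "N - 1" k], of "(*) (real N)"]
    by (cases N) (simp_all add: bilinear_form_monom form_simps algebra_simps)
  show "form (monom 1 N) (gegenbauer_op l (monom 1 k)) = R"
    unfolding R gegenbauer_op_monom using arg_cong[OF right_rule[of N "k - 1"], of "(*) (real k)"]
    by (cases k) (simp_all add: bilinear_form_monom form_simps algebra_simps)
qed

lemma form_op_left:
  "form (gegenbauer_op l g) h = form (pCons 0 (pderiv g)) (pCons 0 (pderiv h)) - v * form (pderiv g) (pderiv h)"
  (is "?P g h = ?Q g h")
proof -
  have pC: "pCons 0 (p + q) = pCons 0 p + pCons 0 q" "pCons 0 (smult c p) = smult c (pCons 0 p)" for p q :: "real poly" and c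
    by simp_all
  have g: "poly_linear (\<lambda>g. ?P g h)" "poly_linear (\<lambda>g. ?Q g h)" for h
    by (rule poly_linearI; simp only: gegenbauer_op_add gegenbauer_op_smult pderiv_add pderiv_smult pC form_simps;
        simp add: algebra_simps)+
  have h: "poly_linear (\<lambda>h. ?P g h)" "poly_linear (\<lambda>h. ?Q g h)" for g
    by (rule poly_linearI; simp only: pderiv_add pderiv_smult pC form_simps; simp add: algebra_simps)+
  show ?thesis
    by (rule poly_linear_eqI[OF g], rule poly_linear_eqI[OF h], rule form_op_monom(1))
qed

lemma form_op_right: "form g (gegenbauer_op l h) = form (gegenbauer_op l g) h"
proof -
  have g: "poly_linear (\<lambda>g. form g (gegenbauer_op l h))" "poly_linear (\<lambda>g. form (gegenbauer_op l g) h)" for h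
    by (rule poly_linearI; simp add: gegenbauer_op_add gegenbauer_op_smult form_simps)+
  have h: "poly_linear (\<lambda>h. form g (gegenbauer_op l h))" "poly_linear (\<lambda>h. form (gegenbauer_op l g) h)" for g
    by (rule poly_linearI; simp add: gegenbauer_op_add gegenbauer_op_smult form_simps)+
  show ?thesis
    by (rule poly_linear_eqI[OF g], rule poly_linear_eqI[OF h]) (simp add: form_op_monom)
qed

text \<open>The operator is symmetric, and its eigenvalues - k (k + 2 l) are distinct because l >
  0.\<close>

lemma form_gegenbauer_orthogonal:
  assumes "j \<noteq> k"
  shows "form (gegenbauer l j) (gegenbauer l k) = 0"
proof -
  have "(real j * (j + 2 * l) - real k * (k + 2 * l)) * form (gegenbauer l j) (gegenbauer l k) = 0"
    using form_op_right[of "gegenbauer l j" "gegenbauer l k"]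
    by (simp add: gegenbauer_op_gegenbauer form_simps algebra_simps)
  moreover have "real j * (j + 2 * l) - real k * (k + 2 * l) = (real j - k) * (j + k + 2 * l)"
    by (simp add: algebra_simps)
  ultimately show ?thesis using assms l_pos by auto
qed

lemma form_gegenbauer_lower:
  assumes "\<And>i. i \<ge> k \<Longrightarrow> coeff p i = 0"
  shows "form p (gegenbauer l k) = 0" "form (gegenbauer l k) p = 0"
  by (rule poly_linear_gegenbauer_eq_0[where k=k, OF form_left l_pos form_gegenbauer_orthogonal assms]
      poly_linear_gegenbauer_eq_0[where k=k, OF form_right l_pos form_gegenbauer_orthogonal assms]; simp)+

text \<open>The diagonal values \<open>a\<close> and the corresponding values \<open>e\<close> for
  the derivatives are coupled by two relations: one expands a derivative, the other is Green's
  formula. Eliminating \<open>e\<close> leaves for (k + l) \<open>a k\<close> exactly the three-term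
  recurrence of the Gegenbauer polynomials at v; the initial values supply the factor.\<close>

lemma form_gegenbauer_same:
  "form (gegenbauer l k) (gegenbauer l k) = l * B 0 0 / (k + l) * poly (gegenbauer l k) v"
proof -
  define a where "a k = form (gegenbauer l k) (gegenbauer l k)" for k
  define e where "e k = form (pderiv (gegenbauer l k)) (pderiv (gegenbauer l k))" for k
  have low: "coeff (pderiv (gegenbauer l k)) i = 0" if "i \<ge> k" for i k
    using that by (simp add: coeff_pderiv coeff_gegenbauer_eq_0)
  have a0: "a 0 = B 0 0"
    using bilinear_form_monom[of B 1 0 1 0] by (simp add: a_def monom_0 one_pCons)
  have e0: "e 0 = 0" by (simp add: e_def form_simps)
  have e1: "e (Suc 0) = 4 * l\<^sup>2 * a 0"
  proof -
    have p: "pderiv (gegenbauer l (Suc 0)) = smult (2 * l) (gegenbauer l 0)"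
      by (subst pderiv_gegenbauer) simp
    show ?thesis
      unfolding e_def a_def p form_simps by (simp add: power2_eq_square)
  qed
  have cross: "form (pderiv (gegenbauer l k)) (gegenbauer l (Suc k)) = 0"
    "form (gegenbauer l (Suc k)) (pderiv (gegenbauer l k)) = 0" for k
    by (intro form_gegenbauer_lower low; simp)+
  have e: "e (Suc (Suc k)) = e k + 4 * (real k + 1 + l)\<^sup>2 * a (Suc k)" for k
  proof -
    have p: "pderiv (gegenbauer l (Suc (Suc k))) =
        pderiv (gegenbauer l k) + smult (2 * (real k + 1 + l)) (gegenbauer l (Suc k))"
      by (rule poly_ext) (simp add: pderiv_gegenbauer_Suc_Suc)
    show ?thesis
      unfolding e_def a_def p form_simps cross by (simp add: power2_eq_square algebra_simps)
  qed
  \<comment> \<open>Green's formula with both arguments equal. The mixed terms vanish because the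
    derivative of C_k has degree below k + 1.\<close>
  have d: "2 * (real k + 1) * (real k + 1 + l) * a (Suc k) = v * e (Suc k) - e k" for k
  proof -
    have p: "pCons 0 (pderiv (gegenbauer l (Suc k))) =
        smult (real k + 1) (gegenbauer l (Suc k)) + pderiv (gegenbauer l k)"
      by (rule poly_ext) (use x_pderiv_gegenbauer_Suc[of _ l k] in auto)
    have "- (real (Suc k) * (Suc k + 2 * l)) * a (Suc k) =
        (real k + 1) * ((real k + 1) * a (Suc k)) + e k - v * e (Suc k)"
      using form_op_left[of "gegenbauer l (Suc k)" "gegenbauer l (Suc k)"]
      unfolding gegenbauer_op_gegenbauer p form_simps cross e_def a_def by simp
    then show ?thesis
      by (simp add: algebra_simps)
  qed
  \<comment> \<open>This is \<open>d\<close> one index lower, with e (k - 1) replaced by means of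
    the recursion for \<open>e\<close>; in this form it also makes sense at k = 0.\<close>
  have q: "2 * real k * (k + l) * a k = v * e k - e (Suc k) + 4 * (k + l)\<^sup>2 * a k" for k
  proof (cases k)
    case 0
    then show ?thesis using e0 e1 by simp
  next
    case (Suc j)
    then show ?thesis using d[of j] e[of j] by (simp add: algebra_simps)
  qed
  have r: "(real k + 2) * ((real k + 2 + l) * a (Suc (Suc k))) =
      2 * (real k + 1 + l) * v * ((real k + 1 + l) * a (Suc k)) - (real k + 2 * l) * ((k + l) * a k)" for k
  proof -
    have "2 * (real k + 2) * (real k + 2 + l) * a (Suc (Suc k)) =
        v * (e k + 4 * (real k + 1 + l)\<^sup>2 * a (Suc k)) - e (Suc k)"
      using d[of "Suc k"] unfolding e by (simp add: algebra_simps)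
    also have "\<dots> = 4 * (real k + 1 + l)\<^sup>2 * v * a (Suc k) + (2 * real k * (k + l) * a k - 4 * (k + l)\<^sup>2 * a k)"
      unfolding q by (simp add: algebra_simps)
    finally show ?thesis
      by (simp add: algebra_simps power2_eq_square)
  qed
  have b: "(k + l) * a k = l * B 0 0 * poly (gegenbauer l k) v \<and>
      (real k + 1 + l) * a (Suc k) = l * B 0 0 * poly (gegenbauer l (Suc k)) v" for k
  proof (induction k)
    case 0
    then show ?case using d[of 0] e0 e1 a0 by (simp add: algebra_simps power2_eq_square)
  next
    case (Suc k)
    then have 1: "(k + l) * a k = l * B 0 0 * poly (gegenbauer l k) v"
      and 2: "(real k + 1 + l) * a (Suc k) = l * B 0 0 * poly (gegenbauer l (Suc k)) v"
      by blast+
    have "(real k + 2) * ((real k + 2 + l) * a (Suc (Suc k))) =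
        l * B 0 0 * ((real k + 2) * poly (gegenbauer l (Suc (Suc k))) v)"
      unfolding r poly_gegenbauer_rec 1 2 by (simp add: algebra_simps)
    then have "(real k + 2) * ((real k + 2 + l) * a (Suc (Suc k))) =
        (real k + 2) * (l * B 0 0 * poly (gegenbauer l (Suc (Suc k))) v)"
      by (simp only: mult.left_commute)
    then have "(real k + 2 + l) * a (Suc (Suc k)) = l * B 0 0 * poly (gegenbauer l (Suc (Suc k))) v"
      by (subst (asm) mult_cancel_left) linarith
    with 2 show ?case by (simp add: add.commute add.left_commute)
  qed
  have "real k + l \<noteq> 0" using l_pos by linarith
  then show ?thesis
    using b[of k] unfolding a_def by (simp add: field_simps)
qed

lemma form_gegenbauer:
  "form (gegenbauer l j) (gegenbauer l k) = (if j = k then l * B 0 0 / (k + l) * poly (gegenbauer l k) v else 0)"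
  using form_gegenbauer_orthogonal form_gegenbauer_same by simp

text \<open>It suffices to test h on Gegenbauer polynomials, where the weight (k + l) / l of the
  kernel cancels the factor l / (k + l) on the diagonal.\<close>

lemma form_gegenbauer_kernel:
  assumes "degree h \<le> n"
  shows "form (gegenbauer_kernel l n) h = B 0 0 * poly h v"
proof -
  define f where "f h = form (gegenbauer_kernel l n) h - B 0 0 * poly h v" for h
  have f: "poly_linear f"
    by (rule poly_linearI) (simp_all add: f_def form_simps algebra_simps)
  have f0: "f (gegenbauer l k) = 0" if "k < Suc n" for k
  proof -
    have "form (gegenbauer_kernel l n) (gegenbauer l k) =
        (\<Sum>j\<le>n. (j + l) / l * form (gegenbauer l j) (gegenbauer l k))"
      by (simp add: gegenbauer_kernel_def poly_linear_sum[OF form_left] form_simps)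
    also have "\<dots> = (\<Sum>j\<le>n. if j = k then (j + l) / l * (l * B 0 0 / (k + l) * poly (gegenbauer l k) v) else 0)"
      by (intro sum.cong) (auto simp: form_gegenbauer)
    also have "\<dots> = (k + l) / l * (l * B 0 0 / (k + l) * poly (gegenbauer l k) v)"
      using that by simp
    also have "\<dots> = B 0 0 * poly (gegenbauer l k) v"
    proof -
      have "real k + l \<noteq> 0" using l_pos by linarith
      then show ?thesis using l_pos by simp
    qed
    finally show ?thesis by (simp add: f_def)
  qed
  have "f h = 0"
    by (rule poly_linear_gegenbauer_eq_0[where k="Suc n", OF f l_pos f0])
       (use assms in \<open>simp_all add: coeff_eq_0\<close>)
  then show ?thesis by (simp add: f_def)
qed

end

section \<open>Estimates in one variable\<close>

text \<open>Exponent 0 occurs for m = 1, where the fibre is a circle. It is split off because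
  \<open>0 powr 0 = 0\<close> would make the weight discontinuous at the end points.\<close>

definition sin_weight :: "real \<Rightarrow> real \<Rightarrow> real" where
  "sin_weight q \<theta> = (if q = 0 then 1 else sin \<theta> powr q)"

lemma continuous_on_sin_weight: "q \<ge> 0 \<Longrightarrow> continuous_on {0..pi} (sin_weight q)"
  by (cases "q = 0") (auto simp: sin_weight_def sin_ge_zero intro!: continuous_intros continuous_on_powr')

lemma sin_weight_nonneg: "sin_weight q \<theta> \<ge> 0"
  by (simp add: sin_weight_def)

lemma sin_weight_mono:
  assumes "0 < q" "q \<le> q'" "\<theta> \<in> {0..pi}"
  shows "sin_weight q' \<theta> \<le> sin_weight q \<theta>"
  using assms powr_mono'[of q q' "sin \<theta>"] by (auto simp: sin_weight_def sin_ge_zero)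

text \<open>With t = cos \<theta> this is the integral of f (t) (1 - t^2)^((q - 1) / 2) over
  [-1, 1]. In the angle the weight stays bounded also for q < 1.\<close>

definition sin_integral :: "real \<Rightarrow> (real \<Rightarrow> real) \<Rightarrow> real" where
  "sin_integral q f = integral {0..pi} (\<lambda>\<theta>. f (cos \<theta>) * sin_weight q \<theta>)"

lemma sin_integral_integrable:
  assumes "q \<ge> 0" "continuous_on UNIV f"
  shows "(\<lambda>\<theta>. f (cos \<theta>) * sin_weight q \<theta>) integrable_on {0..pi}"
  by (intro integrable_continuous_real continuous_intros continuous_on_sin_weight
      continuous_on_compose2[OF assms(2)] assms(1)) auto

lemma sin_integral_add:
  assumes "q \<ge> 0" "continuous_on UNIV f" "continuous_on UNIV g"
  shows "sin_integral q (\<lambda>t. f t + g t) = sin_integral q f + sin_integral q g"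
  using integral_add[OF sin_integral_integrable[OF assms(1,2)] sin_integral_integrable[OF assms(1,3)]]
  by (simp add: sin_integral_def algebra_simps)

lemma sin_integral_cmult: "sin_integral q (\<lambda>t. c * f t) = c * sin_integral q f"
  by (simp add: sin_integral_def mult.assoc)

lemma sin_integral_sum:
  assumes "q \<ge> 0" "finite A" "\<And>i. i \<in> A \<Longrightarrow> continuous_on UNIV (f i)"
  shows "sin_integral q (\<lambda>t. \<Sum>i\<in>A. f i t) = (\<Sum>i\<in>A. sin_integral q (f i))"
  unfolding sin_integral_def sum_distrib_right
  by (intro integral_sum sin_integral_integrable assms)

lemma sin_integral_mono:
  assumes "q \<ge> 0" "continuous_on UNIV f" "continuous_on UNIV g"
    and "\<And>t. -1 \<le> t \<Longrightarrow> t \<le> 1 \<Longrightarrow> f t \<le> g t"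
  shows "sin_integral q f \<le> sin_integral q g"
  unfolding sin_integral_def
  by (intro integral_le sin_integral_integrable assms mult_right_mono sin_weight_nonneg) auto

lemma sin_integral_abs:
  assumes "q \<ge> 0" "continuous_on UNIV f"
  shows "\<bar>sin_integral q f\<bar> \<le> sin_integral q (\<lambda>t. \<bar>f t\<bar>)"
proof -
  have "sin_integral q f \<le> sin_integral q (\<lambda>t. \<bar>f t\<bar>)"
    "sin_integral q (\<lambda>t. - 1 * f t) \<le> sin_integral q (\<lambda>t. \<bar>f t\<bar>)"
    by (intro sin_integral_mono assms continuous_intros; simp)+
  then show ?thesis
    unfolding sin_integral_cmult by linarith
qed

lemma sin_integral_weight_mono:
  assumes "0 < q" "q \<le> q'" "continuous_on UNIV f" "\<And>t. f t \<ge> 0"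
  shows "sin_integral q' f \<le> sin_integral q f"
  unfolding sin_integral_def
  by (intro integral_le sin_integral_integrable mult_left_mono sin_weight_mono) (use assms in auto)

lemma sin_integral_1_pos:
  assumes "q \<ge> 0"
  shows "sin_integral q (\<lambda>_. 1) > 0"
proof -
  have c: "continuous_on {0..pi} (sin_weight q)"
    by (rule continuous_on_sin_weight[OF assms])
  have "integral {0..pi} (sin_weight q) \<ge> 0"
    by (intro integral_nonneg integrable_continuous_real c) (simp add: sin_weight_nonneg)
  moreover have "integral {0..pi} (sin_weight q) \<noteq> 0"
  proof
    assume "integral {0..pi} (sin_weight q) = 0"
    then have "\<forall>\<theta>\<in>{0..pi}. sin_weight q \<theta> = 0"
      using integral_eq_0_iff[OF c] by (simp add: sin_weight_nonneg)
    then have "sin_weight q (pi / 2) = 0"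
      by simp
    then show False by (simp add: sin_weight_def split: if_splits)
  qed
  ultimately show ?thesis by (simp add: sin_integral_def)
qed

text \<open>The derivative of sin^(q+1) cos^N is integrated; this function vanishes at 0 and at
  \<pi>.\<close>

lemma sin_integral_power_rec:
  assumes "q \<ge> 0"
  shows "(real N + q + 1) * sin_integral q (\<lambda>t. t ^ Suc N) = N * sin_integral q (\<lambda>t. t ^ (N - 1))"
proof -
  define F where "F \<theta> = sin_weight (q + 1) \<theta> * cos \<theta> ^ N" for \<theta>
  define F' where "F' \<theta> = ((real N + q + 1) * cos \<theta> ^ Suc N - N * cos \<theta> ^ (N - 1)) * sin_weight q \<theta>" for \<theta>
  have "(F' has_integral F pi - F 0) {0..pi}"
  proof (rule fundamental_theorem_of_calculus_interior)
    show "continuous_on {0..pi} F"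
      unfolding F_def using assms by (intro continuous_intros continuous_on_sin_weight) auto
  next
    fix \<theta> :: real assume t: "\<theta> \<in> {0<..<pi}"
    then have s: "sin \<theta> > 0" by (simp add: sin_gt_zero)
    have w: "sin_weight q \<theta> = sin \<theta> powr q"
      using s by (simp add: sin_weight_def)
    have "((\<lambda>\<theta>. sin \<theta> powr (q + 1) * cos \<theta> ^ N) has_real_derivative
        ((q + 1) * sin \<theta> powr q * cos \<theta> * cos \<theta> ^ N + sin \<theta> powr (q + 1) * (N * cos \<theta> ^ (N - 1) * (- sin \<theta>)))) (at \<theta>)"
    proof -
      have d: "((\<lambda>\<theta>. sin \<theta> powr (q + 1)) has_real_derivative (q + 1) * sin \<theta> powr q * cos \<theta>) (at \<theta>)"
        using DERIV_fun_powr[OF DERIV_sin s, of "q + 1"] by simp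
      show ?thesis
        using s by (auto intro!: derivative_eq_intros d)
    qed
    also have "(q + 1) * sin \<theta> powr q * cos \<theta> * cos \<theta> ^ N + sin \<theta> powr (q + 1) * (N * cos \<theta> ^ (N - 1) * (- sin \<theta>))
        = ((q + 1) * cos \<theta> ^ Suc N - N * cos \<theta> ^ (N - 1) * (sin \<theta>)\<^sup>2) * sin \<theta> powr q"
      using s by (simp add: powr_add algebra_simps power2_eq_square)
    also have "\<dots> = F' \<theta>"
      unfolding F'_def w sin_squared_eq
      by (cases N) (simp_all add: algebra_simps power2_eq_square)
    finally have "(F has_real_derivative F' \<theta>) (at \<theta>)"
      unfolding F_def using assms by (simp add: sin_weight_def)
    then show "(F has_vector_derivative F' \<theta>) (at \<theta>)"
      by (simp add: has_real_derivative_iff_has_vector_derivative)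
  qed simp
  moreover have "F pi = 0" "F 0 = 0"
    using assms by (simp_all add: F_def sin_weight_def)
  ultimately have "integral {0..pi} F' = 0"
    by (simp add: integral_unique)
  moreover have "integral {0..pi} F' = sin_integral q (\<lambda>t. (real N + q + 1) * t ^ Suc N + (- real N) * t ^ (N - 1))"
    by (simp add: sin_integral_def F'_def[abs_def])
  moreover have "\<dots> = (real N + q + 1) * sin_integral q (\<lambda>t. t ^ Suc N) + (- real N) * sin_integral q (\<lambda>t. t ^ (N - 1))"
    by (subst sin_integral_add) (use assms in \<open>auto simp only: sin_integral_cmult intro!: continuous_intros\<close>)
  ultimately show ?thesis by simp
qed

lemma sin_integral_poly:
  assumes "q \<ge> 0"
  shows "sin_integral q (poly p) = moment_functional (\<lambda>i. sin_integral q (\<lambda>t. t ^ i)) p"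
  unfolding moment_functional_def poly_altdef
  by (subst sin_integral_sum) (use assms in \<open>auto simp: sin_integral_cmult intro!: continuous_intros\<close>)

lemma sin_integral_poly_mult:
  assumes "q \<ge> 0"
  shows "sin_integral q (\<lambda>t. poly g t * poly h t) = bilinear_form (\<lambda>i j. sin_integral q (\<lambda>t. t ^ (i + j))) g h"
proof -
  have "(\<lambda>t. poly g t * poly h t) =
      (\<lambda>t. \<Sum>i\<le>degree g. \<Sum>j\<le>degree h. coeff g i * coeff h j * t ^ (i + j))"
    by (simp add: poly_altdef sum_product power_add algebra_simps)
  then have "sin_integral q (\<lambda>t. poly g t * poly h t) =
      (\<Sum>i\<le>degree g. \<Sum>j\<le>degree h. coeff g i * coeff h j * sin_integral q (\<lambda>t. t ^ (i + j)))"
    using assms by (simp add: sin_integral_sum sin_integral_cmult continuous_intros)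
  then show ?thesis
    by (simp add: bilinear_form_def moment_functional_def sum_distrib_left mult.assoc)
qed

text \<open>The case Y = Z of the model: v = 1, and both arguments depend on the same coordinate of
  X, whose density in the angle is sin^(2 l).\<close>

lemma gegenbauer_form_sin_integral:
  assumes "l > 0"
  shows "gegenbauer_form l 1 (\<lambda>i j. sin_integral (2 * l) (\<lambda>t. t ^ (i + j)))"
proof (intro gegenbauer_form.intro assms)
  fix N k :: nat
  let ?m = "\<lambda>n. sin_integral (2 * l) (\<lambda>t. t ^ n)"
  have r: "(real N + k + 2 * l + 1) * ?m (Suc (N + k)) = (real N + k) * ?m (N + k - 1)"
    using sin_integral_power_rec[of "2 * l" "N + k"] assms by simp
  show "(real N + k + 2 * l + 1) * ?m (Suc N + k) = N * ?m (N - 1 + k) + real k * 1 * ?m (N + (k - 1))"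
    "(real N + k + 2 * l + 1) * ?m (N + Suc k) = k * ?m (N + (k - 1)) + real N * 1 * ?m (N - 1 + k)"
    subgoal using r by (cases N; cases k) (simp_all add: algebra_simps)
    subgoal using r by (cases N; cases k) (simp_all add: algebra_simps)
    done
qed

lemma sin_integral_gegenbauer_square:
  assumes "l > 0"
  shows "sin_integral (2 * l) (\<lambda>t. (poly (gegenbauer l k) t)\<^sup>2) =
    l * sin_integral (2 * l) (\<lambda>_. 1) / (k + l) * (pochhammer (2 * l) k / fact k)"
  using gegenbauer_form.form_gegenbauer_same[OF gegenbauer_form_sin_integral[OF assms], of k]
    sin_integral_poly_mult[of "2 * l" "gegenbauer l k" "gegenbauer l k"] assms
  by (simp add: poly_gegenbauer_1 power2_eq_square)

text \<open>The quotient \<open>r\<close> of the two sides tends to 1 / Gamma a, which is positive.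
  Hence \<open>r\<close> and its reciprocal are bounded sequences, which gives both constants for
  all n at once. The base n + 1 keeps n = 0 included.\<close>

lemma pochhammer_growth:
  fixes a :: real
  assumes "a > 0"
  obtains b c where "b > 0" "c > 0"
    "\<And>n. b * (real n + 1) powr (a - 1) \<le> pochhammer a n / fact n"
    "\<And>n. pochhammer a n / fact n \<le> c * (real n + 1) powr (a - 1)"
proof -
  define r where "r n = pochhammer a n / fact n / (real n + 1) powr (a - 1)" for n
  have pos: "r n > 0" for n
    using assms by (simp add: r_def pochhammer_pos)
  have G: "Gamma a > 0" using assms by (simp add: Gamma_real_pos)
  have "(\<lambda>n. Gamma_series' a (Suc n)) \<longlonglongrightarrow> Gamma a"
    using Gamma_series'_LIMSEQ[of a] by (rule LIMSEQ_Suc)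
  then have "(\<lambda>n. (real n + 1) powr a * fact n / pochhammer a (Suc n)) \<longlonglongrightarrow> Gamma a"
    by (simp add: Gamma_series'_def powr_def add.commute mult.commute)
  moreover have "(\<lambda>n. (a + n) / (real n + 1)) \<longlonglongrightarrow> 1"
    by real_asymp
  ultimately have "(\<lambda>n. (real n + 1) powr a * fact n / pochhammer a (Suc n) * ((a + n) / (real n + 1))) \<longlonglongrightarrow> Gamma a * 1"
    by (rule tendsto_mult)
  moreover have "(real n + 1) powr a * fact n / pochhammer a (Suc n) * ((a + n) / (real n + 1)) = inverse (r n)" for n
  proof -
    have "a + real n \<noteq> 0" using assms by linarith
    then show ?thesis
      by (simp add: r_def pochhammer_Suc powr_diff divide_simps)
  qed
  ultimately have i: "(\<lambda>n. inverse (r n)) \<longlonglongrightarrow> Gamma a" by simp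
  then have "(\<lambda>n. inverse (inverse (r n))) \<longlonglongrightarrow> inverse (Gamma a)"
    using G by (intro tendsto_inverse) auto
  then have "r \<longlonglongrightarrow> inverse (Gamma a)" by simp
  then obtain c where "c > 0" "\<And>n. \<bar>r n\<bar> \<le> c"
    by (metis convergentI convergent_imp_Bseq BseqE real_norm_def)
  moreover obtain b where "b > 0" "\<And>n. \<bar>inverse (r n)\<bar> \<le> b"
    using i by (metis convergentI convergent_imp_Bseq BseqE real_norm_def)
  ultimately show ?thesis
  proof (intro that[of "inverse b" c])
    fix n
    have p: "(real n + 1) powr (a - 1) > 0" by simp
    have "inverse b \<le> r n"
      using \<open>\<bar>inverse (r n)\<bar> \<le> b\<close> pos[of n] \<open>b > 0\<close> by (simp add: field_simps)
    then show "inverse b * (real n + 1) powr (a - 1) \<le> pochhammer a n / fact n"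
      using p by (simp add: r_def field_simps)
    have "r n \<le> c" using \<open>\<bar>r n\<bar> \<le> c\<close> by simp
    then show "pochhammer a n / fact n \<le> c * (real n + 1) powr (a - 1)"
      using p by (simp add: r_def field_simps)
  qed auto
qed

text \<open>The hockey-stick identity for binomial coefficients with real parameter.\<close>

lemma sum_pochhammer:
  fixes b :: real
  shows "(\<Sum>k\<le>n. pochhammer b k / fact k) = pochhammer (b + 1) n / fact n"
proof (induction n)
  case (Suc n)
  define p where "p = pochhammer (b + 1) n / fact n"
  have 1: "pochhammer b (Suc n) / fact (Suc n) = b / (n + 1) * p"
    by (simp add: p_def pochhammer_rec)
  have 2: "pochhammer (b + 1) (Suc n) / fact (Suc n) = (b + 1 + n) / (n + 1) * p"
    by (simp add: p_def pochhammer_Suc)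
  show ?case
    unfolding sum.atMost_Suc Suc 1 2 p_def[symmetric] by (simp add: field_simps)
qed simp

text \<open>For weight exponent \<open>1\<close> the comparison goes the wrong way; the two derivatives integrated
  below, combined with Gegenbauer's equation, give
  \<open>(N - 1/4) \<integral> y\<^sup>2 \<le> 3 N \<integral> (1 - t\<^sup>2) y\<^sup>2\<close> with \<open>N = k (k + 3/2)\<close>.\<close>

lemma sin_integral_1_pderiv:
  "sin_integral 1 (poly (pderiv p)) = poly p 1 - poly p (-1)"
proof -
  have "((\<lambda>\<theta>. poly (pderiv p) (cos \<theta>) * sin \<theta>) has_integral (- poly p (cos pi)) - (- poly p (cos 0))) {0..pi}"
    by (rule fundamental_theorem_of_calculus)
       (auto intro!: derivative_eq_intros poly_DERIV DERIV_chain2[OF poly_DERIV]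
         simp flip: has_real_derivative_iff_has_vector_derivative)
  then have "integral {0..pi} (\<lambda>\<theta>. poly (pderiv p) (cos \<theta>) * sin \<theta>) = poly p 1 - poly p (-1)"
    by (simp add: integral_unique)
  moreover have "sin_integral 1 (poly (pderiv p)) = integral {0..pi} (\<lambda>\<theta>. poly (pderiv p) (cos \<theta>) * sin \<theta>)"
    unfolding sin_integral_def by (rule integral_cong) (simp add: sin_weight_def sin_ge_zero)
  ultimately show ?thesis by simp
qed

lemma sin_integral_1_gegenbauer_square:
  "sin_integral 1 (\<lambda>t. (poly (gegenbauer (3 / 4) k) t)\<^sup>2)
    \<le> 4 * sin_integral (3 / 2) (\<lambda>t. (poly (gegenbauer (3 / 4) k) t)\<^sup>2)"
proof -
  define y where "y = gegenbauer (3 / 4) k"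
  define N where "N = real k * (k + 3 / 2)"
  define I where "I p = sin_integral 1 (poly p)" for p
  have Iadd: "I (p + q) = I p + I q" and Ismult: "I (smult c p) = c * I p" for p q c
    unfolding I_def poly_add poly_smult
    by (simp_all add: sin_integral_add sin_integral_cmult continuous_intros)
  have ode: "(1 - t\<^sup>2) * poly (pderiv (pderiv y)) t = 5 / 2 * t * poly (pderiv y) t - N * poly y t" for t
    using gegenbauer_ode[of t "3 / 4" k] by (simp add: y_def N_def algebra_simps)
  define Y0 Y1 V where "Y0 = I (y * y)" and "Y1 = I ([:1, 0, -1:] * (y * y))"
    and "V = I ([:1, 0, -1:] * (pderiv y * pderiv y))"
  have e1: "I ([:1, 0, -1:] * (pderiv y * pderiv y) + smult (3 * N) ([:1, 0, -1:] * (y * y)) + smult (- 2 * N) (y * y)) = 0"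
  proof -
    \<comment> \<open>The second factor is Sonin's function, whose derivative is 3 t y'^2 by the
      equation. Multiplying it by t (1 - t^2) makes the boundary values vanish and leaves y'^2 only
      with the factor 1 - t^2.\<close>
    define G where "G = [:0, 1, 0, -1:] * ([:1, 0, -1:] * (pderiv y * pderiv y) + smult N (y * y))"
    have "pderiv G = [:1, 0, -1:] * (pderiv y * pderiv y) + smult (3 * N) ([:1, 0, -1:] * (y * y)) + smult (- 2 * N) (y * y)"
    proof (rule poly_ext)
      fix t
      define a b c where "a = poly y t" and "b = poly (pderiv y) t" and "c = poly (pderiv (pderiv y)) t"
      have "poly (pderiv G) t = (1 - 3 * t\<^sup>2) * ((1 - t\<^sup>2) * b\<^sup>2 + N * a\<^sup>2)
          + t * (1 - t\<^sup>2) * (2 * b * ((1 - t\<^sup>2) * c) - 2 * t * b\<^sup>2 + 2 * N * a * b)"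
        unfolding G_def a_def b_def c_def pderiv_mult pderiv_add pderiv_smult
        by (simp add: pderiv_pCons algebra_simps power2_eq_square)
      also have "\<dots> = (1 - t\<^sup>2) * b\<^sup>2 + 3 * N * ((1 - t\<^sup>2) * a\<^sup>2) - 2 * N * a\<^sup>2"
        unfolding ode[of t, folded a_def b_def c_def] by (simp add: algebra_simps power2_eq_square)
      finally show "poly (pderiv G) t = poly ([:1, 0, -1:] * (pderiv y * pderiv y) + smult (3 * N) ([:1, 0, -1:] * (y * y)) + smult (- 2 * N) (y * y)) t"
        unfolding a_def b_def by (simp add: algebra_simps power2_eq_square)
    qed
    moreover have "I (pderiv G) = 0"
      unfolding I_def sin_integral_1_pderiv by (simp add: G_def)
    ultimately show ?thesis by simp
  qed
  have e2: "I ([:1, 0, -1:] * (pderiv y * pderiv y) + smult (- (N + 1 / 4)) (y * y)) \<le> 0"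
  proof -
    \<comment> \<open>The equation leaves t y y' / 2 in the derivative of (1 - t^2) y y';
      subtracting t y^2 / 4 removes it, and the boundary values of this term have a favourable
      sign.\<close>
    define G where "G = [:1, 0, -1:] * (y * pderiv y) + smult (- 1 / 4) ([:0, 1:] * (y * y))"
    have "pderiv G = [:1, 0, -1:] * (pderiv y * pderiv y) + smult (- (N + 1 / 4)) (y * y)"
    proof (rule poly_ext)
      fix t
      define a b c where "a = poly y t" and "b = poly (pderiv y) t" and "c = poly (pderiv (pderiv y)) t"
      have "poly (pderiv G) t = a * ((1 - t\<^sup>2) * c) + (1 - t\<^sup>2) * b\<^sup>2 - 2 * t * a * b - (a\<^sup>2 + 2 * t * a * b) / 4"
        unfolding G_def a_def b_def c_def pderiv_mult pderiv_add pderiv_smult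
        by (simp add: pderiv_pCons algebra_simps power2_eq_square)
      also have "\<dots> = (1 - t\<^sup>2) * b\<^sup>2 - (N + 1 / 4) * a\<^sup>2"
        unfolding ode[of t, folded a_def b_def c_def] by (simp add: algebra_simps power2_eq_square)
      finally show "poly (pderiv G) t = poly ([:1, 0, -1:] * (pderiv y * pderiv y) + smult (- (N + 1 / 4)) (y * y)) t"
        unfolding a_def b_def by (simp add: algebra_simps power2_eq_square)
    qed
    moreover have "I (pderiv G) \<le> 0"
      unfolding I_def sin_integral_1_pderiv by (simp add: G_def)
    ultimately show ?thesis by simp
  qed
  \<comment> \<open>\<open>V\<close> is eliminated between the identity \<open>e1\<close> and the
    inequality \<open>e2\<close>.\<close>
  have main: "(N - 1 / 4) * Y0 \<le> 3 * N * Y1"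
    using e1[unfolded Iadd Ismult, folded V_def Y0_def Y1_def] e2[unfolded Iadd Ismult, folded V_def Y0_def]
    unfolding left_diff_distrib distrib_right minus_add_distrib by linarith
  have c: "continuous_on UNIV (\<lambda>t. (1 - t\<^sup>2) * (poly y t)\<^sup>2)"
    by (intro continuous_intros)
  have Y1: "Y1 = sin_integral 1 (\<lambda>t. (1 - t\<^sup>2) * (poly y t)\<^sup>2)"
  proof -
    have "poly ([:1, 0, -1:] * (y * y)) = (\<lambda>t. (1 - t\<^sup>2) * (poly y t)\<^sup>2)"
      by (rule ext) (simp add: algebra_simps power2_eq_square)
    then show ?thesis by (simp only: Y1_def I_def)
  qed
  have Y1_le: "Y1 \<le> sin_integral (3 / 2) (\<lambda>t. (poly y t)\<^sup>2)"
    unfolding Y1 sin_integral_def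
  proof (intro integral_le sin_integral_integrable[OF _ c] sin_integral_integrable[of "3/2" "\<lambda>t. (poly y t)\<^sup>2"])
    fix \<theta> assume t: "\<theta> \<in> {0..pi}"
    then have s: "0 \<le> sin \<theta>" "sin \<theta> \<le> 1" by (auto simp: sin_ge_zero)
    have "(1 - (cos \<theta>)\<^sup>2) * sin_weight 1 \<theta> = sin \<theta> powr 3"
      using s powr_realpow'[of "sin \<theta>" 3] by (simp add: sin_weight_def power3_eq_cube power2_eq_square flip: sin_squared_eq[unfolded power2_eq_square])
    also have "\<dots> \<le> sin_weight (3 / 2) \<theta>"
      using s powr_mono'[of "3 / 2" 3 "sin \<theta>"] by (simp add: sin_weight_def)
    finally have "(poly y (cos \<theta>))\<^sup>2 * ((1 - (cos \<theta>)\<^sup>2) * sin_weight 1 \<theta>) \<le> (poly y (cos \<theta>))\<^sup>2 * sin_weight (3 / 2) \<theta>"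
      by (rule mult_left_mono) simp
    then show "(1 - (cos \<theta>)\<^sup>2) * (poly y (cos \<theta>))\<^sup>2 * sin_weight 1 \<theta> \<le> (poly y (cos \<theta>))\<^sup>2 * sin_weight (3 / 2) \<theta>"
      by (simp only: mult_ac)
  qed (auto intro!: continuous_intros)
  have nonneg: "Y0 \<ge> 0"
  proof -
    have "sin_integral 1 (\<lambda>t. 0 * 1) \<le> sin_integral 1 (poly (y * y))"
      by (rule sin_integral_mono) (auto intro!: continuous_intros)
    then show ?thesis unfolding sin_integral_cmult Y0_def I_def by simp
  qed
  \<comment> \<open>For k = 0 the number \<open>N\<close> is 0 and \<open>main\<close> is empty, so
    both integrals are computed. For k >= 1 one has N >= 5/2, so N - 1/4 is at least 3 N /
    4.\<close>
  have "Y0 \<le> 4 * Y1"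
  proof (cases "k = 0")
    case True
    have "pderiv [:0, 1:] = (1 :: real poly)" "pderiv [:0, 1, 0, - 1 / 3:] = [:1, 0, - 1 :: real:]"
      by (simp_all add: pderiv_pCons)
    then have "I 1 = 2" "I [:1, 0, -1:] = 4 / 3"
      using sin_integral_1_pderiv[of "[:0, 1:]"] sin_integral_1_pderiv[of "[:0, 1, 0, - 1 / 3:]"]
      by (simp_all add: I_def)
    then show ?thesis using True by (simp add: Y0_def Y1_def y_def)
  next
    case False
    then have "real k * (k + 3 / 2) \<ge> 1 * (1 + 3 / 2)"
      by (intro mult_mono) auto
    then have "N \<ge> 5 / 2" by (simp add: N_def)
    then have "3 / 4 * N * Y0 \<le> (N - 1 / 4) * Y0"
      using nonneg by (intro mult_right_mono) auto
    with main have "N * (3 / 4 * Y0) \<le> N * (3 * Y1)" by simp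
    with \<open>N \<ge> 5 / 2\<close> show ?thesis
      by (subst (asm) mult_le_cancel_left_pos) auto
  qed
  moreover have "Y0 = sin_integral 1 (\<lambda>t. (poly y t)\<^sup>2)"
  proof -
    have "poly (y * y) = (\<lambda>t. (poly y t)\<^sup>2)"
      by (rule ext) (simp add: power2_eq_square)
    then show ?thesis by (simp only: Y0_def I_def)
  qed
  ultimately show ?thesis
    using Y1_le unfolding y_def by linarith
qed

text \<open>Each integral is compared with the squared norm for the weight sin^(2 s), 2 s = (D + 1)
  / 2: by monotonicity of powers of the sine for D >= 3, and by
  \<open>sin_integral_1_gegenbauer_square\<close> for D = 2, which is the origin of the factor 4.
  The norms are explicit and can be summed.\<close>

lemma sum_gegenbauer_squares_bound:
  fixes D :: nat
  assumes "D \<ge> 2"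
  obtains c where "c > 0"
    "\<And>n. sin_integral (real D - 1) (\<lambda>t. \<Sum>k\<le>n. (poly (gegenbauer ((D + 1) / 4) k) t)\<^sup>2) \<le> c * (real n + 1) powr ((D - 1) / 2)"
proof -
  define s where "s = (D + 1) / 4"
  have s: "s \<ge> 3 / 4" using assms by (simp add: s_def)
  let ?g = "\<lambda>k t. (poly (gegenbauer s k) t)\<^sup>2"
  define j where "j = sin_integral (2 * s) (\<lambda>_. 1)"
  have j: "j > 0" using s by (simp add: j_def sin_integral_1_pos)
  have cont: "continuous_on UNIV (?g k)" for k
    by (intro continuous_intros)
  have "sin_integral (real D - 1) (?g k) \<le> 4 * sin_integral (2 * s) (?g k)" for k
  proof (cases "D = 2")
    case True
    then show ?thesis using sin_integral_1_gegenbauer_square[of k] by (simp add: s_def)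
  next
    case False
    have "sin_integral (2 * s) (\<lambda>t. 0 * 1) \<le> sin_integral (2 * s) (?g k)"
      by (rule sin_integral_mono) (use s in \<open>auto intro!: continuous_intros\<close>)
    moreover have "sin_integral (real D - 1) (?g k) \<le> sin_integral (2 * s) (?g k)"
      by (rule sin_integral_weight_mono) (use assms False cont in \<open>auto simp: s_def\<close>)
    ultimately show ?thesis
      unfolding sin_integral_cmult by linarith
  qed
  also have "4 * sin_integral (2 * s) (?g k) \<le> 8 * s * j * (1 / (2 * s - 1)) * (pochhammer (2 * s - 1) k / fact k)" for k
  proof -
    \<comment> \<open>Replacing the denominator k + s of the norm by (2 s - 1 + k) / 2 costs a
      factor of at most 2 and turns the norms into Pochhammer quotients of parameter 2 s - 1, to
      which \<open>sum_pochhammer\<close> applies.\<close>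
    have p: "(2 * s - 1) * (pochhammer (2 * s) k / fact k) = (2 * s - 1 + k) * (pochhammer (2 * s - 1) k / fact k)"
      using pochhammer_rec[of "2 * s - 1" k] pochhammer_Suc[of "2 * s - 1" k] by (simp add: mult.commute)
    have "4 * sin_integral (2 * s) (?g k) = 4 * s * j / (k + s) * (pochhammer (2 * s) k / fact k)"
      using sin_integral_gegenbauer_square[of s k] s by (simp add: j_def)
    also have "\<dots> \<le> 8 * s * j / (2 * s - 1 + k) * (pochhammer (2 * s) k / fact k)"
    proof (rule mult_right_mono)
      have "4 / (k + s) \<le> 8 / (2 * s - 1 + k)"
        using s by (simp add: field_simps)
      then have "s * j * (4 / (k + s)) \<le> s * j * (8 / (2 * s - 1 + k))"
        using s j by (intro mult_left_mono) auto
      then show "4 * s * j / (k + s) \<le> 8 * s * j / (2 * s - 1 + k)" by (simp add: ac_simps)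
    qed (use s in \<open>auto intro!: divide_nonneg_nonneg pochhammer_nonneg\<close>)
    also have "pochhammer (2 * s) k / fact k = 1 / (2 * s - 1) * ((2 * s - 1 + k) * (pochhammer (2 * s - 1) k / fact k))"
      using s unfolding p[symmetric] by simp
    also have "8 * s * j / (2 * s - 1 + k) * \<dots> = 8 * s * j * (1 / (2 * s - 1)) * (pochhammer (2 * s - 1) k / fact k)"
    proof -
      have "2 * s - 1 + k \<noteq> 0" using s by linarith
      then show ?thesis by simp
    qed
    finally show ?thesis .
  qed
  finally have le: "sin_integral (real D - 1) (?g k) \<le> 8 * s * j * (1 / (2 * s - 1)) * (pochhammer (2 * s - 1) k / fact k)" for k .
  have "2 * s > 0" using s by simp
  obtain b c where c: "b > 0" "c > 0"
    "\<And>n. b * (real n + 1) powr (2 * s - 1) \<le> pochhammer (2 * s) n / fact n"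
    "\<And>n. pochhammer (2 * s) n / fact n \<le> c * (real n + 1) powr (2 * s - 1)"
    by (rule pochhammer_growth[OF \<open>2 * s > 0\<close>]) (rule that)
  define C where "C = 8 * s * j * (1 / (2 * s - 1))"
  have C: "C > 0" using s j by (simp add: C_def)
  show thesis
  proof (rule that)
    show "C * c > 0" using C c(2) by simp
    fix n
    have "sin_integral (real D - 1) (\<lambda>t. \<Sum>k\<le>n. ?g k t) = (\<Sum>k\<le>n. sin_integral (real D - 1) (?g k))"
      using assms by (intro sin_integral_sum cont) auto
    also have "\<dots> \<le> (\<Sum>k\<le>n. C * (pochhammer (2 * s - 1) k / fact k))"
      unfolding C_def by (intro sum_mono le)
    also have "\<dots> = C * (pochhammer (2 * s) n / fact n)"
      unfolding sum_distrib_left[symmetric] sum_pochhammer by simp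
    also have "\<dots> \<le> C * (c * (real n + 1) powr (2 * s - 1))"
      using C c(4) by (intro mult_left_mono) auto
    also have "2 * s - 1 = (real D - 1) / 2"
      by (simp add: s_def field_simps)
    finally show "sin_integral (real D - 1) (\<lambda>t. \<Sum>k\<le>n. (poly (gegenbauer ((D + 1) / 4) k) t)\<^sup>2)
        \<le> C * c * (real n + 1) powr ((D - 1) / 2)"
      using assms by (simp add: s_def of_nat_diff mult.assoc)
  qed
qed

text \<open>For the orthonormal polynomials \<open>p\<^sub>n\<close> with recurrence
  \<open>t p\<^sub>n = A\<^sub>n p\<^bsub>n+1\<^esub> + A\<^bsub>n-1\<^esub> p\<^bsub>n-1\<^esub>\<close>, the Turan-type expression
  \<open>T\<^sub>n = A\<^sub>n\<^sup>2 (p\<^sub>n\<^sup>2 + p\<^bsub>n+1\<^esub>\<^sup>2) - t A\<^sub>n p\<^sub>n p\<^bsub>n+1\<^esub>\<close> satisfies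
  \<open>T\<^bsub>n+1\<^esub> - T\<^sub>n = (A\<^bsub>n+1\<^esub>\<^sup>2 - A\<^sub>n\<^sup>2) p\<^bsub>n+1\<^esub>\<^sup>2\<close>, and \<open>A\<^sub>n\<close> increases when
  the parameter exceeds \<open>1\<close>. Below, \<open>r n = A\<^sub>n \<surd> (h n / h (n + 1))\<close> and \<open>k n = A\<^sub>n\<^sup>2 / r n\<close>,
  so that no square roots occur.\<close>

lemma gegenbauer_consecutive_lower_bound:
  fixes v :: real
  assumes v: "v > 1"
  obtains b where "b > 0"
    "\<And>n t. \<bar>t\<bar> \<le> 1 \<Longrightarrow> b * (real n + 1) powr (v - 1) \<le> \<bar>poly (gegenbauer v (Suc n)) t\<bar> + \<bar>poly (gegenbauer v n) t\<bar>"
proof -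
  \<comment> \<open>Up to a factor independent of n this is the squared norm of C_n for the weight
    sin^(2 v).\<close>
  define h where "h n = pochhammer (2 * v) n / fact n / (real n + v)" for n
  define r where "r n = (real n + 1) / (2 * (real n + v))" for n
  define k where "k n = (real n + 2 * v) / (2 * (real n + 1 + v))" for n
  have h_pos: "h n > 0" for n
    using v by (simp add: h_def pochhammer_pos)
  have kh: "k n * h n = r n * h (Suc n)" for n
  proof -
    have "real n + v \<noteq> 0" "real n + 1 + v \<noteq> 0" using v by linarith+
    then show ?thesis
      by (simp add: k_def r_def h_def pochhammer_Suc divide_simps) (simp add: algebra_simps)
  qed
  have rk: "r n * k n = 1 / 4 - v * (v - 1) / (4 * ((real n + v) * (real n + 1 + v)))" for n
  proof -
    have "real n + v \<noteq> 0" "real n + 1 + v \<noteq> 0" using v by linarith+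
    then show ?thesis
      by (simp add: k_def r_def divide_simps) (simp add: algebra_simps)
  qed
  have rk_mono: "r n * k n \<le> r (Suc n) * k (Suc n)" for n
  proof -
    have "v * (v - 1) / (4 * ((real (Suc n) + v) * (real (Suc n) + 1 + v))) \<le> v * (v - 1) / (4 * ((real n + v) * (real n + 1 + v)))"
      using v by (intro divide_left_mono mult_left_mono mult_mono mult_pos_pos) auto
    then show ?thesis unfolding rk by linarith
  qed
  have rk_le: "r n * k n \<le> 1 / 4" for n
    unfolding rk using v by simp
  have r_pos: "r n > 0" and r_le: "r n \<le> 1 / 2" for n
    using v by (simp_all add: r_def divide_simps)
  have k_pos: "k n > 0" for n
    using v by (simp add: k_def)
  have "2 * v > 0" using v by simp
  obtain b0 c0 where b0: "b0 > 0" "c0 > 0"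
    "\<And>n. b0 * (real n + 1) powr (2 * v - 1) \<le> pochhammer (2 * v) n / fact n"
    "\<And>n. pochhammer (2 * v) n / fact n \<le> c0 * (real n + 1) powr (2 * v - 1)"
    by (rule pochhammer_growth[OF \<open>2 * v > 0\<close>]) (rule that)
  \<comment> \<open>The product of T 0 = r 0 k 0 / h 0 with the constant b0 / v in the lower bound
    for \<open>h n\<close>; the 2 undoes the division by 2 in the bound for
    \<open>T n * h n\<close>.\<close>
  define b where "b = sqrt (2 * (r 0 * k 0 / h 0) * (b0 / v))"
  have b_arg: "2 * (r 0 * k 0 / h 0) * (b0 / v) > 0"
    using r_pos k_pos h_pos b0(1) v by simp
  then have "b > 0" by (simp add: b_def)
  moreover have "b * (real n + 1) powr (v - 1) \<le> \<bar>poly (gegenbauer v (Suc n)) t\<bar> + \<bar>poly (gegenbauer v n) t\<bar>"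
    if t: "\<bar>t\<bar> \<le> 1" for n t
  proof -
    define c where "c n = poly (gegenbauer v n) t" for n
    define T where "T n = (r n * k n * (c n)\<^sup>2 + (r n * c (Suc n))\<^sup>2 - t * (r n * c (Suc n)) * c n) / h n" for n
    have rc: "r (Suc n) * c (Suc (Suc n)) = t * c (Suc n) - k n * c n" for n
    proof -
      have "(real n + 2) * c (Suc (Suc n)) = 2 * (real n + 1 + v) * t * c (Suc n) - (real n + 2 * v) * c n"
        unfolding c_def by (rule poly_gegenbauer_rec)
      moreover have "real n + 1 + v \<noteq> 0" using v by linarith
      moreover have "r (Suc n) * c (Suc (Suc n)) = ((real n + 2) * c (Suc (Suc n))) / (2 * (real n + 1 + v))"
        by (simp add: r_def add.commute)
      ultimately show ?thesis
        by (simp add: k_def diff_divide_distrib)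
    qed
    have T_mono: "T n \<le> T (Suc n)" for n
    proof -
      have "r n / h n = k n / h (Suc n)"
        using kh[of n] h_pos[of n] h_pos[of "Suc n"] by (simp add: field_simps)
      moreover have "T n = r n / h n * (k n * (c n)\<^sup>2 + r n * (c (Suc n))\<^sup>2 - t * c (Suc n) * c n)"
        unfolding T_def times_divide_eq_left
        by (rule arg_cong[where f="\<lambda>x. x / h n"]) (simp add: algebra_simps power2_eq_square)
      ultimately have "T n = (k n * (k n * (c n)\<^sup>2 + r n * (c (Suc n))\<^sup>2 - t * c (Suc n) * c n)) / h (Suc n)"
        by simp
      then have "T (Suc n) - T n = (r (Suc n) * k (Suc n) * (c (Suc n))\<^sup>2
          + (t * c (Suc n) - k n * c n)\<^sup>2 - t * (t * c (Suc n) - k n * c n) * c (Suc n)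
          - k n * (k n * (c n)\<^sup>2 + r n * (c (Suc n))\<^sup>2 - t * c (Suc n) * c n)) / h (Suc n)"
        unfolding T_def[of "Suc n"] rc by (simp only: diff_divide_distrib)
      also have "\<dots> = (r (Suc n) * k (Suc n) - r n * k n) * (c (Suc n))\<^sup>2 / h (Suc n)"
        by (rule arg_cong[where f="\<lambda>x. x / h (Suc n)"]) (simp add: algebra_simps power2_eq_square)
      also have "\<dots> \<ge> 0"
        using rk_mono[of n] h_pos[of "Suc n"] by simp
      finally show ?thesis by simp
    qed
    have "T 0 \<le> T n"
      by (rule lift_Suc_mono_le[of T, OF T_mono]) simp
    moreover have "T 0 = r 0 * k 0 / h 0"
      using v by (simp add: T_def c_def r_def power2_eq_square)
    \<comment> \<open>The coefficients satisfy r k <= 1/4, r^2 <= 1/4 and |t| r <= 1/2; half of the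
      mixed product is again at most a quarter of the sum of squares.\<close>
    moreover have "T n * h n \<le> ((c n)\<^sup>2 + (c (Suc n))\<^sup>2) / 2"
    proof -
      have "r n * k n * (c n)\<^sup>2 \<le> 1 / 4 * (c n)\<^sup>2"
        by (intro mult_right_mono rk_le) auto
      moreover have "(r n)\<^sup>2 \<le> (1 / 2)\<^sup>2"
        using r_pos[of n] r_le[of n] by (intro power_mono) auto
      then have "(r n)\<^sup>2 * (c (Suc n))\<^sup>2 \<le> 1 / 4 * (c (Suc n))\<^sup>2"
        by (intro mult_right_mono) (auto simp: power2_eq_square)
      moreover have "\<bar>t * (r n * c (Suc n)) * c n\<bar> \<le> 1 / 2 * \<bar>c (Suc n) * c n\<bar>"
      proof -
        have "\<bar>t\<bar> * r n \<le> 1 * (1 / 2)"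
          using t r_pos[of n] r_le[of n] by (intro mult_mono) auto
        then have "\<bar>t\<bar> * r n * \<bar>c (Suc n) * c n\<bar> \<le> 1 / 2 * \<bar>c (Suc n) * c n\<bar>"
          by (intro mult_right_mono) auto
        then show ?thesis using r_pos[of n] by (simp add: abs_mult mult.assoc)
      qed
      moreover have "2 * \<bar>c (Suc n) * c n\<bar> \<le> (c (Suc n))\<^sup>2 + (c n)\<^sup>2"
        using sum_squares_bound[of "\<bar>c (Suc n)\<bar>" "\<bar>c n\<bar>"] by (simp add: abs_mult)
      moreover have "T n * h n = r n * k n * (c n)\<^sup>2 + (r n)\<^sup>2 * (c (Suc n))\<^sup>2 - t * (r n * c (Suc n)) * c n"
        using h_pos[of n] by (simp add: T_def power_mult_distrib)
      ultimately show ?thesis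
        by (simp add: abs_le_iff)
    qed
    moreover have "b0 / v * (real n + 1) powr (2 * v - 2) \<le> h n"
    proof -
      have "b0 / v * (real n + 1) powr (2 * v - 2) = b0 * (real n + 1) powr (2 * v - 1) / (v * (real n + 1))"
        using v by (simp add: powr_diff field_simps power2_eq_square)
      also have "\<dots> \<le> (pochhammer (2 * v) n / fact n) / (v * (real n + 1))"
        using v b0(3) by (intro divide_right_mono) auto
      also have "\<dots> \<le> h n"
        unfolding h_def
      proof (rule divide_left_mono)
        have "real n * 1 \<le> real n * v" using v by (intro mult_left_mono) auto
        then show "real n + v \<le> v * (real n + 1)" by (simp add: algebra_simps)
      qed (use v in \<open>auto intro!: divide_nonneg_nonneg pochhammer_nonneg mult_pos_pos add_nonneg_pos\<close>)
      finally show ?thesis .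
    qed
    ultimately have *: "r 0 * k 0 / h 0 \<le> T n" "T n * h n \<le> ((c n)\<^sup>2 + (c (Suc n))\<^sup>2) / 2"
      "b0 / v * (real n + 1) powr (2 * v - 2) \<le> h n"
      by simp_all
    have "r 0 * k 0 / h 0 > 0" using r_pos k_pos h_pos by simp
    then have "r 0 * k 0 / h 0 * (b0 / v * (real n + 1) powr (2 * v - 2)) \<le> T n * h n"
      using * b0(1) v by (intro mult_mono) auto
    then have "r 0 * k 0 / h 0 * (b0 / v * (real n + 1) powr (2 * v - 2)) \<le> ((c n)\<^sup>2 + (c (Suc n))\<^sup>2) / 2"
      using *(2) by (rule order_trans)
    then have "2 * (r 0 * k 0 / h 0 * (b0 / v * (real n + 1) powr (2 * v - 2))) \<le> (c n)\<^sup>2 + (c (Suc n))\<^sup>2"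
      by (simp only: le_divide_eq_numeral1 mult.commute)
    also have "\<dots> \<le> (\<bar>c (Suc n)\<bar> + \<bar>c n\<bar>)\<^sup>2"
      by (simp add: power2_sum)
    finally have "2 * (r 0 * k 0 / h 0) * (b0 / v) * (real n + 1) powr (2 * v - 2) \<le> (\<bar>c (Suc n)\<bar> + \<bar>c n\<bar>)\<^sup>2"
      by (simp only: mult.assoc)
    moreover have "(b * (real n + 1) powr (v - 1))\<^sup>2 = 2 * (r 0 * k 0 / h 0) * (b0 / v) * (real n + 1) powr (2 * v - 2)"
      unfolding power_mult_distrib b_def real_sqrt_pow2[OF less_imp_le[OF b_arg]]
      by (simp add: power2_eq_square powr_add[symmetric])
    ultimately have "(b * (real n + 1) powr (v - 1))\<^sup>2 \<le> (\<bar>c (Suc n)\<bar> + \<bar>c n\<bar>)\<^sup>2"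
      by simp
    then show ?thesis
      unfolding c_def by (rule power2_le_imp_le) simp
  qed
  ultimately show thesis by (rule that)
qed

text \<open>The two consecutive polynomials have opposite parity, so up to sign the kernel takes the
  values a + b and a - b at t and - t, and |a + b| + |a - b| >= |a| + |b|.\<close>

lemma gegenbauer_kernel_lower_bound:
  fixes l :: real
  assumes "l > 0"
  obtains b where "b > 0"
    "\<And>n t. \<bar>t\<bar> \<le> 1 \<Longrightarrow> b * (real n + 1) powr l
       \<le> \<bar>poly (gegenbauer_kernel l (Suc n)) t\<bar> + \<bar>poly (gegenbauer_kernel l (Suc n)) (- t)\<bar>"
proof -
  obtain b where b: "b > 0" "\<And>n t. \<bar>t\<bar> \<le> 1 \<Longrightarrow> b * (real n + 1) powr l
      \<le> \<bar>poly (gegenbauer (l + 1) (Suc n)) t\<bar> + \<bar>poly (gegenbauer (l + 1) n) t\<bar>"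
    using gegenbauer_consecutive_lower_bound[of "l + 1"] assms by auto
  have *: "\<bar>poly (gegenbauer_kernel l (Suc n)) t\<bar> + \<bar>poly (gegenbauer_kernel l (Suc n)) (- t)\<bar>
      \<ge> \<bar>poly (gegenbauer (l + 1) (Suc n)) t\<bar> + \<bar>poly (gegenbauer (l + 1) n) t\<bar>" for n t
    unfolding poly_gegenbauer_kernel[OF assms] poly_gegenbauer_minus
    by (cases "even n") auto
  show thesis
    by (rule that[OF b(1)]) (rule order_trans[OF b(2) *])
qed

section \<open>Weighted integrals over the ball\<close>

lemma poly_space_monomial:
  assumes "a \<in> multi_indices n"
  shows "(\<lambda>x :: real ^ 'n. \<Prod>i\<in>UNIV. (x $ i) ^ a i) \<in> poly_space n"
proof -
  have "(\<lambda>x :: real ^ 'n. \<Prod>i\<in>UNIV. (x $ i) ^ a i) =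
      (\<lambda>x. \<Sum>b\<in>multi_indices n. (if b = a then 1 else 0) * (\<Prod>i\<in>UNIV. (x $ i) ^ b i))"
    using assms by (simp add: if_distrib[of "\<lambda>c. c * _"] finite_multi_indices cong: if_cong)
  then show ?thesis unfolding poly_space_def by (intro CollectI exI)
qed

lemma poly_space_add:
  assumes "f \<in> poly_space n" "g \<in> poly_space n"
  shows "(\<lambda>x. f x + g x) \<in> poly_space n"
proof -
  from assms obtain c d where "f = (\<lambda>x. \<Sum>a\<in>multi_indices n. c a * (\<Prod>i\<in>UNIV. (x $ i) ^ a i))"
    "g = (\<lambda>x. \<Sum>a\<in>multi_indices n. d a * (\<Prod>i\<in>UNIV. (x $ i) ^ a i))"
    unfolding poly_space_def by blast
  then have "(\<lambda>x. f x + g x) = (\<lambda>x. \<Sum>a\<in>multi_indices n. (c a + d a) * (\<Prod>i\<in>UNIV. (x $ i) ^ a i))"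
    by (simp add: distrib_right sum.distrib)
  then show ?thesis unfolding poly_space_def by (intro CollectI exI)
qed

lemma poly_space_cmult:
  assumes "f \<in> poly_space n"
  shows "(\<lambda>x. b * f x) \<in> poly_space n"
proof -
  from assms obtain c where "f = (\<lambda>x. \<Sum>a\<in>multi_indices n. c a * (\<Prod>i\<in>UNIV. (x $ i) ^ a i))"
    unfolding poly_space_def by blast
  then have "(\<lambda>x. b * f x) = (\<lambda>x. \<Sum>a\<in>multi_indices n. (b * c a) * (\<Prod>i\<in>UNIV. (x $ i) ^ a i))"
    by (simp add: sum_distrib_left mult.assoc)
  then show ?thesis unfolding poly_space_def by (intro CollectI exI)
qed

lemma poly_space_0: "(\<lambda>x. 0) \<in> poly_space n"
proof -
  have "(\<lambda>x. 0) = (\<lambda>x :: real ^ 'a. \<Sum>a\<in>multi_indices n. 0 * (\<Prod>i\<in>UNIV. (x $ i) ^ a i))"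
    by simp
  then show ?thesis unfolding poly_space_def by (intro CollectI exI)
qed

lemma poly_space_sum:
  assumes "\<And>i. i \<in> A \<Longrightarrow> f i \<in> poly_space n"
  shows "(\<lambda>x. \<Sum>i\<in>A. f i x) \<in> poly_space n"
  using assms
  by (induction A rule: infinite_finite_induct) (simp_all add: poly_space_0 poly_space_add)

lemma poly_space_diff:
  "f \<in> poly_space n \<Longrightarrow> g \<in> poly_space n \<Longrightarrow> (\<lambda>x. f x - g x) \<in> poly_space n"
  using poly_space_add[of f n "\<lambda>x. (-1) * g x"] poly_space_cmult[of g n "-1"] by simp

lemma poly_space_mono:
  assumes "f \<in> poly_space m" "m \<le> n"
  shows "f \<in> poly_space n"
proof -
  from assms(1) obtain c where f: "f = (\<lambda>x. \<Sum>a\<in>multi_indices m. c a * (\<Prod>i\<in>UNIV. (x $ i) ^ a i))"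
    unfolding poly_space_def by blast
  show ?thesis
    unfolding f using assms(2)
    by (intro poly_space_sum poly_space_cmult poly_space_monomial) (auto simp: multi_indices_def)
qed

lemma poly_space_mult:
  assumes "f \<in> poly_space m" "g \<in> poly_space n"
  shows "(\<lambda>x. f x * g x) \<in> poly_space (m + n)"
proof -
  from assms obtain c d where f: "f = (\<lambda>x. \<Sum>a\<in>multi_indices m. c a * (\<Prod>i\<in>UNIV. (x $ i) ^ a i))"
    and g: "g = (\<lambda>x. \<Sum>a\<in>multi_indices n. d a * (\<Prod>i\<in>UNIV. (x $ i) ^ a i))"
    unfolding poly_space_def by blast
  have "(\<lambda>x. f x * g x) = (\<lambda>x. \<Sum>a\<in>multi_indices m. \<Sum>b\<in>multi_indices n.
      (c a * d b) * (\<Prod>i\<in>UNIV. (x $ i) ^ (a i + b i)))"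
    by (simp add: f g sum_product power_add prod.distrib mult_ac)
  also have "\<dots> \<in> poly_space (m + n)"
    by (intro poly_space_sum poly_space_cmult poly_space_monomial) (auto simp: multi_indices_def sum.distrib)
  finally show ?thesis .
qed

lemma poly_space_const: "(\<lambda>x. c) \<in> poly_space n"
  using poly_space_cmult[OF poly_space_monomial[of "\<lambda>_. 0" n], of c] by (simp add: multi_indices_def)

lemma poly_space_nth: "(\<lambda>x :: real ^ 'n. x $ j) \<in> poly_space 1"
proof -
  have "(\<lambda>i. if i = j then 1 else 0) \<in> multi_indices 1"
    by (simp add: multi_indices_def)
  from poly_space_monomial[OF this] show ?thesis
    by (simp add: if_distrib[of "\<lambda>k. _ ^ k"] cong: if_cong)
qed

lemma poly_space_inner: "(\<lambda>x :: real ^ 'n. x \<bullet> y) \<in> poly_space 1"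
  unfolding inner_vec_def inner_real_def mult.commute[of _ "y $ _"]
  by (intro poly_space_sum poly_space_cmult poly_space_nth)

lemma poly_space_power:
  assumes "f \<in> poly_space m"
  shows "(\<lambda>x. f x ^ k) \<in> poly_space (k * m)"
proof (induction k)
  case 0
  show ?case by (simp add: poly_space_const)
next
  case (Suc k)
  from poly_space_mult[OF assms this] show ?case by simp
qed

lemma poly_space_norm_sq: "(\<lambda>x :: real ^ 'n. 1 - (norm x)\<^sup>2) \<in> poly_space 2"
proof -
  have "(\<lambda>x :: real ^ 'n. 1 - (\<Sum>i\<in>UNIV. (x $ i) * (x $ i))) \<in> poly_space (1 + 1)"
    by (intro poly_space_diff poly_space_const poly_space_sum poly_space_mult poly_space_nth)
  moreover have "(norm x)\<^sup>2 = (\<Sum>i\<in>UNIV. (x $ i) * (x $ i))" for x :: "real ^ 'n"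
    unfolding power2_norm_eq_inner by (simp add: inner_vec_def)
  ultimately show ?thesis
    by (simp add: numeral_2_eq_2)
qed

lemma continuous_on_poly_space: "f \<in> poly_space n \<Longrightarrow> continuous_on A f"
  unfolding poly_space_def by (auto intro!: continuous_intros)

text \<open>Restrict to lines through \<open>0\<close>.\<close>

lemma poly_space_eq_0:
  fixes f :: "real ^ 'n \<Rightarrow> real"
  assumes "f \<in> poly_space n" "\<And>x. norm x \<le> 1 \<Longrightarrow> f x = 0"
  shows "f x = 0"
proof -
  from assms(1) obtain c where f: "f = (\<lambda>x. \<Sum>a\<in>multi_indices n. c a * (\<Prod>i\<in>UNIV. (x $ i) ^ a i))"
    unfolding poly_space_def by blast
  define p where "p = (\<Sum>a\<in>multi_indices n. smult (c a) (\<Prod>i\<in>UNIV. [:0, x $ i:] ^ a i))"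
  have p: "poly p t = f (t *\<^sub>R x)" for t
    by (simp add: p_def f poly_sum poly_prod)
  have "poly p t = 0" if "t \<in> {0..1 / (norm x + 1)}" for t
  proof -
    have "\<bar>t\<bar> * norm x \<le> 1 / (norm x + 1) * norm x"
      using that by (intro mult_right_mono) auto
    also have "\<dots> \<le> 1" by (simp add: divide_le_eq add_nonneg_pos)
    finally show ?thesis unfolding p by (intro assms(2)) simp
  qed
  then have "{0..1 / (norm x + 1)} \<subseteq> {t. poly p t = 0}" by blast
  moreover have "infinite {0..1 / (norm x + 1)}"
    by (intro infinite_Icc) (simp add: add_nonneg_pos)
  ultimately have "p = 0"
    using poly_roots_finite finite_subset by blast
  with p[of 1] show ?thesis by simp
qed

text \<open>The index is m = 2 \<mu>, because integration by parts relates m to m + 2 and powers of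
  the fibre radius shift m by natural numbers.\<close>

definition ball_moment :: "nat \<Rightarrow> (real ^ 'n \<Rightarrow> real) \<Rightarrow> real" where
  "ball_moment m f = ball_integral (gegenbauer_weight (real m / 2)) f"

lemma gegenbauer_weight_half: "gegenbauer_weight (real m / 2) x = (1 - (norm x)\<^sup>2) powr ((real m - 1) / 2)"
  by (simp add: gegenbauer_weight_def field_simps)

lemma ball_moment_eq:
  "ball_moment m f = (\<integral>x. indicator unit_ball x * (f x * (1 - (norm x)\<^sup>2) powr ((real m - 1) / 2)) \<partial>lborel)"
  by (simp add: ball_moment_def ball_integral_def set_lebesgue_integral_def gegenbauer_weight_half)

lemma ball_moment_integrable:
  fixes f :: "real ^ 'n \<Rightarrow> real"
  assumes "m \<ge> 1" "continuous_on UNIV f"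
  shows "integrable lborel (\<lambda>x. indicator unit_ball x * (f x * (1 - (norm x)\<^sup>2) powr ((real m - 1) / 2)))"
proof -
  have "compact (f ` unit_ball)"
    using assms(2) by (intro compact_continuous_image continuous_on_subset[OF assms(2)]) auto
  then obtain B where B: "\<And>x. x \<in> unit_ball \<Longrightarrow> \<bar>f x\<bar> \<le> B"
    by (metis bounded_iff compact_imp_bounded imageI real_norm_def)
  have [measurable]: "f \<in> borel_measurable borel"
    by (rule borel_measurable_continuous_onI[OF assms(2)])
  have [measurable]: "(unit_ball :: (real ^ 'n) set) \<in> sets borel"
    by (intro borel_closed closed_cball)
  show ?thesis
  proof (rule Bochner_Integration.integrable_bound)
    show "integrable lborel (\<lambda>x :: real ^ 'n. indicator unit_ball x * B)"
      by (intro integrable_mult_left integrable_real_indicator) (auto simp: emeasure_lborel_cball_finite[unfolded infinity_ennreal_def])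
    show "AE x in lborel. norm (indicator unit_ball x * (f x * (1 - (norm x)\<^sup>2) powr ((real m - 1) / 2)))
        \<le> norm (indicator unit_ball x * B)"
    proof (intro AE_I2)
      fix x :: "real ^ 'n"
      show "norm (indicator unit_ball x * (f x * (1 - (norm x)\<^sup>2) powr ((real m - 1) / 2))) \<le> norm (indicator unit_ball x * B)"
      proof (cases "x \<in> unit_ball")
        case True
        then have "0 \<le> 1 - (norm x)\<^sup>2" "1 - (norm x)\<^sup>2 \<le> 1"
          by (auto simp: power_le_one)
        then have "(1 - (norm x)\<^sup>2) powr ((real m - 1) / 2) \<le> 1"
          using assms(1) by (intro powr_le1) auto
        then have "\<bar>f x\<bar> * (1 - (norm x)\<^sup>2) powr ((real m - 1) / 2) \<le> B * 1"
          using B[OF True] by (intro mult_mono) auto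
        then show ?thesis using True by (simp add: abs_mult)
      qed simp
    qed
    show "(\<lambda>x. indicator unit_ball x * (f x * (1 - (norm x)\<^sup>2) powr ((real m - 1) / 2))) \<in> borel_measurable lborel"
      unfolding measurable_lborel1 by measurable
  qed
qed

lemma ball_moment_add:
  assumes "m \<ge> 1" "continuous_on UNIV f" "continuous_on UNIV g"
  shows "ball_moment m (\<lambda>x. f x + g x) = ball_moment m f + ball_moment m g"
  unfolding ball_moment_eq using Bochner_Integration.integral_add[OF ball_moment_integrable[OF assms(1,2)] ball_moment_integrable[OF assms(1,3)]]
  by (simp add: algebra_simps)

lemma ball_moment_cmult: "ball_moment m (\<lambda>x. c * f x) = c * ball_moment m f"
  unfolding ball_moment_eq by (simp add: mult.assoc mult.left_commute[of _ c])

lemma ball_moment_0: "ball_moment m (\<lambda>x. 0) = 0"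
  unfolding ball_moment_eq by simp

lemma ball_moment_sum:
  assumes "m \<ge> 1" "finite A" "\<And>i. i \<in> A \<Longrightarrow> continuous_on UNIV (f i)"
  shows "ball_moment m (\<lambda>x. \<Sum>i\<in>A. f i x) = (\<Sum>i\<in>A. ball_moment m (f i))"
  using assms(2,3)
proof (induction A rule: finite_induct)
  case (insert i A)
  have "ball_moment m (\<lambda>x. f i x + (\<Sum>i\<in>A. f i x)) = ball_moment m (f i) + ball_moment m (\<lambda>x. \<Sum>i\<in>A. f i x)"
    using insert.prems by (intro ball_moment_add assms(1) continuous_intros) auto
  with insert show ?case by simp
qed (simp add: ball_moment_0)

lemma ball_moment_cong:
  assumes "\<And>x. norm x \<le> 1 \<Longrightarrow> f x = g x"
  shows "ball_moment m f = ball_moment m g"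
  unfolding ball_moment_eq using assms by (intro Bochner_Integration.integral_cong) (auto simp: indicator_def)

lemma ball_moment_nonneg:
  assumes "\<And>x. norm x \<le> 1 \<Longrightarrow> f x \<ge> 0"
  shows "ball_moment m f \<ge> 0"
  unfolding ball_moment_eq using assms by (intro Bochner_Integration.integral_nonneg) (auto simp: indicator_def)

text \<open>The weight is 0 on the bounding sphere, so a boundary point is reached from inside: by
  continuity a positive value of f persists on a nonempty open subset of the ball, where the weight
  is positive.\<close>

lemma ball_moment_eq_0:
  fixes f :: "real ^ 'n \<Rightarrow> real"
  assumes "m \<ge> 1" "continuous_on UNIV f" "\<And>x. f x \<ge> 0" "ball_moment m f = 0" "norm x \<le> 1"
  shows "f x = 0"
proof (rule ccontr)
  assume "f x \<noteq> 0"
  with assms(3)[of x] have pos: "f x > 0" by simp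
  have "AE x in lborel. indicator unit_ball x * (f x * (1 - (norm x)\<^sup>2) powr ((real m - 1) / 2)) = 0"
    using assms(4) unfolding ball_moment_eq
    by (subst (asm) integral_nonneg_eq_0_iff_AE[OF ball_moment_integrable[OF assms(1,2)]])
       (auto simp: indicator_def assms(3))
  then have ae: "AE x in lborel. x \<notin> ball 0 1 \<inter> f -` {0<..}"
  proof eventually_elim
    case (elim x)
    have "\<bar>(norm x)\<^sup>2\<bar> < 1" if "norm x < 1"
      using that by (simp add: power_less_one_iff abs_square_less_1)
    with elim show ?case by (auto simp: indicator_def)
  qed
  have op: "open (ball 0 1 \<inter> f -` {0<..})"
    by (intro open_Int open_ball open_vimage assms(2)) auto
  have "x \<in> closure (ball 0 1)" using assms(5) by simp
  moreover have "open (f -` {0<..})" "x \<in> f -` {0<..}"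
    using pos assms(2) by (auto intro: open_vimage)
  ultimately have "ball 0 1 \<inter> f -` {0<..} \<noteq> {}"
    by (metis Int_commute disjoint_iff open_Int_closure_eq_empty)
  then have "\<not> negligible (ball 0 1 \<inter> f -` {0<..})"
    using op open_not_negligible by blast
  moreover have "ball 0 1 \<inter> f -` {0<..} \<in> null_sets lborel"
    using ae op by (subst (asm) AE_iff_null_sets[symmetric]) auto
  ultimately show False
    by (simp add: negligible_iff_null_sets null_sets_completionI)
qed

section \<open>Integration by parts on the ball\<close>

text \<open>For b >= 1 the derivative is at most b on (0, 1]. The case t = 0 is separate because the
  mean value theorem in use asks for derivatives at the end points too.\<close>

lemma powr_lipschitz:
  fixes s t b :: real
  assumes "b \<ge> 1" "s \<in> {0..1}" "t \<in> {0..1}"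
  shows "\<bar>s powr b - t powr b\<bar> \<le> b * \<bar>s - t\<bar>"
proof -
  have *: "\<bar>s powr b - t powr b\<bar> \<le> b * \<bar>s - t\<bar>" if st: "t < s" "0 \<le> t" "s \<le> 1" for s t
  proof (cases "t = 0")
    case True
    have "s powr b \<le> s powr 1"
      using st assms(1) by (intro powr_mono') auto
    moreover have "1 * s \<le> b * s" using st assms(1) by (intro mult_right_mono) auto
    moreover have "s powr 1 = s" using st by simp
    ultimately have "s powr b \<le> b * s" by linarith
    then show ?thesis using True st by simp
  next
    case False
    then have "0 < t" using st by simp
    have "\<exists>z>t. z < s \<and> s powr b - t powr b = (s - t) * (b * z powr (b - 1))"
      using st \<open>0 < t\<close> by (intro MVT2) (auto intro!: has_real_derivative_powr)
    then obtain z where z: "t < z" "z < s" "s powr b - t powr b = (s - t) * (b * z powr (b - 1))" by blast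
    have "z powr (b - 1) \<le> 1" using z st assms(1) by (intro powr_le1) auto
    then have "(s - t) * (b * z powr (b - 1)) \<le> (s - t) * (b * 1)"
      using st assms(1) by (intro mult_left_mono) auto
    moreover have "(s - t) * (b * z powr (b - 1)) \<ge> 0"
      using st assms(1) by simp
    ultimately show ?thesis using z(3) st by (simp add: mult.commute)
  qed
  show ?thesis
    using *[of s t] *[of t s] assms by (cases s t rule: linorder_cases) (auto simp: abs_minus_commute)
qed

text \<open>The excluded point s = 0 corresponds to the unit sphere when s = 1 - |x|^2, which is a
  null set.\<close>

lemma max0_powr_deriv:
  fixes b s :: real
  assumes "s \<noteq> 0"
  shows "((\<lambda>s. max 0 s powr b) has_real_derivative b * max 0 s powr (b - 1)) (at s)"
proof (cases "s > 0")
  case True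
  have "((\<lambda>s. s powr b) has_real_derivative b * max 0 s powr (b - 1)) (at s)"
    using True has_real_derivative_powr[of s b] by simp
  then show ?thesis
    by (rule has_field_derivative_transform_within_open[where S="{0<..}"]) (use True in auto)
next
  case False
  then have "s < 0" using assms by simp
  have "((\<lambda>s. 0) has_real_derivative b * max 0 s powr (b - 1)) (at s)"
    using \<open>s < 0\<close> by simp
  then show ?thesis
    by (rule has_field_derivative_transform_within_open[where S="{..<0}"]) (use \<open>s < 0\<close> in auto)
qed

text \<open>The function \<open>u\<close> below is
  Lipschitz with compact support, so its difference quotients are dominated, and their integrals
  vanish by translation invariance.\<close>

lemma ball_moment_by_parts:
  fixes q q' :: "real ^ 'n \<Rightarrow> real" and z :: "real ^ 'n"
  assumes m: "m \<ge> 1"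
    and deriv: "\<And>x. ((\<lambda>h. q (x + h *\<^sub>R z)) has_real_derivative q' x) (at 0)"
    and cont: "continuous_on UNIV q" "continuous_on UNIV q'"
  shows "ball_moment (m + 2) q' = (real m + 1) * ball_moment m (\<lambda>x. (x \<bullet> z) * q x)"
proof -
  \<comment> \<open>The power (1 - |x|^2)^b is the weight belonging to m + 2, and its derivative
    contains the exponent b - 1 = (m - 1) / 2, the weight belonging to m.\<close>
  define b where "b = (real m + 1) / 2"
  have b: "b \<ge> 1" using m by (simp add: b_def)
  define P where "P x = 1 - (norm x)\<^sup>2" for x :: "real ^ 'n"
  define u where "u x = max 0 (P x) powr b * q x" for x
  define g where "g x = b * max 0 (P x) powr (b - 1) * (- 2 * (x \<bullet> z)) * q x + max 0 (P x) powr b * q' x" for x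
  define h where "h k = inverse (real (Suc k))" for k
  define f where "f k x = (u (x + h k *\<^sub>R z) - u x) / h k" for k x
  have h: "h k > 0" "h k \<le> 1" for k by (simp_all add: h_def divide_simps)
  have P_shift: "P (x + t *\<^sub>R z) = P x - 2 * t * (x \<bullet> z) - t\<^sup>2 * (norm z)\<^sup>2" for x t
    unfolding P_def power2_norm_eq_inner by (simp add: inner_simps inner_commute power2_eq_square algebra_simps)
  have P_deriv: "((\<lambda>t. P (x + t *\<^sub>R z)) has_real_derivative (- 2 * (x \<bullet> z))) (at 0)" for x
    unfolding P_shift by (auto intro!: derivative_eq_intros)
  have cont_P: "continuous_on UNIV P" unfolding P_def by (intro continuous_intros)
  have cont_w: "continuous_on UNIV (\<lambda>x. max 0 (P x) powr b)"
    using b by (intro continuous_on_powr' continuous_intros cont_P) auto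
  have cont_u: "continuous_on UNIV u"
    unfolding u_def by (intro continuous_intros cont_w cont)
  have [measurable]: "u \<in> borel_measurable borel" "q \<in> borel_measurable borel" "q' \<in> borel_measurable borel"
      "P \<in> borel_measurable borel"
    by (intro borel_measurable_continuous_onI cont_u cont cont_P)+
  have P_out: "max 0 (P x) = 0" if "norm x \<ge> 1" for x
    using that by (simp add: P_def)
  have P_in: "max 0 (P x) = P x" if "norm x \<le> 1" for x
    using that by (simp add: P_def power_le_one)
  have P01: "max 0 (P x) \<in> {0..1}" for x by (auto simp: P_def)
  have u_out: "u x = 0" if "norm x \<ge> 1" for x
    using that by (simp add: u_def P_out)
  \<comment> \<open>For |x| > R neither x nor x + t z with 0 <= t <= 1 lies in the open unit ball,
    so all difference quotients vanish there. For |x| <= R the segment stays within radius R +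
    R.\<close>
  define R where "R = 1 + norm z"
  have "compact (q ` cball 0 (R + R))" "compact (q' ` cball 0 (R + R))"
    by (intro compact_continuous_image continuous_on_subset[OF cont(1)] continuous_on_subset[OF cont(2)]; simp)+
  then obtain B0 B1 where B0: "\<And>x. norm x \<le> R + R \<Longrightarrow> \<bar>q x\<bar> \<le> B0" and B1: "\<And>x. norm x \<le> R + R \<Longrightarrow> \<bar>q' x\<bar> \<le> B1"
    by (metis bounded_iff compact_imp_bounded imageI mem_cball_0 real_norm_def)
  define M where "M = b * (2 * R * R + R * R) * B0 + B1"
  have "B0 \<ge> 0" "B1 \<ge> 0" using B0[of 0] B1[of 0] by (auto simp: R_def)
  have R: "R \<ge> 1" "norm z \<le> R" by (simp_all add: R_def)
  have lip: "\<bar>u (x + t *\<^sub>R z) - u x\<bar> \<le> M * t" if x: "norm x \<le> R" and t: "0 < t" "t \<le> 1" for x t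
  proof -
    have tz: "norm (s *\<^sub>R z) \<le> R" if "0 \<le> s" "s \<le> t" for s
    proof -
      have "\<bar>s\<bar> * norm z \<le> 1 * R" using that t R by (intro mult_mono) auto
      then show ?thesis by simp
    qed
    have in_ball: "norm (x + s *\<^sub>R z) \<le> R + R" if "0 \<le> s" "s \<le> t" for s
      using norm_triangle_ineq[of x "s *\<^sub>R z"] tz[OF that] x by linarith
    have "\<bar>q (x + t *\<^sub>R z) - q (x + 0 *\<^sub>R z)\<bar> \<le> B1 * \<bar>t - 0\<bar>"
    proof (rule field_differentiable_bound[where S="{0..t}" and f="\<lambda>s. q (x + s *\<^sub>R z)" and f'="\<lambda>s. q' (x + s *\<^sub>R z)", unfolded real_norm_def])
      fix s assume s: "s \<in> {0..t}"
      have "((\<lambda>r. q (x + s *\<^sub>R z + r *\<^sub>R z)) has_real_derivative q' (x + s *\<^sub>R z)) (at (s - s))"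
        using deriv[of "x + s *\<^sub>R z"] by simp
      then have "((\<lambda>r. q (x + s *\<^sub>R z + (r - s) *\<^sub>R z)) has_real_derivative q' (x + s *\<^sub>R z) * 1) (at s)"
        by (rule DERIV_chain2) (auto intro!: derivative_eq_intros)
      then show "((\<lambda>s. q (x + s *\<^sub>R z)) has_real_derivative q' (x + s *\<^sub>R z)) (at s within {0..t})"
        by (auto simp: algebra_simps intro: has_field_derivative_at_within)
      show "\<bar>q' (x + s *\<^sub>R z)\<bar> \<le> B1" using s in_ball by (intro B1) auto
    qed (use t in auto)
    then have dq: "\<bar>q (x + t *\<^sub>R z) - q x\<bar> \<le> B1 * t" using t by simp
    have "\<bar>max 0 (P (x + t *\<^sub>R z)) powr b - max 0 (P x) powr b\<bar> \<le> b * \<bar>max 0 (P (x + t *\<^sub>R z)) - max 0 (P x)\<bar>"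
      by (intro powr_lipschitz b P01)
    also have "\<dots> \<le> b * \<bar>P (x + t *\<^sub>R z) - P x\<bar>"
      using b by (intro mult_left_mono) auto
    also have "\<bar>P (x + t *\<^sub>R z) - P x\<bar> \<le> t * (2 * R * R + R * R)"
    proof -
      have "\<bar>x \<bullet> z\<bar> \<le> R * R"
        using Cauchy_Schwarz_ineq2[of x z] mult_mono[OF x R(2)] R by (auto simp: R_def)
      then have 1: "2 * t * \<bar>x \<bullet> z\<bar> \<le> 2 * t * (R * R)"
        using t by (intro mult_left_mono) auto
      have "t * (norm z)\<^sup>2 \<le> 1 * (R * R)"
        unfolding power2_eq_square using t R by (intro mult_mono) auto
      then have 2: "t * (t * (norm z)\<^sup>2) \<le> t * (R * R)"
        using t by (intro mult_left_mono) auto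
      have "\<bar>P (x + t *\<^sub>R z) - P x\<bar> \<le> \<bar>2 * t * (x \<bullet> z)\<bar> + \<bar>t * (t * (norm z)\<^sup>2)\<bar>"
        unfolding P_shift by (simp add: power2_eq_square)
      also have "\<dots> = 2 * t * \<bar>x \<bullet> z\<bar> + t * (t * (norm z)\<^sup>2)"
        using t by (simp add: abs_mult)
      finally show ?thesis using 1 2 by (simp add: algebra_simps)
    qed
    finally have dp: "\<bar>max 0 (P (x + t *\<^sub>R z)) powr b - max 0 (P x) powr b\<bar> \<le> b * (t * (2 * R * R + R * R))"
      using b by simp
    have "u (x + t *\<^sub>R z) - u x = (max 0 (P (x + t *\<^sub>R z)) powr b - max 0 (P x) powr b) * q (x + t *\<^sub>R z)
        + max 0 (P x) powr b * (q (x + t *\<^sub>R z) - q x)"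
      by (simp add: u_def algebra_simps)
    also have "\<bar>\<dots>\<bar> \<le> b * (t * (2 * R * R + R * R)) * B0 + 1 * (B1 * t)"
    proof (rule order_trans[OF abs_triangle_ineq], unfold abs_mult, intro add_mono mult_mono dp dq)
      show "\<bar>q (x + t *\<^sub>R z)\<bar> \<le> B0" using in_ball[of t] t by (intro B0) auto
      show "\<bar>max 0 (P x) powr b\<bar> \<le> 1" using P01[of x] b by (auto intro!: powr_le1)
      show "0 \<le> b * (t * (2 * R * R + R * R))" using b t R by simp
    qed auto
    finally show ?thesis by (simp add: M_def algebra_simps)
  qed
  have f_bound: "\<bar>f k x\<bar> \<le> M * indicator (cball 0 R) x" for k x
  proof (cases "norm x \<le> R")
    case True
    from lip[OF True h(1,2)[of k]] show ?thesis
      using h(1)[of k] True by (simp add: f_def abs_divide divide_le_eq)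
  next
    case False
    have "norm (h k *\<^sub>R z) \<le> norm z"
      using h[of k] by (simp add: mult_left_le_one_le)
    then have "norm (x + h k *\<^sub>R z) \<ge> 1"
      using False norm_diff_ineq[of x "h k *\<^sub>R z"] by (simp add: R_def)
    moreover have "norm x \<ge> 1" using False norm_ge_zero[of z] unfolding R_def by linarith
    ultimately show ?thesis using False u_out[of x] u_out[of "x + h k *\<^sub>R z"] by (simp add: f_def)
  qed
  have u_int: "integrable lborel u"
  proof -
    have "integrable lborel (\<lambda>x. indicator (cball 0 1) x *\<^sub>R u x)"
      using borel_integrable_compact[of "cball 0 1" u] continuous_on_subset[OF cont_u] by (simp add: set_integrable_def)
    moreover have "(\<lambda>x. indicator (cball 0 1) x *\<^sub>R u x) = u"
      using u_out by (auto simp: indicator_def fun_eq_iff)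
    ultimately show ?thesis by simp
  qed
  have u_shift: "integrable lborel (\<lambda>x. u (x + c))" "(\<integral>x. u (x + c) \<partial>lborel) = (\<integral>x. u x \<partial>lborel)" for c
  proof -
    have "integrable (distr lborel borel ((+) c)) u" using u_int by (simp add: lborel_distr_plus)
    then show "integrable lborel (\<lambda>x. u (x + c))"
      by (subst (asm) integrable_distr_eq) (auto simp: add.commute)
    have "(\<integral>x. u x \<partial>lborel) = (\<integral>x. u x \<partial>distr lborel borel ((+) c))" by (simp add: lborel_distr_plus)
    also have "\<dots> = (\<integral>x. u (x + c) \<partial>lborel)" by (subst integral_distr) (auto simp: add.commute)
    finally show "(\<integral>x. u (x + c) \<partial>lborel) = (\<integral>x. u x \<partial>lborel)" ..
  qed
  have f_int: "(\<integral>x. f k x \<partial>lborel) = 0" for k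
    unfolding f_def using u_int u_shift by simp
  have f_lim: "(\<lambda>k. f k x) \<longlonglongrightarrow> g x" if "norm x \<noteq> 1" for x
  proof -
    have "norm x \<noteq> - 1" using norm_ge_zero[of x] by linarith
    then have "P x \<noteq> 0" using that by (simp add: P_def power2_eq_1_iff)
    have "((\<lambda>t. max 0 (P (x + t *\<^sub>R z)) powr b) has_real_derivative b * max 0 (P x) powr (b - 1) * (- 2 * (x \<bullet> z))) (at 0)"
      by (rule DERIV_chain2[OF _ P_deriv]) (use max0_powr_deriv[OF \<open>P x \<noteq> 0\<close>] in simp)
    from DERIV_mult[OF this deriv[of x]]
    have "((\<lambda>t. u (x + t *\<^sub>R z)) has_real_derivative g x) (at 0)"
      unfolding u_def g_def by (simp add: algebra_simps)
    then have "((\<lambda>t. (u (x + t *\<^sub>R z) - u x) / t) \<longlongrightarrow> g x) (at 0)"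
      unfolding DERIV_def by simp
    moreover have "filterlim h (at 0) sequentially"
      unfolding filterlim_at using LIMSEQ_inverse_real_of_nat by (auto simp: h_def[abs_def])
    ultimately show ?thesis
      unfolding f_def by (rule filterlim_compose)
  qed
  have sphere: "AE x in lborel. x \<notin> sphere (0 :: real ^ 'n) 1"
  proof (rule AE_not_in)
    show "sphere (0 :: real ^ 'n) 1 \<in> null_sets lborel"
      using negligible_sphere[of "0 :: real ^ 'n" 1]
      by (auto simp: null_sets_completion_iff negligible_iff_null_sets negligible_convex_frontier)
  qed
  have "(\<lambda>k. \<integral>x. f k x \<partial>lborel) \<longlonglongrightarrow> (\<integral>x. g x \<partial>lborel)"
  proof (rule integral_dominated_convergence)
    show "integrable lborel (\<lambda>x :: real ^ 'n. M * indicator (cball 0 R) x)"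
      by (intro integrable_mult_right integrable_real_indicator) (auto simp: emeasure_lborel_cball_finite[unfolded infinity_ennreal_def])
    show "AE x in lborel. (\<lambda>k. f k x) \<longlonglongrightarrow> g x"
      using sphere by eventually_elim (auto intro: f_lim)
    show "AE x in lborel. norm (f k x) \<le> M * indicator (cball 0 R) x" for k
      using f_bound by simp
    show "g \<in> borel_measurable lborel" unfolding g_def by measurable
    show "f k \<in> borel_measurable lborel" for k unfolding f_def by measurable
  qed
  then have g0: "(\<integral>x. g x \<partial>lborel) = 0"
    unfolding f_int by (simp add: LIMSEQ_const_iff)
  have g_eq: "g x = indicator unit_ball x * (q' x * (1 - (norm x)\<^sup>2) powr ((real (m + 2) - 1) / 2))
      - (real m + 1) * (indicator unit_ball x * (((x \<bullet> z) * q x) * (1 - (norm x)\<^sup>2) powr ((real m - 1) / 2)))" for x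
  proof (cases "norm x \<le> 1")
    case True
    have e: "(real (m + 2) - 1) / 2 = b" "(real m - 1) / 2 = b - 1" "real m + 1 = 2 * b"
      by (simp_all add: b_def field_simps)
    show ?thesis
      using True P_in[OF True] unfolding g_def e P_def[symmetric] by simp
  next
    case False
    then show ?thesis by (simp add: g_def P_out)
  qed
  have "0 = (\<integral>x. indicator unit_ball x * (q' x * (1 - (norm x)\<^sup>2) powr ((real (m + 2) - 1) / 2))
      - (real m + 1) * (indicator unit_ball x * (((x \<bullet> z) * q x) * (1 - (norm x)\<^sup>2) powr ((real m - 1) / 2))) \<partial>lborel)"
    using g0 unfolding g_eq by simp
  also have "\<dots> = ball_moment (m + 2) q' - (real m + 1) * ball_moment m (\<lambda>x. (x \<bullet> z) * q x)"
  proof -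
    have "integrable lborel (\<lambda>x. (real m + 1) * (indicator unit_ball x * (((x \<bullet> z) * q x) * (1 - (norm x)\<^sup>2) powr ((real m - 1) / 2))))"
      by (intro integrable_mult_right ball_moment_integrable m continuous_intros cont)
    from Bochner_Integration.integral_diff[OF ball_moment_integrable[of "m + 2" q'] this] show ?thesis
      unfolding ball_moment_eq by (simp add: cont)
  qed
  finally show ?thesis by simp
qed

section \<open>Averages over fibres of the sphere\<close>

text \<open>Powers of the fibre radius sqrt (1 - |x|^2) are absorbed into the weight, so that fibre
  averages can be integrated through ridge moments alone. On the sphere both sides vanish because
  \<open>0 powr\<close> any exponent is 0.\<close>

lemma ball_moment_shift:
  "ball_moment (m + i) f = ball_moment m (\<lambda>x. sqrt (1 - (norm x)\<^sup>2) ^ i * f x)"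
  unfolding ball_moment_eq
proof (intro Bochner_Integration.integral_cong refl)
  fix x :: "real ^ 'a"
  show "indicator unit_ball x * (f x * (1 - (norm x)\<^sup>2) powr ((real (m + i) - 1) / 2)) =
    indicator unit_ball x * (sqrt (1 - (norm x)\<^sup>2) ^ i * f x * (1 - (norm x)\<^sup>2) powr ((real m - 1) / 2))"
  proof (cases "norm x < 1")
    case True
    define P where "P = 1 - (norm x)\<^sup>2"
    have "P > 0" using True by (simp add: P_def abs_square_less_1)
    then have "sqrt P ^ i = P powr (real i / 2)"
      by (simp add: powr_half_sqrt[symmetric] powr_power)
    moreover have "P powr ((real (m + i) - 1) / 2) = P powr (real i / 2) * P powr ((real m - 1) / 2)"
      unfolding powr_add[symmetric] by (simp add: field_simps)
    ultimately show ?thesis by (simp add: P_def)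
  next
    case False
    then consider "norm x = 1" | "norm x > 1" by linarith
    then show ?thesis by cases simp_all
  qed
qed

lemma ball_moment_shift_2:
  "ball_moment (m + 2) f = ball_moment m (\<lambda>x. (1 - (norm x)\<^sup>2) * f x)"
  unfolding ball_moment_shift by (intro ball_moment_cong) (simp add: power_le_one)

section \<open>Moments of products of two ridge powers\<close>

definition ridge_moment :: "nat \<Rightarrow> real ^ 'n \<Rightarrow> real ^ 'n \<Rightarrow> nat \<Rightarrow> nat \<Rightarrow> real" where
  "ridge_moment m y z a b = ball_moment m (\<lambda>x. (x \<bullet> y) ^ a * (x \<bullet> z) ^ b)"

lemma ridge_moment_by_parts:
  assumes "m \<ge> 1"
  shows "a * (e \<bullet> y) * ridge_moment (m + 2) y z (a - 1) b + b * (e \<bullet> z) * ridge_moment (m + 2) y z a (b - 1)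
    = (real m + 1) * ball_moment m (\<lambda>x. (x \<bullet> e) * ((x \<bullet> y) ^ a * (x \<bullet> z) ^ b))"
proof -
  have "ball_moment (m + 2) (\<lambda>x. (a * (e \<bullet> y)) * ((x \<bullet> y) ^ (a - 1) * (x \<bullet> z) ^ b) + (b * (e \<bullet> z)) * ((x \<bullet> y) ^ a * (x \<bullet> z) ^ (b - 1)))
    = (real m + 1) * ball_moment m (\<lambda>x. (x \<bullet> e) * ((x \<bullet> y) ^ a * (x \<bullet> z) ^ b))"
    by (rule ball_moment_by_parts[OF assms])
       (auto simp: inner_simps algebra_simps intro!: derivative_eq_intros continuous_intros)
  then show ?thesis
    unfolding ridge_moment_def
    by (subst (asm) ball_moment_add) (use assms in \<open>auto simp: ball_moment_cmult intro!: continuous_intros\<close>)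
qed

text \<open>Integration by parts for x_i f in direction i, summed over i. Euler's identity for f,
  homogeneous of degree a + b, gives the factor d + a + b; writing |x|^2 as 1 - (1 - |x|^2) brings
  the other side back to moments for m and m + 2.\<close>

lemma ridge_moment_euler:
  fixes y z :: "real ^ 'n"
  assumes "m \<ge> 1"
  shows "(real CARD('n) + a + b + m + 1) * ridge_moment (m + 2) y z a b = (real m + 1) * ridge_moment m y z a b"
proof -
  define f where "f x = (x \<bullet> y) ^ a * (x \<bullet> z) ^ b" for x
  define f' where "f' i x = a * (y $ i) * ((x \<bullet> y) ^ (a - 1) * (x \<bullet> z) ^ b) + b * (z $ i) * ((x \<bullet> y) ^ a * (x \<bullet> z) ^ (b - 1))" for i x
  have cf: "continuous_on UNIV f" unfolding f_def by (intro continuous_intros)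
  have cf': "continuous_on UNIV (f' i)" for i unfolding f'_def by (intro continuous_intros)
  have "ball_moment (m + 2) (\<lambda>x. f x + x $ i * f' i x) = (real m + 1) * ball_moment m (\<lambda>x. (x \<bullet> axis i 1) * (x $ i * f x))" for i
  proof (rule ball_moment_by_parts[OF assms])
    fix x
    show "((\<lambda>h. (x + h *\<^sub>R axis i 1) $ i * f (x + h *\<^sub>R axis i 1)) has_real_derivative f x + x $ i * f' i x) (at 0)"
    proof -
      have "((\<lambda>h. (x \<bullet> y + h * y $ i) ^ a * (x \<bullet> z + h * z $ i) ^ b) has_real_derivative f' i x) (at 0)"
        unfolding f'_def by (auto intro!: derivative_eq_intros)
      then have d1: "((\<lambda>h. f (x + h *\<^sub>R axis i 1)) has_real_derivative f' i x) (at 0)"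
        by (simp add: f_def inner_add_left inner_axis')
      have d2: "((\<lambda>h. (x + h *\<^sub>R axis i 1) $ i) has_real_derivative 1) (at 0)"
        by (auto intro!: derivative_eq_intros)
      show ?thesis
        using DERIV_mult[OF d2 d1] by (simp add: mult.commute)
    qed
  qed (intro continuous_intros cf cf')+
  then have "(\<Sum>i\<in>UNIV. ball_moment (m + 2) (\<lambda>x. f x + x $ i * f' i x)) = (\<Sum>i\<in>UNIV. (real m + 1) * ball_moment m (\<lambda>x. (x $ i)\<^sup>2 * f x))"
    by (simp add: inner_axis power2_eq_square mult.assoc)
  moreover have "(\<Sum>i\<in>UNIV. ball_moment (m + 2) (\<lambda>x. f x + x $ i * f' i x)) = ball_moment (m + 2) (\<lambda>x. (real CARD('n) + a + b) * f x)"
  proof -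
    have "(\<Sum>i\<in>UNIV. f x + x $ i * f' i x) = (real CARD('n) + a + b) * f x" for x
    proof -
      define G H where "G = a * ((x \<bullet> y) ^ (a - 1) * (x \<bullet> z) ^ b)" and "H = b * ((x \<bullet> y) ^ a * (x \<bullet> z) ^ (b - 1))"
      have "x $ i * f' i x = G * (x $ i * y $ i) + H * (x $ i * z $ i)" for i
        unfolding f'_def G_def H_def by (simp only: distrib_left mult_ac)
      then have "(\<Sum>i\<in>UNIV. x $ i * f' i x) = G * (x \<bullet> y) + H * (x \<bullet> z)"
        by (simp only: sum.distrib sum_distrib_left[symmetric] inner_vec_def inner_real_def)
      also have "G * (x \<bullet> y) = real a * f x"
        unfolding G_def f_def by (cases a) (simp_all add: mult_ac)
      also have "H * (x \<bullet> z) = real b * f x"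
        unfolding H_def f_def by (cases b) (simp_all add: mult_ac)
      finally show ?thesis by (simp add: sum.distrib algebra_simps)
    qed
    then show ?thesis
      by (subst ball_moment_sum[symmetric]) (use assms in \<open>auto intro!: continuous_intros cf cf'\<close>)
  qed
  moreover have "(\<Sum>i\<in>UNIV. (real m + 1) * ball_moment m (\<lambda>x. (x $ i)\<^sup>2 * f x)) = (real m + 1) * ball_moment m (\<lambda>x. (norm x)\<^sup>2 * f x)"
  proof -
    have n: "(norm x)\<^sup>2 = (\<Sum>i\<in>UNIV. (x $ i)\<^sup>2)" for x :: "real ^ 'n"
      unfolding power2_norm_eq_inner by (simp add: inner_vec_def power2_eq_square)
    show ?thesis
      unfolding n sum_distrib_right sum_distrib_left[symmetric]
      by (subst ball_moment_sum) (use assms in \<open>auto intro!: continuous_intros cf\<close>)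
  qed
  moreover have "ball_moment m f = ball_moment (m + 2) f + ball_moment m (\<lambda>x. (norm x)\<^sup>2 * f x)"
    unfolding ball_moment_shift_2
    by (subst ball_moment_add[symmetric]) (use assms in \<open>auto intro!: continuous_intros cf simp: algebra_simps\<close>)
  ultimately have "(real CARD('n) + a + b) * ball_moment (m + 2) f = (real m + 1) * (ball_moment m f - ball_moment (m + 2) f)"
    by (simp add: ball_moment_cmult)
  moreover have "ridge_moment m y z a b = ball_moment m f" "ridge_moment (m + 2) y z a b = ball_moment (m + 2) f"
    by (simp_all add: ridge_moment_def f_def[abs_def])
  ultimately show ?thesis
    by (simp add: algebra_simps)
qed

text \<open>Combines \<open>ridge_moment_by_parts\<close> with \<open>ridge_moment_euler\<close> so
  that the weight for m + 2 disappears. The cases e = y and e = z are the flat versions of the two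
  rules of \<open>gegenbauer_form\<close>.\<close>

lemma ridge_moment_rule:
  fixes y z :: "real ^ 'n"
  assumes "m \<ge> 1"
  shows "(real a + b + CARD('n) + m) * ball_moment m (\<lambda>x. (x \<bullet> e) * ((x \<bullet> y) ^ a * (x \<bullet> z) ^ b)) =
    a * (e \<bullet> y) * ridge_moment m y z (a - 1) b + b * (e \<bullet> z) * ridge_moment m y z a (b - 1)"
proof -
  let ?s = "real a + b + CARD('n) + m"
  have 1: "a * (?s * ridge_moment (m + 2) y z (a - 1) b) = a * ((real m + 1) * ridge_moment m y z (a - 1) b)"
    using ridge_moment_euler[OF assms, of "a - 1" b y z] by (cases a) (simp_all add: algebra_simps)
  have 2: "b * (?s * ridge_moment (m + 2) y z a (b - 1)) = b * ((real m + 1) * ridge_moment m y z a (b - 1))"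
    using ridge_moment_euler[OF assms, of a "b - 1" y z] by (cases b) (simp_all add: algebra_simps)
  have "(real m + 1) * (?s * ball_moment m (\<lambda>x. (x \<bullet> e) * ((x \<bullet> y) ^ a * (x \<bullet> z) ^ b))) =
      ?s * (a * (e \<bullet> y) * ridge_moment (m + 2) y z (a - 1) b + b * (e \<bullet> z) * ridge_moment (m + 2) y z a (b - 1))"
    unfolding ridge_moment_by_parts[OF assms] by (simp only: mult.left_commute)
  also have "\<dots> = (e \<bullet> y) * (a * (?s * ridge_moment (m + 2) y z (a - 1) b)) + (e \<bullet> z) * (b * (?s * ridge_moment (m + 2) y z a (b - 1)))"
    by (simp only: distrib_left mult_ac)
  also have "\<dots> = (real m + 1) * (a * (e \<bullet> y) * ridge_moment m y z (a - 1) b + b * (e \<bullet> z) * ridge_moment m y z a (b - 1))"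
    unfolding 1 2 by (simp only: distrib_left mult_ac)
  finally show ?thesis
    by (subst (asm) mult_cancel_left) linarith
qed

lemma ridge_moment_rule_left:
  fixes y z :: "real ^ 'n"
  assumes "m \<ge> 1"
  shows "(real a + b + CARD('n) + m) * ridge_moment m y z (Suc a) b =
    a * (norm y)\<^sup>2 * ridge_moment m y z (a - 1) b + b * (y \<bullet> z) * ridge_moment m y z a (b - 1)"
  using ridge_moment_rule[OF assms, of a b y y z] by (simp add: ridge_moment_def power2_norm_eq_inner mult.assoc)

lemma ridge_moment_rule_right:
  fixes y z :: "real ^ 'n"
  assumes "m \<ge> 1" "norm z = 1"
  shows "(real a + b + CARD('n) + m) * ridge_moment m y z a (Suc b) =
    a * (y \<bullet> z) * ridge_moment m y z (a - 1) b + b * ridge_moment m y z a (b - 1)"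
proof -
  have "z \<bullet> z = 1" using assms(2) by (simp add: norm_eq_1)
  then show ?thesis
    using ridge_moment_rule[OF assms(1), of a b z y z]
    by (simp add: ridge_moment_def mult.left_commute inner_commute)
qed

section \<open>Fibre averages and their bilinear form\<close>

text \<open>The moments of one coordinate of a uniformly distributed point on the unit sphere of
  dimension m, which is the fibre after scaling.\<close>

definition sin_moment :: "nat \<Rightarrow> nat \<Rightarrow> real" where
  "sin_moment m i = sin_integral (real m - 1) (\<lambda>t. t ^ i) / sin_integral (real m - 1) (\<lambda>_. 1)"

lemma sin_moment_0: "m \<ge> 1 \<Longrightarrow> sin_moment m 0 = 1"
  using sin_integral_1_pos[of "real m - 1"] by (simp add: sin_moment_def)

lemma sin_moment_rec: "m \<ge> 1 \<Longrightarrow> (real i + m) * sin_moment m (Suc i) = i * sin_moment m (i - 1)"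
  using sin_integral_power_rec[of "real m - 1" i] by (simp add: sin_moment_def field_simps)

lemma sin_moment_odd:
  assumes "m \<ge> 1" "odd i"
  shows "sin_moment m i = 0"
  using assms(2)
proof (induction i rule: less_induct)
  case (less i)
  then obtain j where i: "i = Suc j" by (cases i) auto
  have "real j * sin_moment m (j - 1) = 0"
    using less i by (cases j) auto
  then have "(real j + m) * sin_moment m (Suc j) = 0"
    by (simp only: sin_moment_rec[OF assms(1)])
  then show ?case using assms(1) i by auto
qed

text \<open>With \<open>X\<close> running over the fibre of the sphere of dimension \<open>CARD('n) + m\<close> over \<open>x\<close>, and
  \<open>Y\<close> a point over \<open>y\<close>, this is the average of \<open>g (X \<bullet> Y)\<close>.\<close>

definition fibre_average :: "nat \<Rightarrow> (real \<Rightarrow> real) \<Rightarrow> real ^ 'n \<Rightarrow> real ^ 'n \<Rightarrow> real" where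
  "fibre_average m g x y =
     sin_integral (real m - 1) (\<lambda>s. g (x \<bullet> y + sqrt (1 - (norm x)\<^sup>2) * sqrt (1 - (norm y)\<^sup>2) * s))
       / sin_integral (real m - 1) (\<lambda>_. 1)"

text \<open>In the model this is the integral of (X . Y)^N (X . Z)^k, with X . Y expanded into its
  ball part x . y and its fibre part. For |z| = 1 the fibre over z is a single point, so X . Z = x .
  z and a second average does not arise.\<close>

definition fibre_form :: "nat \<Rightarrow> real ^ 'n \<Rightarrow> real ^ 'n \<Rightarrow> nat \<Rightarrow> nat \<Rightarrow> real" where
  "fibre_form m y z N k = (\<Sum>i\<le>N. real (N choose i) *
     (sin_moment m i * sqrt (1 - (norm y)\<^sup>2) ^ i * ridge_moment (m + i) y z (N - i) k))"

lemma sum_binomial_diff_mult: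
  fixes g :: "nat \<Rightarrow> real"
  shows "(\<Sum>i\<le>N. real (N choose i) * (real (N - i) * g i)) = N * (\<Sum>i\<le>N - 1. real (N - 1 choose i) * g i)"
proof (cases N)
  case (Suc n)
  have e: "real (N choose i) * real (N - i) = real N * real (n choose i)" for i
    using binomial_absorb_comp[of N i] by (metis Suc diff_Suc_1 mult.commute of_nat_mult)
  have "(\<Sum>i\<le>N. real (N choose i) * (real (N - i) * g i)) = (\<Sum>i\<le>n. real (N choose i) * (real (N - i) * g i))"
    unfolding Suc by simp
  also have "\<dots> = (\<Sum>i\<le>n. real N * (real (n choose i) * g i))"
    unfolding mult.assoc[symmetric] e ..
  finally show ?thesis
    using Suc by (simp add: sum_distrib_left)
qed simp

lemma sum_binomial_pascal:
  fixes g :: "nat \<Rightarrow> real"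
  shows "(\<Sum>i\<le>Suc N. real (Suc N choose i) * g i) = (\<Sum>i\<le>N. real (N choose i) * g i) + (\<Sum>i\<le>N. real (N choose i) * g (Suc i))"
proof -
  have "(\<Sum>i\<le>N. real (N choose i) * g i) = (\<Sum>i\<le>Suc N. real (N choose i) * g i)"
    by simp
  also have "\<dots> = g 0 + (\<Sum>i\<le>N. real (N choose Suc i) * g (Suc i))"
    by (subst sum.atMost_Suc_shift) simp
  finally show ?thesis
    by (subst sum.atMost_Suc_shift) (simp add: sum.distrib algebra_simps)
qed

text \<open>All terms obey the ridge rules with one common factor \<open>?s\<close>, because the i
  lost in the exponent N - i is regained in the weight index m + i. In the left rule Pascal's
  identity splits off one factor X . Y: its ball part contributes |y|^2 and its fibre part 1 -
  |y|^2, which together give |Y|^2 = 1.\<close>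

lemma gegenbauer_form_fibre_form:
  fixes y z :: "real ^ 'n"
  assumes m: "m \<ge> 1" and y: "norm y \<le> 1" and z: "norm z = 1"
  shows "gegenbauer_form ((real CARD('n) + m - 1) / 2) (y \<bullet> z) (fibre_form m y z)"
proof (intro gegenbauer_form.intro)
  have "real CARD('n) > 0" "real m \<ge> 1" using m by simp_all
  then have "real CARD('n) + m - 1 > 0" by linarith
  then show "(real CARD('n) + m - 1) / 2 > 0" by (rule half_gt_zero)
next
  fix N k :: nat
  define q where "q = sqrt (1 - (norm y)\<^sup>2)"
  have q2: "q\<^sup>2 = 1 - (norm y)\<^sup>2"
    using y by (simp add: q_def power_le_one)
  define c where "c i = sin_moment m i * q ^ i" for i
  define R where "R i a b = ridge_moment (m + i) y z a b" for i a b
  let ?s = "real N + k + CARD('n) + m"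
  have F: "fibre_form m y z N k = (\<Sum>i\<le>N. real (N choose i) * (c i * R i (N - i) k))" for N k
    by (simp add: fibre_form_def c_def R_def q_def)
  have m1: "m + i \<ge> 1" for i using m by simp
  have right: "?s * R i (N - i) (Suc k) = real (N - i) * (y \<bullet> z) * R i (N - 1 - i) k + k * R i (N - i) (k - 1)" if "i \<le> N" for i
  proof -
    have e: "real (N - i) + k + CARD('n) + real (m + i) = ?s"
      using that by (simp add: of_nat_diff)
    show ?thesis
      using ridge_moment_rule_right[OF m1 z, of "N - i" k i y] unfolding e R_def by simp
  qed
  have left: "?s * R i (Suc N - i) k = real (N - i) * (norm y)\<^sup>2 * R i (N - 1 - i) k + k * (y \<bullet> z) * R i (N - i) (k - 1)" if "i \<le> N" for i
  proof -
    have e: "real (N - i) + k + CARD('n) + real (m + i) = ?s"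
      using that by (simp add: of_nat_diff)
    show ?thesis
      using ridge_moment_rule_left[OF m1, of "N - i" k i y z] that unfolding e R_def by (simp add: Suc_diff_le)
  qed
  have eN: "real N + k + 2 * ((real CARD('n) + m - 1) / 2) + 1 = ?s" by (simp add: field_simps)
  have "?s * fibre_form m y z N (Suc k) = (\<Sum>i\<le>N. real (N choose i) * (c i * (?s * R i (N - i) (Suc k))))"
    unfolding F sum_distrib_left by (simp only: mult_ac)
  also have "\<dots> = (\<Sum>i\<le>N. (y \<bullet> z) * (real (N choose i) * (real (N - i) * (c i * R i (N - 1 - i) k))) + k * (real (N choose i) * (c i * R i (N - i) (k - 1))))"
    by (intro sum.cong refl, subst right, simp, simp only: distrib_left mult_ac)
  also have "\<dots> = N * (y \<bullet> z) * fibre_form m y z (N - 1) k + k * fibre_form m y z N (k - 1)"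
    unfolding sum.distrib sum_distrib_left[symmetric] sum_binomial_diff_mult F by simp
  finally show "(real N + k + 2 * ((real CARD('n) + m - 1) / 2) + 1) * fibre_form m y z N (Suc k) =
      k * fibre_form m y z N (k - 1) + N * (y \<bullet> z) * fibre_form m y z (N - 1) k"
    unfolding eN by (simp only: add.commute)
  have "?s * (\<Sum>i\<le>N. real (N choose i) * (c i * R i (Suc N - i) k)) = (\<Sum>i\<le>N. real (N choose i) * (c i * (?s * R i (Suc N - i) k)))"
    unfolding sum_distrib_left by (simp only: mult_ac)
  also have "\<dots> = (\<Sum>i\<le>N. (norm y)\<^sup>2 * (real (N choose i) * (real (N - i) * (c i * R i (N - 1 - i) k))) + k * (y \<bullet> z) * (real (N choose i) * (c i * R i (N - i) (k - 1))))"
    by (intro sum.cong refl, subst left, simp, simp only: distrib_left mult_ac)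
  also have "\<dots> = (norm y)\<^sup>2 * (N * fibre_form m y z (N - 1) k) + k * (y \<bullet> z) * fibre_form m y z N (k - 1)"
    unfolding sum.distrib sum_distrib_left[symmetric] sum_binomial_diff_mult F by simp
  finally have part1: "?s * (\<Sum>i\<le>N. real (N choose i) * (c i * R i (Suc N - i) k)) =
    (norm y)\<^sup>2 * (N * fibre_form m y z (N - 1) k) + k * (y \<bullet> z) * fibre_form m y z N (k - 1)" .
  \<comment> \<open>The term i = 0 contains the first fibre moment, which is 0. In the others,
    shifted by two in the moment index, the factor m + i + 1 produced by
    \<open>ridge_moment_euler\<close> is exactly the one in \<open>sin_moment_rec\<close>.\<close>
  have part2: "?s * (\<Sum>i\<le>N. real (N choose i) * (c (Suc i) * R (Suc i) (N - i) k)) = q\<^sup>2 * (N * fibre_form m y z (N - 1) k)"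
  proof (cases N)
    case 0
    then show ?thesis using sin_moment_odd[OF m, of 1] by (simp add: c_def)
  next
    case (Suc n)
    have t: "real (N choose Suc i) * (c (i + 2) * (?s * R (i + 2) (n - i) k)) = q\<^sup>2 * (N * (real (n choose i) * (c i * R i (n - i) k)))" if "i \<le> n" for i
    proof -
      have 1: "?s * R (i + 2) (n - i) k = (real (m + i) + 1) * R i (n - i) k"
      proof -
        have e: "real CARD('n) + (n - i) + k + (m + i) + 1 = ?s"
          using that Suc by (simp add: of_nat_diff)
        show ?thesis
          using ridge_moment_euler[OF m1, of "n - i" k i y z] unfolding e R_def by simp
      qed
      have 2: "(real (m + i) + 1) * sin_moment m (i + 2) = (real i + 1) * sin_moment m i"
        using sin_moment_rec[OF m, of "Suc i"] by (simp add: add_ac)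
      have 3: "(real i + 1) * real (N choose Suc i) = N * real (n choose i)"
        using Suc_times_binomial[of i n] Suc by (metis of_nat_Suc of_nat_mult add.commute)
      have "real (N choose Suc i) * (c (i + 2) * (?s * R (i + 2) (n - i) k)) =
          q ^ (i + 2) * R i (n - i) k * (real (N choose Suc i) * ((real (m + i) + 1) * sin_moment m (i + 2)))"
        unfolding 1 c_def by (simp only: mult_ac)
      also have "\<dots> = q ^ (i + 2) * R i (n - i) k * sin_moment m i * ((real i + 1) * real (N choose Suc i))"
        unfolding 2 by (simp only: mult_ac)
      also have "\<dots> = q\<^sup>2 * (N * (real (n choose i) * (c i * R i (n - i) k)))"
        unfolding 3 c_def power_add by (simp only: mult_ac)
      finally show ?thesis .
    qed
    have "?s * (\<Sum>i\<le>N. real (N choose i) * (c (Suc i) * R (Suc i) (N - i) k)) =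
        (\<Sum>i\<le>N. real (N choose i) * (c (Suc i) * (?s * R (Suc i) (N - i) k)))"
      unfolding sum_distrib_left by (simp only: mult_ac)
    also have "\<dots> = (\<Sum>i\<le>n. real (N choose Suc i) * (c (i + 2) * (?s * R (i + 2) (n - i) k)))"
      unfolding Suc by (subst sum.atMost_Suc_shift) (use sin_moment_odd[OF m, of 1] in \<open>simp add: c_def\<close>)
    also have "\<dots> = (\<Sum>i\<le>n. q\<^sup>2 * (N * (real (n choose i) * (c i * R i (n - i) k))))"
      by (intro sum.cong refl t) simp
    also have "\<dots> = q\<^sup>2 * (N * fibre_form m y z (N - 1) k)"
      unfolding F Suc by (simp add: sum_distrib_left)
    finally show ?thesis .
  qed
  have "?s * fibre_form m y z (Suc N) k = ?s * (\<Sum>i\<le>N. real (N choose i) * (c i * R i (Suc N - i) k))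
      + ?s * (\<Sum>i\<le>N. real (N choose i) * (c (Suc i) * R (Suc i) (N - i) k))"
    unfolding F sum_binomial_pascal by (simp add: distrib_left)
  also have "\<dots> = N * fibre_form m y z (N - 1) k + k * (y \<bullet> z) * fibre_form m y z N (k - 1)"
    unfolding part1 part2 q2 by (simp add: algebra_simps)
  finally show "(real N + k + 2 * ((real CARD('n) + m - 1) / 2) + 1) * fibre_form m y z (Suc N) k =
      N * fibre_form m y z (N - 1) k + k * (y \<bullet> z) * fibre_form m y z N (k - 1)"
    unfolding eN by (simp only: add.commute)
qed

lemma fibre_average_power:
  fixes x y :: "real ^ 'n"
  assumes "m \<ge> 1"
  shows "fibre_average m (\<lambda>t. t ^ N) x y = (\<Sum>i\<le>N. real (N choose i) *
     (sin_moment m i * sqrt (1 - (norm y)\<^sup>2) ^ i * ((x \<bullet> y) ^ (N - i) * sqrt (1 - (norm x)\<^sup>2) ^ i)))"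
proof -
  define p where "p = sqrt (1 - (norm x)\<^sup>2) * sqrt (1 - (norm y)\<^sup>2)"
  have "(x \<bullet> y + p * s) ^ N = (\<Sum>i\<le>N. (real (N choose i) * p ^ i * (x \<bullet> y) ^ (N - i)) * s ^ i)" for s
    unfolding add.commute[of "x \<bullet> y"] binomial_ring by (simp add: power_mult_distrib mult_ac)
  then have "sin_integral (real m - 1) (\<lambda>s. (x \<bullet> y + p * s) ^ N) =
      (\<Sum>i\<le>N. (real (N choose i) * p ^ i * (x \<bullet> y) ^ (N - i)) * sin_integral (real m - 1) (\<lambda>s. s ^ i))"
    using assms by (simp add: sin_integral_sum sin_integral_cmult continuous_intros)
  then show ?thesis
    unfolding fibre_average_def p_def[symmetric]
    by (simp add: sum_divide_distrib sin_moment_def p_def power_mult_distrib mult_ac)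
qed

lemma fibre_average_poly:
  fixes x y :: "real ^ 'n"
  assumes "m \<ge> 1"
  shows "fibre_average m (poly g) x y = (\<Sum>N\<le>degree g. coeff g N * fibre_average m (\<lambda>t. t ^ N) x y)"
  unfolding fibre_average_def poly_altdef
  using assms by (simp add: sin_integral_sum sin_integral_cmult continuous_intros sum_divide_distrib)

lemma continuous_on_fibre_average_power:
  "m \<ge> 1 \<Longrightarrow> continuous_on A (\<lambda>x. fibre_average m (\<lambda>t. t ^ N) x y)"
  by (simp only: fibre_average_power) (intro continuous_intros)

lemma continuous_on_fibre_average_poly:
  "m \<ge> 1 \<Longrightarrow> continuous_on A (\<lambda>x. fibre_average m (poly g) x y)"
  by (simp only: fibre_average_poly) (intro continuous_intros continuous_on_fibre_average_power)

lemma ball_moment_fibre_average_power: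
  fixes y z :: "real ^ 'n"
  assumes "m \<ge> 1"
  shows "ball_moment m (\<lambda>x. fibre_average m (\<lambda>t. t ^ N) x y * (x \<bullet> z) ^ k) = fibre_form m y z N k"
proof -
  define a where "a i = real (N choose i) * (sin_moment m i * sqrt (1 - (norm y)\<^sup>2) ^ i)" for i
  have "ball_moment m (\<lambda>x. fibre_average m (\<lambda>t. t ^ N) x y * (x \<bullet> z) ^ k) =
      ball_moment m (\<lambda>x. \<Sum>i\<le>N. a i * (sqrt (1 - (norm x)\<^sup>2) ^ i * ((x \<bullet> y) ^ (N - i) * (x \<bullet> z) ^ k)))"
    unfolding fibre_average_power[OF assms] sum_distrib_right a_def by (simp only: mult_ac)
  also have "\<dots> = (\<Sum>i\<le>N. a i * ball_moment m (\<lambda>x. sqrt (1 - (norm x)\<^sup>2) ^ i * ((x \<bullet> y) ^ (N - i) * (x \<bullet> z) ^ k)))"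
    by (subst ball_moment_sum) (use assms in \<open>auto simp: ball_moment_cmult intro!: continuous_intros\<close>)
  also have "\<dots> = fibre_form m y z N k"
    unfolding fibre_form_def ridge_moment_def ball_moment_shift[symmetric] a_def by (simp only: mult_ac)
  finally show ?thesis .
qed

lemma ball_moment_fibre_average:
  fixes y z :: "real ^ 'n"
  assumes "m \<ge> 1"
  shows "ball_moment m (\<lambda>x. fibre_average m (poly g) x y * poly h (x \<bullet> z)) = bilinear_form (fibre_form m y z) g h"
proof -
  have "ball_moment m (\<lambda>x. fibre_average m (poly g) x y * poly h (x \<bullet> z)) =
      ball_moment m (\<lambda>x. \<Sum>i\<le>degree g. \<Sum>j\<le>degree h. (coeff g i * coeff h j) * (fibre_average m (\<lambda>t. t ^ i) x y * (x \<bullet> z) ^ j))"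
    unfolding fibre_average_poly[OF assms] poly_altdef sum_product by (simp only: mult_ac)
  also have "\<dots> = (\<Sum>i\<le>degree g. \<Sum>j\<le>degree h. (coeff g i * coeff h j) * fibre_form m y z i j)"
    using assms
    by (simp add: ball_moment_sum ball_moment_cmult ball_moment_fibre_average_power
        continuous_intros continuous_on_fibre_average_power)
  finally show ?thesis
    by (simp add: bilinear_form_def moment_functional_def sum_distrib_left mult.assoc)
qed

lemma fibre_form_0_0:
  fixes y z :: "real ^ 'n"
  shows "m \<ge> 1 \<Longrightarrow> fibre_form m y z 0 0 = ball_moment m (\<lambda>_ :: real ^ 'n. 1)"
  by (simp add: fibre_form_def sin_moment_0 ridge_moment_def)

text \<open>On the sphere this is rotation invariance.\<close>

lemma ball_moment_fibre_average_eq: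
  fixes y :: "real ^ 'n"
  assumes m: "m \<ge> 1" and y: "norm y \<le> 1"
  shows "ball_moment m (\<lambda>x. fibre_average m (poly g) x y) * sin_integral (real CARD('n) + m - 1) (\<lambda>_. 1)
    = ball_moment m (\<lambda>_ :: real ^ 'n. 1) * sin_integral (real CARD('n) + m - 1) (poly g)"
proof -
  define q where "q = real CARD('n) + m - 1"
  have "real CARD('n) > 0" "real m \<ge> 1" using m by simp_all
  then have q: "q > 0" unfolding q_def by linarith
  \<comment> \<open>Any unit vector will do: the form is taken with second argument 1, where the
    power of x . z is 1.\<close>
  obtain z :: "real ^ 'n" where z: "norm z = 1" using norm_axis_1 by blast
  define B where "B = fibre_form m y z"
  interpret gegenbauer_form "(real CARD('n) + m - 1) / 2" "y \<bullet> z" B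
    unfolding B_def by (rule gegenbauer_form_fibre_form[OF m y z])
  \<comment> \<open>Both sequences satisfy the same recurrence of step two. For n = 0 it forces the
    value at index 1 to be 0, so the value at index 0 determines everything.\<close>
  have B: "B N 0 * sin_integral q (\<lambda>_. 1) = B 0 0 * sin_integral q (\<lambda>t. t ^ N)" for N
  proof (induction N rule: less_induct)
    case (less N)
    show ?case
    proof (cases N)
      case (Suc n)
      have 1: "(real n + q + 1) * B (Suc n) 0 = n * B (n - 1) 0"
    proof -
      have e: "2 * ((real CARD('n) + m - 1) / 2) = q" by (simp add: q_def)
      show ?thesis using left_rule[of n 0] unfolding e by simp
    qed
      have "(real n + q + 1) * (B (Suc n) 0 * sin_integral q (\<lambda>_. 1)) = n * (B (n - 1) 0 * sin_integral q (\<lambda>_. 1))"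
        unfolding mult.assoc[symmetric] 1 ..
      also have "\<dots> = B 0 0 * (n * sin_integral q (\<lambda>t. t ^ (n - 1)))"
        using less[of "n - 1"] Suc by (cases n) simp_all
      also have "\<dots> = (real n + q + 1) * (B 0 0 * sin_integral q (\<lambda>t. t ^ Suc n))"
        using sin_integral_power_rec[of q n] q by simp
      finally show ?thesis
        unfolding Suc by (subst (asm) mult_cancel_left) (use q in auto)
    qed simp
  qed
  have "ball_moment m (\<lambda>x. fibre_average m (poly g) x y) = bilinear_form B g 1"
    using ball_moment_fibre_average[OF m, of g y 1 z] by (simp add: B_def)
  also have "\<dots> = moment_functional (\<lambda>i. B i 0) g"
    by (simp add: bilinear_form_def moment_functional_def)
  finally have "ball_moment m (\<lambda>x. fibre_average m (poly g) x y) * sin_integral q (\<lambda>_. 1)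
      = (\<Sum>i\<le>degree g. coeff g i * (B i 0 * sin_integral q (\<lambda>_. 1)))"
    by (simp add: moment_functional_def sum_distrib_right mult.assoc)
  also have "\<dots> = B 0 0 * sin_integral q (poly g)"
    unfolding B using q by (simp add: sin_integral_poly moment_functional_def sum_distrib_left mult_ac)
  finally show ?thesis
    unfolding q_def B_def fibre_form_0_0[OF m] .
qed

lemma ball_moment_kernel_ridge:
  fixes y z :: "real ^ 'n"
  assumes m: "m \<ge> 1" and y: "norm y \<le> 1" and z: "norm z = 1" and h: "degree h \<le> n"
  shows "ball_moment m (\<lambda>x. fibre_average m (poly (gegenbauer_kernel ((real CARD('n) + m - 1) / 2) n)) x y * poly h (x \<bullet> z))
    = ball_moment m (\<lambda>_ :: real ^ 'n. 1) * poly h (y \<bullet> z)"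
  unfolding ball_moment_fibre_average[OF m]
  using gegenbauer_form.form_gegenbauer_kernel[OF gegenbauer_form_fibre_form[OF m y z] h]
  unfolding fibre_form_0_0[OF m] .

section \<open>The reproducing kernel\<close>

text \<open>Odd fibre moments vanish, so only even powers of the square root survive and
  \<open>i div 2\<close> loses nothing. The agreement is restricted to the ball because outside it
  the radicand is negative.\<close>

lemma fibre_average_poly_space:
  fixes y :: "real ^ 'n"
  assumes m: "m \<ge> 1" and g: "degree g \<le> n"
  obtains f where "f \<in> poly_space n" "\<And>x. norm x \<le> 1 \<Longrightarrow> f x = fibre_average m (poly g) x y"
proof
  define f where "f x = (\<Sum>N\<le>degree g. coeff g N * (\<Sum>i\<le>N. real (N choose i) *
     (sin_moment m i * sqrt (1 - (norm y)\<^sup>2) ^ i * ((x \<bullet> y) ^ (N - i) * (1 - (norm x)\<^sup>2) ^ (i div 2)))))" for x :: "real ^ 'n"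
  show "f \<in> poly_space n"
    unfolding f_def
  proof (intro poly_space_sum poly_space_cmult)
    fix N i assume "N \<in> {..degree g}" "i \<in> {..N}"
    then have "(N - i) * 1 + i div 2 * 2 \<le> n" using g by auto
    then show "(\<lambda>x. (x \<bullet> y) ^ (N - i) * (1 - (norm x)\<^sup>2) ^ (i div 2)) \<in> poly_space n"
      by (rule poly_space_mono[OF poly_space_mult[OF poly_space_power[OF poly_space_inner] poly_space_power[OF poly_space_norm_sq]]])
  qed
  fix x :: "real ^ 'n" assume x: "norm x \<le> 1"
  have "sin_moment m i * sqrt (1 - (norm y)\<^sup>2) ^ i * ((x \<bullet> y) ^ (N - i) * (1 - (norm x)\<^sup>2) ^ (i div 2)) =
      sin_moment m i * sqrt (1 - (norm y)\<^sup>2) ^ i * ((x \<bullet> y) ^ (N - i) * sqrt (1 - (norm x)\<^sup>2) ^ i)" for N i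
  proof (cases "even i")
    case True
    then obtain j where "i = 2 * j" by blast
    then show ?thesis using x by (simp add: power_mult power_le_one)
  qed (simp add: sin_moment_odd[OF m])
  then show "f x = fibre_average m (poly g) x y"
    unfolding f_def fibre_average_poly[OF m] fibre_average_power[OF m] by (simp only:)
qed

text \<open>Polarization: expanding \<open>(x \<bullet> (z + t e)) ^ (j + 1)\<close> in powers of \<open>t\<close> allows one to replace
  powers of linear forms by arbitrary monomials.\<close>

lemma ridge_polynomials_span:
  fixes K :: "real ^ 'n \<Rightarrow> real" and y :: "real ^ 'n"
  assumes m: "m \<ge> 1" and K: "continuous_on UNIV K"
    and ridge: "\<And>z j. j \<le> n \<Longrightarrow> ball_moment m (\<lambda>x. K x * (x \<bullet> z) ^ j) = c * (y \<bullet> z) ^ j"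
    and p: "p \<in> poly_space n"
  shows "ball_moment m (\<lambda>x. K x * p x) = c * p y"
proof -
  define T where "T f = ball_moment m (\<lambda>x. K x * f x) - c * f y" for f :: "real ^ 'n \<Rightarrow> real"
  have T_sum: "T (\<lambda>x. \<Sum>i\<in>A. a i * f i x) = (\<Sum>i\<in>A. a i * T (f i))"
    if "finite A" "\<And>i. i \<in> A \<Longrightarrow> continuous_on UNIV (f i)" for A :: "'b set" and a f
  proof -
    have "ball_moment m (\<lambda>x. K x * (\<Sum>i\<in>A. a i * f i x)) = (\<Sum>i\<in>A. a i * ball_moment m (\<lambda>x. K x * f i x))"
      unfolding sum_distrib_left mult.left_commute[of "K _"]
      by (subst ball_moment_sum) (use m K that in \<open>auto simp: ball_moment_cmult intro!: continuous_intros\<close>)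
    then show ?thesis
      by (simp add: T_def sum_subtractf sum_distrib_left algebra_simps)
  qed
  \<comment> \<open>Here \<open>r\<close> is the number of linear factors already moved into f; what
    remains of n is available for the power of x . z.\<close>
  define good where "good r f \<longleftrightarrow> continuous_on UNIV f \<and> (\<forall>j z. j + r \<le> n \<longrightarrow> T (\<lambda>x. (x \<bullet> z) ^ j * f x) = 0)" for r f
  have step: "good (Suc r) (\<lambda>x. (x \<bullet> e) * f x)" if gd: "good r f" for r f e
    unfolding good_def
  proof (intro conjI allI impI)
    have cf: "continuous_on UNIV f" using gd by (simp add: good_def)
    then show "continuous_on UNIV (\<lambda>x. (x \<bullet> e) * f x)" by (intro continuous_intros)
    fix j z assume j: "j + Suc r \<le> n"
    define a where "a i = real (Suc j choose i) * T (\<lambda>x. (x \<bullet> e) ^ i * (x \<bullet> z) ^ (Suc j - i) * f x)" for i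
    have "(\<Sum>i\<le>Suc j. a i * t ^ i) = 0" for t :: real
    proof -
      have "(x \<bullet> (z + t *\<^sub>R e)) ^ Suc j * f x = (\<Sum>i\<le>Suc j. (real (Suc j choose i) * t ^ i) * ((x \<bullet> e) ^ i * (x \<bullet> z) ^ (Suc j - i) * f x))" for x
        unfolding inner_add_right inner_scaleR_right add.commute[of "x \<bullet> z"] binomial_ring power_mult_distrib sum_distrib_right
        by (simp only: mult_ac)
      then have "T (\<lambda>x. (x \<bullet> (z + t *\<^sub>R e)) ^ Suc j * f x) = (\<Sum>i\<le>Suc j. (real (Suc j choose i) * t ^ i) * T (\<lambda>x. (x \<bullet> e) ^ i * (x \<bullet> z) ^ (Suc j - i) * f x))"
        by (simp only:) (rule T_sum; auto intro!: continuous_intros cf)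
      moreover have "T (\<lambda>x. (x \<bullet> (z + t *\<^sub>R e)) ^ Suc j * f x) = 0"
      proof -
        have "Suc j + r \<le> n" using j by simp
        then show ?thesis using gd unfolding good_def by blast
      qed
      ultimately show ?thesis
        unfolding a_def by (simp only: mult_ac)
    qed
    \<comment> \<open>The coefficient of t is j + 1 times the wanted value of
      \<open>T\<close>.\<close>
    then have "a 1 = 0"
      using polyfun_eq_0[of a "Suc j"] by auto
    then show "T (\<lambda>x. (x \<bullet> z) ^ j * ((x \<bullet> e) * f x)) = 0"
      by (simp add: a_def mult_ac)
  qed
  have power: "good (r + k) (\<lambda>x. (x $ i) ^ k * f x)" if "good r f" for r f k i
  proof (induction k)
    case (Suc k)
    then have "good (Suc (r + k)) (\<lambda>x. (x \<bullet> axis i 1) * ((x $ i) ^ k * f x))" by (rule step)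
    then show ?case by (simp add: inner_axis mult.assoc)
  qed (use that in simp)
  have "good 0 (\<lambda>_. 1)"
    using ridge by (simp add: good_def T_def)
  have good_monomial: "good (\<Sum>i\<in>I. a i) (\<lambda>x. \<Prod>i\<in>I. (x $ i) ^ a i)" for a and I :: "'n set"
  proof (induction I rule: infinite_finite_induct)
    case empty
    then show ?case using \<open>good 0 (\<lambda>_. 1)\<close> by simp
  next
    case (insert i I)
    then show ?case using power[of "\<Sum>i\<in>I. a i" "\<lambda>x. \<Prod>i\<in>I. (x $ i) ^ a i" "a i" i] by (simp add: add.commute)
  qed simp
  have T0: "T (\<lambda>x. \<Prod>i\<in>UNIV. (x $ i) ^ a i) = 0" if "a \<in> multi_indices n" for a
  proof -
    have "0 + (\<Sum>i\<in>UNIV. a i) \<le> n" using that by (simp add: multi_indices_def)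
    then have "T (\<lambda>x. (x \<bullet> 0) ^ 0 * (\<Prod>i\<in>UNIV. (x $ i) ^ a i)) = 0"
      using good_monomial[of a UNIV] unfolding good_def by blast
    then show ?thesis by simp
  qed
  from p obtain d where "p = (\<lambda>x. \<Sum>a\<in>multi_indices n. d a * (\<Prod>i\<in>UNIV. (x $ i) ^ a i))"
    unfolding poly_space_def by blast
  then have "T p = (\<Sum>a\<in>multi_indices n. d a * T (\<lambda>x. \<Prod>i\<in>UNIV. (x $ i) ^ a i))"
    by (simp only:) (rule T_sum; auto simp: finite_multi_indices intro!: continuous_intros)
  then have "T p = 0" by (simp add: T0)
  then show ?thesis by (simp add: T_def)
qed

lemma ball_moment_kernel:
  fixes y :: "real ^ 'n"
  assumes m: "m \<ge> 1" and y: "norm y \<le> 1" and p: "p \<in> poly_space n"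
  shows "ball_moment m (\<lambda>x. fibre_average m (poly (gegenbauer_kernel ((real CARD('n) + m - 1) / 2) n)) x y * p x)
    = ball_moment m (\<lambda>_ :: real ^ 'n. 1) * p y"
proof (rule ridge_polynomials_span[OF m continuous_on_fibre_average_poly[OF m] _ p])
  fix z :: "real ^ 'n" and j assume j: "j \<le> n"
  \<comment> \<open>Both sides are homogeneous of degree j in z, which reduces the claim to boundary
    points; for z = 0 any unit vector serves.\<close>
  obtain u :: "real ^ 'n" where u: "norm u = 1" "z = norm z *\<^sub>R u"
  proof (cases "z = 0")
    case True
    obtain u :: "real ^ 'n" where "norm u = 1" using norm_axis_1 by blast
    with True show ?thesis by (intro that[of u]) auto
  next
    case False
    then show ?thesis by (intro that[of "sgn z"]) (auto simp: norm_sgn sgn_div_norm)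
  qed
  have e: "(x \<bullet> z) ^ j = poly (monom (norm z ^ j) j) (x \<bullet> u)" for x
    by (subst u(2)) (simp add: poly_monom power_mult_distrib)
  show "ball_moment m (\<lambda>x. fibre_average m (poly (gegenbauer_kernel ((real CARD('n) + m - 1) / 2) n)) x y * (x \<bullet> z) ^ j)
      = ball_moment m (\<lambda>_ :: real ^ 'n. 1) * (y \<bullet> z) ^ j"
    unfolding e by (rule ball_moment_kernel_ridge[OF m y u(1)]) (use j degree_monom_le le_trans in blast)
qed

section \<open>Orthonormal bases and independence of the kernel\<close>

lemma orthonormal_expansion:
  fixes p :: "nat \<Rightarrow> real ^ 'n \<Rightarrow> real"
  assumes m: "m \<ge> 1" and p: "orthonormal_basis (gegenbauer_weight (real m / 2)) n N p" and f: "f \<in> poly_space n"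
  shows "f x = (\<Sum>j<N. ball_moment m (\<lambda>x. f x * p j x) * p j x)"
proof -
  from p f obtain c where c: "f = (\<lambda>x. \<Sum>j<N. c j * p j x)"
    unfolding orthonormal_basis_def by blast
  have cont: "continuous_on UNIV (p j)" if "j < N" for j
    using p that by (auto simp: orthonormal_basis_def intro: continuous_on_poly_space)
  have "ball_moment m (\<lambda>x. f x * p k x) = c k" if k: "k < N" for k
  proof -
    have "ball_moment m (\<lambda>x. f x * p k x) = (\<Sum>j<N. c j * ball_moment m (\<lambda>x. p j x * p k x))"
      unfolding c sum_distrib_right mult.assoc
      by (subst ball_moment_sum) (use m cont k in \<open>auto simp: ball_moment_cmult intro!: continuous_intros\<close>)
    also have "\<dots> = (\<Sum>j<N. if j = k then c j else 0)"
      using p k by (intro sum.cong) (auto simp: orthonormal_basis_def ball_moment_def)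
    finally show ?thesis using k by simp
  qed
  then show ?thesis by (subst c) simp
qed

lemma ball_moment_diff_expand:
  fixes f g :: "real ^ 'n \<Rightarrow> real" and p :: "nat \<Rightarrow> real ^ 'n \<Rightarrow> real"
  assumes "m \<ge> 1" "continuous_on UNIV f" "\<And>j. j < N \<Longrightarrow> continuous_on UNIV (p j)" "continuous_on UNIV g"
  shows "ball_moment m (\<lambda>x. (f x - (\<Sum>j<N. c j * p j x)) * g x) =
    ball_moment m (\<lambda>x. f x * g x) - (\<Sum>j<N. c j * ball_moment m (\<lambda>x. p j x * g x))"
proof -
  have "ball_moment m (\<lambda>x. (f x - (\<Sum>j<N. c j * p j x)) * g x) =
      ball_moment m (\<lambda>x. f x * g x + (\<Sum>j<N. (- c j) * (p j x * g x)))"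
    by (simp add: left_diff_distrib sum_distrib_right sum_negf mult.assoc)
  also have "\<dots> = ball_moment m (\<lambda>x. f x * g x) + ball_moment m (\<lambda>x. \<Sum>j<N. (- c j) * (p j x * g x))"
    by (rule ball_moment_add) (use assms in \<open>auto intro!: continuous_intros\<close>)
  also have "ball_moment m (\<lambda>x. \<Sum>j<N. (- c j) * (p j x * g x)) = (\<Sum>j<N. (- c j) * ball_moment m (\<lambda>x. p j x * g x))"
    unfolding ball_moment_cmult[symmetric]
    by (rule ball_moment_sum) (use assms in \<open>auto intro!: continuous_intros\<close>)
  finally show ?thesis by (simp add: sum_negf)
qed

text \<open>The number N is not prescribed, so linear dependence in S is harmless: a residual
  \<open>r\<close> of norm 0 vanishes on the ball by positivity, hence everywhere as a polynomial,
  and adds no new function.\<close>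

lemma gram_schmidt:
  fixes S :: "(real ^ 'n \<Rightarrow> real) set"
  assumes m: "m \<ge> 1" and "finite S" "S \<subseteq> poly_space n"
  shows "\<exists>(N :: nat) p. (\<forall>j<N. p j \<in> poly_space n) \<and> (\<forall>f\<in>S. \<exists>c. f = (\<lambda>x. \<Sum>j<N. c j * p j x)) \<and>
    (\<forall>i<N. \<forall>j<N. ball_moment m (\<lambda>x. p i x * p j x) = (if i = j then 1 else 0))"
  using assms(2,3)
proof (induction S rule: finite_induct)
  case empty
  show ?case by (rule exI[where x=0]) simp
next
  case (insert f S)
  have "S \<subseteq> poly_space n" using insert.prems by simp
  from insert.IH[OF this] obtain N :: nat and p where
    *: "\<forall>j<N. p j \<in> poly_space n" "\<forall>f\<in>S. \<exists>c. f = (\<lambda>x. \<Sum>j<N. c j * p j x)"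
      "\<forall>i<N. \<forall>j<N. ball_moment m (\<lambda>x. p i x * p j x) = (if i = j then 1 else 0)"
    by (elim exE conjE)
  have p: "p j \<in> poly_space n" if "j < N" for j using * that by blast
  have span: "\<exists>c. f = (\<lambda>x. \<Sum>j<N. c j * p j x)" if "f \<in> S" for f using *(2) that by blast
  have orth: "ball_moment m (\<lambda>x. p i x * p j x) = (if i = j then 1 else 0)" if "i < N" "j < N" for i j
    using *(3) that by blast
  have f: "f \<in> poly_space n" using insert by simp
  note cont = continuous_on_poly_space[OF f] continuous_on_poly_space[OF p]
  define a where "a j = ball_moment m (\<lambda>x. f x * p j x)" for j
  define r where "r x = f x - (\<Sum>j<N. a j * p j x)" for x
  have r: "r \<in> poly_space n"
    unfolding r_def by (intro poly_space_diff f poly_space_sum poly_space_cmult p) auto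
  define s where "s = ball_moment m (\<lambda>x. r x * r x)"
  have s0: "s \<ge> 0" unfolding s_def by (rule ball_moment_nonneg) simp
  have rp: "ball_moment m (\<lambda>x. r x * p i x) = 0" if "i < N" for i
  proof -
    have "ball_moment m (\<lambda>x. r x * p i x) = a i - (\<Sum>j<N. a j * ball_moment m (\<lambda>x. p j x * p i x))"
      unfolding r_def a_def using that by (intro ball_moment_diff_expand m cont) auto
    also have "(\<Sum>j<N. a j * ball_moment m (\<lambda>x. p j x * p i x)) = (\<Sum>j<N. if j = i then a j else 0)"
      using that by (intro sum.cong) (auto simp: orth)
    finally show ?thesis using that by simp
  qed
  show ?case
  proof (cases "s = 0")
    case True
    have r0: "r x * r x = 0" if "norm x \<le> 1" for x
      by (rule ball_moment_eq_0[where f="\<lambda>x. r x * r x", OF m])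
         (use True that in \<open>auto simp: s_def intro!: continuous_intros continuous_on_poly_space[OF r]\<close>)
    have "r x = 0" for x
      by (rule poly_space_eq_0[OF r]) (use r0 in simp)
    then have "f = (\<lambda>x. \<Sum>j<N. a j * p j x)" by (simp add: r_def fun_eq_iff)
    then have f_span: "\<exists>c. f = (\<lambda>x. \<Sum>j<N. c j * p j x)" by (rule exI[where x=a])
    have "\<forall>g\<in>insert f S. \<exists>c. g = (\<lambda>x. \<Sum>j<N. c j * p j x)"
    proof
      fix g assume "g \<in> insert f S"
      then show "\<exists>c. g = (\<lambda>x. \<Sum>j<N. c j * p j x)"
        by (rule insertE) (simp only: f_span, rule span)
    qed
    with *(1,3) show ?thesis by (intro exI[of _ N] exI[of _ p] conjI)
  next
    case False
    then have s: "s > 0" using s0 by simp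
    define P where "P j = (if j < N then p j else (\<lambda>x. (1 / sqrt s) * r x))" for j
    have lt: "(\<Sum>j<Suc N. c j * P j x) = (\<Sum>j<N. c j * p j x) + c N * ((1 / sqrt s) * r x)" for c x
      by (simp add: P_def)
    have "P j \<in> poly_space n" if "j < Suc N" for j
      using p r poly_space_cmult[OF r, of "1 / sqrt s"] by (simp add: P_def)
    moreover have "\<exists>c. g = (\<lambda>x. \<Sum>j<Suc N. c j * P j x)" if g: "g \<in> insert f S" for g
    proof (cases "g = f")
      case True
      have "(\<Sum>j<N. (if j < N then a j else sqrt s) * p j x) = (\<Sum>j<N. a j * p j x)" for x by simp
      then have "f = (\<lambda>x. \<Sum>j<Suc N. (if j < N then a j else sqrt s) * P j x)"
        unfolding lt using s by (simp add: r_def fun_eq_iff)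
      then show ?thesis unfolding True by (rule exI[where x="\<lambda>j. if j < N then a j else sqrt s"])
    next
      case False
      then obtain c where c: "g = (\<lambda>x. \<Sum>j<N. c j * p j x)" using span g by blast
      have "(\<Sum>j<N. (if j < N then c j else 0) * p j x) = (\<Sum>j<N. c j * p j x)" for x by simp
      then have "g = (\<lambda>x. \<Sum>j<Suc N. (if j < N then c j else 0) * P j x)"
        unfolding lt using c by simp
      then show ?thesis by (rule exI[where x="\<lambda>j. if j < N then c j else 0"])
    qed
    moreover have "ball_moment m (\<lambda>x. P i x * P j x) = (if i = j then 1 else 0)" if ij: "i < Suc N" "j < Suc N" for i j
    proof -
      have 1: "ball_moment m (\<lambda>x. ((1 / sqrt s) * r x) * p k x) = 0" if "k < N" for k
        unfolding mult.assoc ball_moment_cmult rp[OF that] by simp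
      then have 2: "ball_moment m (\<lambda>x. p k x * ((1 / sqrt s) * r x)) = 0" if "k < N" for k
        using that by (subst mult.commute) blast
      have "(\<lambda>x. ((1 / sqrt s) * r x) * ((1 / sqrt s) * r x)) = (\<lambda>x. (1 / s) * (r x * r x))"
        using s by (auto simp: fun_eq_iff)
      then have 3: "ball_moment m (\<lambda>x. ((1 / sqrt s) * r x) * ((1 / sqrt s) * r x)) = 1"
        using s by (simp only: ball_moment_cmult s_def[symmetric]) simp
      consider "i < N" "j < N" | "i = N" "j < N" | "i < N" "j = N" | "i = N" "j = N"
        using ij by linarith
      then show ?thesis
        by cases (simp_all only: P_def if_True if_False less_irrefl orth 1 2 3 simp_thms less_irrefl_nat, auto)
    qed
    ultimately show ?thesis
      by (intro exI[of _ "Suc N"] exI[of _ P] conjI ballI allI impI)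
  qed
qed

lemma orthonormal_basis_exists:
  assumes m: "m \<ge> 1"
  shows "\<exists>N p. orthonormal_basis (gegenbauer_weight (real m / 2) :: real ^ 'n \<Rightarrow> real) n N p"
proof -
  define S :: "(real ^ 'n \<Rightarrow> real) set" where "S = (\<lambda>a x. \<Prod>i\<in>UNIV. (x $ i) ^ a i) ` multi_indices n"
  have "finite S" "S \<subseteq> poly_space n"
    by (auto simp: S_def finite_multi_indices poly_space_monomial)
  from gram_schmidt[OF m this] obtain N :: nat and p where p: "\<forall>j<N. p j \<in> poly_space n"
    and span: "\<forall>f\<in>S. \<exists>c. f = (\<lambda>x. \<Sum>j<N. c j * p j x)"
    and orth: "\<forall>i<N. \<forall>j<N. ball_moment m (\<lambda>x. p i x * p j x) = (if i = j then 1 else 0)"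
    by (elim exE conjE)
  have "\<exists>c. f = (\<lambda>x. \<Sum>j<N. c j * p j x)" if f: "f \<in> poly_space n" for f
  proof -
    from f obtain d where d: "f = (\<lambda>x. \<Sum>a\<in>multi_indices n. d a * (\<Prod>i\<in>UNIV. (x $ i) ^ a i))"
      unfolding poly_space_def by blast
    have "\<forall>a\<in>multi_indices n. \<exists>c. (\<lambda>x :: real ^ 'n. \<Prod>i\<in>UNIV. (x $ i) ^ a i) = (\<lambda>x. \<Sum>j<N. c j * p j x)"
      using span unfolding S_def ball_simps(9) .
    from bchoice[OF this] obtain C where
      C: "\<forall>a\<in>multi_indices n. (\<lambda>x :: real ^ 'n. \<Prod>i\<in>UNIV. (x $ i) ^ a i) = (\<lambda>x. \<Sum>j<N. C a j * p j x)" ..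
    have "f = (\<lambda>x. \<Sum>a\<in>multi_indices n. d a * (\<Sum>j<N. C a j * p j x))"
      unfolding d by (intro ext sum.cong refl arg_cong2[of _ _ _ _ "(*)"] fun_cong[OF C[rule_format]])
    also have "\<dots> = (\<lambda>x. \<Sum>j<N. (\<Sum>a\<in>multi_indices n. d a * C a j) * p j x)"
      unfolding sum_distrib_left sum_distrib_right by (subst sum.swap) (simp add: mult.assoc)
    finally show ?thesis by (intro exI)
  qed
  with p orth show ?thesis
    unfolding orthonormal_basis_def ball_moment_def by blast
qed

text \<open>Each basis is expanded in the other. By symmetry of the inner product the same numbers
  \<open>c i j\<close> occur in both expansions, so interchanging the sums turns one kernel into the
  other without comparing N and N'.\<close>

lemma reproducing_kernel_eq_basis:
  fixes p :: "nat \<Rightarrow> real ^ 'n \<Rightarrow> real"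
  assumes m: "m \<ge> 1" and p: "orthonormal_basis (gegenbauer_weight (real m / 2)) n N p"
  shows "reproducing_kernel (gegenbauer_weight (real m / 2)) n = (\<lambda>x y. \<Sum>j<N. p j x * p j y)"
  unfolding reproducing_kernel_def
proof (rule the_equality)
  show "\<exists>N' p'. orthonormal_basis (gegenbauer_weight (real m / 2)) n N' p' \<and>
      (\<lambda>x y. \<Sum>j<N. p j x * p j y) = (\<lambda>x y. \<Sum>j<N'. p' j x * p' j y)"
    using p by blast
  fix K :: "real ^ 'n \<Rightarrow> real ^ 'n \<Rightarrow> real"
  assume "\<exists>N' p'. orthonormal_basis (gegenbauer_weight (real m / 2)) n N' p' \<and> K = (\<lambda>x y. \<Sum>j<N'. p' j x * p' j y)"
  then obtain N' p' where p': "orthonormal_basis (gegenbauer_weight (real m / 2)) n N' p'"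
    and K: "K = (\<lambda>x y. \<Sum>j<N'. p' j x * p' j y)" by blast
  define c where "c i j = ball_moment m (\<lambda>x. p' i x * p j x)" for i j
  have 1: "p' i x = (\<Sum>j<N. c i j * p j x)" if "i < N'" for i x
    unfolding c_def using p' that by (intro orthonormal_expansion[OF m p]) (auto simp: orthonormal_basis_def)
  have 2: "p j x = (\<Sum>i<N'. c i j * p' i x)" if "j < N" for j x
    unfolding c_def mult.commute[of "p' _ _"]
    using p that by (intro orthonormal_expansion[OF m p']) (auto simp: orthonormal_basis_def)
  have "K x y = (\<Sum>j<N. p j x * p j y)" for x y
  proof -
    have "K x y = (\<Sum>i<N'. \<Sum>j<N. (c i j * p j x) * p' i y)"
      unfolding K by (simp add: 1[of _ x] sum_distrib_right)
    also have "\<dots> = (\<Sum>j<N. p j x * (\<Sum>i<N'. c i j * p' i y))"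
      by (subst sum.swap) (simp add: sum_distrib_left mult_ac)
    also have "\<dots> = (\<Sum>j<N. p j x * p j y)"
      by (simp add: 2[of _ y])
    finally show ?thesis .
  qed
  then show "K = (\<lambda>x y. \<Sum>j<N. p j x * p j y)" by blast
qed

lemma ball_moment_1_pos:
  assumes "m \<ge> 1"
  shows "ball_moment m (\<lambda>_ :: real ^ 'n. 1) > 0"
  using ball_moment_nonneg[of "\<lambda>_ :: real ^ 'n. 1" m] ball_moment_eq_0[OF assms, of "\<lambda>_ :: real ^ 'n. 1" 0]
  by (auto simp: order_less_le)

text \<open>For fixed y the fibre average of the zonal kernel agrees on the ball with a polynomial;
  \<open>ball_moment_kernel\<close> computes its coefficients in an orthonormal basis as the total
  mass times p_j (y).\<close>

lemma reproducing_kernel_ball: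
  fixes x y :: "real ^ 'n"
  assumes m: "m \<ge> 1" and x: "norm x \<le> 1" and y: "norm y \<le> 1"
  shows "reproducing_kernel (gegenbauer_weight (real m / 2)) n x y =
    fibre_average m (poly (gegenbauer_kernel ((real CARD('n) + m - 1) / 2) n)) x y / ball_moment m (\<lambda>_ :: real ^ 'n. 1)"
proof -
  define g where "g = gegenbauer_kernel ((real CARD('n) + m - 1) / 2) n"
  obtain N p where p: "orthonormal_basis (gegenbauer_weight (real m / 2) :: real ^ 'n \<Rightarrow> real) n N p"
    using orthonormal_basis_exists[OF m] by blast
  have "degree g \<le> n"
    unfolding g_def gegenbauer_kernel_def
    by (rule degree_sum_le) (auto intro: order_trans[OF degree_smult_le] order_trans[OF degree_gegenbauer_le])
  then obtain f where f: "f \<in> poly_space n" "\<And>x. norm x \<le> 1 \<Longrightarrow> f x = fibre_average m (poly g) x y"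
    using fibre_average_poly_space[OF m] by metis
  have "ball_moment m (\<lambda>x. f x * p j x) = ball_moment m (\<lambda>_ :: real ^ 'n. 1) * p j y" if "j < N" for j
  proof -
    have "ball_moment m (\<lambda>x. f x * p j x) = ball_moment m (\<lambda>x. fibre_average m (poly g) x y * p j x)"
      by (rule ball_moment_cong) (simp add: f)
    also have "\<dots> = ball_moment m (\<lambda>_ :: real ^ 'n. 1) * p j y"
      unfolding g_def using p that by (intro ball_moment_kernel m y) (auto simp: orthonormal_basis_def)
    finally show ?thesis .
  qed
  then have "f x = ball_moment m (\<lambda>_ :: real ^ 'n. 1) * (\<Sum>j<N. p j x * p j y)"
    using orthonormal_expansion[OF m p f(1), of x] by (simp add: sum_distrib_left mult_ac)
  then show ?thesis
    unfolding reproducing_kernel_eq_basis[OF m p] g_def[symmetric] f(2)[OF x, symmetric]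
    using ball_moment_1_pos[OF m, where 'n='n] by simp
qed

section \<open>The Lebesgue constant\<close>

lemma fibre_average_affine_continuous:
  "continuous_on UNIV g \<Longrightarrow> continuous_on UNIV (\<lambda>s :: real. g (a + b * s) :: real)"
  by (rule continuous_on_compose2[where t=UNIV]) (auto intro!: continuous_intros)

lemma fibre_average_abs_le:
  assumes "m \<ge> 1" "continuous_on UNIV g" "continuous_on UNIV h" "\<And>t. \<bar>g t\<bar> \<le> h t"
  shows "\<bar>fibre_average m g x y\<bar> \<le> fibre_average m h x y"
proof -
  let ?a = "\<lambda>s. x \<bullet> y + sqrt (1 - (norm x)\<^sup>2) * sqrt (1 - (norm y)\<^sup>2) * s"
  have q: "real m - 1 \<ge> 0" using assms(1) by simp
  have "\<bar>sin_integral (real m - 1) (\<lambda>s. g (?a s))\<bar> \<le> sin_integral (real m - 1) (\<lambda>s. \<bar>g (?a s)\<bar>)"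
    by (intro sin_integral_abs q fibre_average_affine_continuous assms)
  also have "\<dots> \<le> sin_integral (real m - 1) (\<lambda>s. h (?a s))"
    by (intro sin_integral_mono q continuous_on_rabs fibre_average_affine_continuous assms)
  finally show ?thesis
    using sin_integral_1_pos[OF q] by (simp add: fibre_average_def abs_divide divide_right_mono)
qed

lemma fibre_average_boundary:
  assumes "m \<ge> 1" "norm y = 1"
  shows "fibre_average m g x y = g (x \<bullet> y)"
  using sin_integral_1_pos[of "real m - 1"] sin_integral_cmult[of "real m - 1" "g (x \<bullet> y)" "\<lambda>_. 1"] assms
  by (simp add: fibre_average_def)

lemma ball_norm_le: "(\<And>x. norm x \<le> 1 \<Longrightarrow> \<bar>f x\<bar> \<le> C) \<Longrightarrow> ball_norm f \<le> C"
  for f :: "real ^ 'n \<Rightarrow> real"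
  unfolding ball_norm_def by (rule cSUP_least) auto

lemma abs_le_ball_norm:
  fixes f :: "real ^ 'n \<Rightarrow> real"
  assumes "bdd_above ((\<lambda>x. \<bar>f x\<bar>) ` unit_ball)" "norm x \<le> 1"
  shows "\<bar>f x\<bar> \<le> ball_norm f"
  unfolding ball_norm_def using assms by (intro cSUP_upper) auto

text \<open>The bound C also enters the second claim: it makes the sets bounded above, without which
  the real-valued suprema could not be compared with their members.\<close>

lemma lebesgue_constant_hyperinterpolation:
  fixes x :: "'i \<Rightarrow> real ^ 'n"
  defines "K \<equiv> reproducing_kernel"
  assumes A: "finite A" "\<And>\<alpha>. \<alpha> \<in> A \<Longrightarrow> l \<alpha> > 0" "\<And>\<alpha>. \<alpha> \<in> A \<Longrightarrow> norm (x \<alpha>) \<le> 1"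
    and C: "\<And>y. norm y \<le> 1 \<Longrightarrow> (\<Sum>\<alpha>\<in>A. l \<alpha> * \<bar>K w n (x \<alpha>) y\<bar>) \<le> C"
  shows "lebesgue_constant (hyperinterpolation w n A l x) \<le> C"
    and "norm y \<le> 1 \<Longrightarrow> (\<Sum>\<alpha>\<in>A. l \<alpha> * \<bar>K w n (x \<alpha>) y\<bar>) \<le> lebesgue_constant (hyperinterpolation w n A l x)"
proof -
  let ?L = "hyperinterpolation w n A l x"
  let ?F = "{f :: real ^ 'n \<Rightarrow> real. continuous_on unit_ball f \<and> ball_norm f \<le> 1}"
  have L: "\<bar>?L f y\<bar> \<le> C" if f: "f \<in> ?F" and y: "norm y \<le> 1" for f y
  proof -
    have "compact ((\<lambda>x. \<bar>f x\<bar>) ` unit_ball)"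
      using f by (intro compact_continuous_image continuous_intros) auto
    then have "bdd_above ((\<lambda>x. \<bar>f x\<bar>) ` unit_ball)"
      by (intro bounded_imp_bdd_above compact_imp_bounded)
    then have f1: "\<bar>f x\<bar> \<le> 1" if "norm x \<le> 1" for x
      using abs_le_ball_norm[of f x] f that by auto
    have "\<bar>?L f y\<bar> \<le> (\<Sum>\<alpha>\<in>A. \<bar>l \<alpha> * K w n (x \<alpha>) y * f (x \<alpha>)\<bar>)"
      unfolding hyperinterpolation_def K_def by (rule sum_abs)
    also have "\<dots> \<le> (\<Sum>\<alpha>\<in>A. l \<alpha> * \<bar>K w n (x \<alpha>) y\<bar>)"
    proof (rule sum_mono)
      fix \<alpha> assume \<alpha>: "\<alpha> \<in> A"
      have "l \<alpha> * \<bar>K w n (x \<alpha>) y\<bar> * \<bar>f (x \<alpha>)\<bar> \<le> l \<alpha> * \<bar>K w n (x \<alpha>) y\<bar> * 1"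
        using A(2)[OF \<alpha>] f1[OF A(3)[OF \<alpha>]] by (intro mult_left_mono) auto
      then show "\<bar>l \<alpha> * K w n (x \<alpha>) y * f (x \<alpha>)\<bar> \<le> l \<alpha> * \<bar>K w n (x \<alpha>) y\<bar>"
        using A(2)[OF \<alpha>] by (simp add: abs_mult)
    qed
    also have "\<dots> \<le> C" by (rule C[OF y])
    finally show ?thesis .
  qed
  have norm_L: "ball_norm (?L f) \<le> C" if "f \<in> ?F" for f
    by (rule ball_norm_le) (rule L[OF that])
  have "(\<lambda>_. 0) \<in> ?F"
    by (auto intro!: ball_norm_le)
  then have ne: "?F \<noteq> {}" by blast
  show "lebesgue_constant ?L \<le> C"
    unfolding lebesgue_constant_def by (rule cSUP_least[OF ne norm_L])
  assume y: "norm y \<le> 1"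
  \<comment> \<open>The extremal function takes the sign of the kernel at the nodes and is extended
    by Tietze's theorem without leaving [-1, 1]. Signs are prescribed by point rather than by index,
    so coinciding nodes cannot conflict.\<close>
  have "continuous_on (x ` A) (\<lambda>z. sgn (K w n z y))"
    by (rule continuous_on_finite) (use A in simp)
  moreover have "closedin (top_of_set UNIV) (x ` A)"
    using A by (simp add: finite_imp_closed)
  ultimately obtain f where f: "continuous_on UNIV f" "\<And>z. z \<in> x ` A \<Longrightarrow> f z = sgn (K w n z y)" "\<And>z. z \<in> UNIV \<Longrightarrow> norm (f z) \<le> 1"
    by (rule Tietze[of "x ` A" "\<lambda>z. sgn (K w n z y)" UNIV 1]) (auto simp: sgn_if)
  have fF: "f \<in> ?F"
    using f by (auto intro!: ball_norm_le intro: continuous_on_subset)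
  have "(\<Sum>\<alpha>\<in>A. l \<alpha> * \<bar>K w n (x \<alpha>) y\<bar>) = ?L f y"
    unfolding hyperinterpolation_def K_def[symmetric]
    by (intro sum.cong refl) (simp add: f(2) mult.assoc abs_sgn)
  also have "\<dots> \<le> \<bar>?L f y\<bar>" by simp
  also have "\<dots> \<le> ball_norm (?L f)"
    by (rule abs_le_ball_norm[OF _ y]) (use L[OF fF] in \<open>auto intro!: bdd_aboveI2[where M=C]\<close>)
  also have "\<dots> \<le> lebesgue_constant ?L"
    unfolding lebesgue_constant_def
    by (rule cSUP_upper[OF fF]) (rule bdd_aboveI2[where M=C], rule norm_L)
  finally show "(\<Sum>\<alpha>\<in>A. l \<alpha> * \<bar>K w n (x \<alpha>) y\<bar>) \<le> lebesgue_constant ?L" .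
qed

text \<open>The majorant of the zonal polynomial passes to fibre averages because averaging is
  monotone. The bound is uniform in y since by \<open>ball_moment_fibre_average_eq\<close> the
  integral of such an average does not depend on y.\<close>

lemma kernel_sum_upper_bound:
  fixes m :: nat
  assumes m: "m \<ge> 1"
  obtains c where "c > 0"
    "\<And>n (A :: 'i set) l (x :: 'i \<Rightarrow> real ^ 'n) y. n \<ge> 1 \<Longrightarrow>
      cubature_formula (gegenbauer_weight (real m / 2)) (2 * n) A l x \<Longrightarrow> norm y \<le> 1 \<Longrightarrow>
      (\<Sum>\<alpha>\<in>A. l \<alpha> * \<bar>reproducing_kernel (gegenbauer_weight (real m / 2)) n (x \<alpha>) y\<bar>)
        \<le> c * real n powr ((real CARD('n) + m - 1) / 2)"
proof -
  define D where "D = CARD('n) + m"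
  define s where "s = (real CARD('n) + m - 1) / 2"
  have "CARD('n) > 0" by simp
  then have D: "D \<ge> 2" using m unfolding D_def by linarith
  have sD: "s = (real D - 1) / 2" by (simp add: s_def D_def)
  have s0: "s > 0" using D by (simp add: sD)
  obtain c0 where c0: "c0 > 0"
    "\<And>n. sin_integral (real D - 1) (\<lambda>t. \<Sum>k\<le>n. (poly (gegenbauer ((D + 1) / 4) k) t)\<^sup>2) \<le> c0 * (real n + 1) powr ((D - 1) / 2)"
    by (rule sum_gegenbauer_squares_bound[OF D]) (rule that)
  define j where "j = sin_integral (real D - 1) (\<lambda>_. 1)"
  have j: "j > 0" using D by (simp add: j_def sin_integral_1_pos)
  \<comment> \<open>The 2 counts the two Gegenbauer polynomials in the kernel, \<open>j\<close>
    normalises the sine weight, and 2^s comes from n + 1 <= 2 n.\<close>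
  define c where "c = 2 / j * c0 * 2 powr s"
  have "c > 0" using j c0(1) by (simp add: c_def)
  moreover have "(\<Sum>\<alpha>\<in>A. l \<alpha> * \<bar>reproducing_kernel (gegenbauer_weight (real m / 2)) n (x \<alpha>) y\<bar>) \<le> c * real n powr s"
    if n: "n \<ge> 1" and cub: "cubature_formula (gegenbauer_weight (real m / 2)) (2 * n) A l x" and y: "norm y \<le> 1"
    for n l y and A :: "'i set" and x :: "'i \<Rightarrow> real ^ 'n"
  proof -
    define M where "M = ball_moment m (\<lambda>_ :: real ^ 'n. 1)"
    have M: "M > 0" unfolding M_def by (rule ball_moment_1_pos[OF m])
    define G where "G = smult 2 (\<Sum>k\<le>n. (gegenbauer ((D + 1) / 4) k) ^ 2)"
    have polyG: "poly G t = 2 * (\<Sum>k\<le>n. (poly (gegenbauer ((D + 1) / 4) k) t)\<^sup>2)" for t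
      by (simp add: G_def poly_sum)
    have "degree (gegenbauer ((D + 1) / 4) k ^ 2) \<le> 2 * n" if "k \<le> n" for k
      using degree_power_le[of "gegenbauer ((D + 1) / 4) k" 2] degree_gegenbauer_le[of "(D + 1) / 4" k] that by linarith
    then have degG: "degree G \<le> 2 * n"
      unfolding G_def by (intro order_trans[OF degree_smult_le] degree_sum_le) auto
    obtain f where f: "f \<in> poly_space (2 * n)" "\<And>x. norm x \<le> 1 \<Longrightarrow> f x = fibre_average m (poly G) x y"
      by (rule fibre_average_poly_space[OF m degG]) (rule that)
    have kernel_le: "\<bar>poly (gegenbauer_kernel s n) t\<bar> \<le> poly G t" for t
    proof -
      obtain k where k: "n = Suc k" using n by (cases n) auto
      have e: "(s + 1) / 2 = (D + 1) / 4" by (simp add: sD field_simps)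
      have "\<bar>poly (gegenbauer (s + 1) i) t\<bar> \<le> (\<Sum>k\<le>n. (poly (gegenbauer ((D + 1) / 4) k) t)\<^sup>2)" if "i \<le> n" for i
        using abs_gegenbauer_le_sum_squares[OF that, of "s + 1" t] unfolding e .
      from this[of n] this[of k] show ?thesis
        unfolding polyG unfolding k poly_gegenbauer_kernel[OF s0] by simp
    qed
    have "(\<Sum>\<alpha>\<in>A. l \<alpha> * \<bar>reproducing_kernel (gegenbauer_weight (real m / 2)) n (x \<alpha>) y\<bar>) \<le> (\<Sum>\<alpha>\<in>A. l \<alpha> * (f (x \<alpha>) / M))"
    proof (intro sum_mono mult_left_mono)
      fix \<alpha> assume "\<alpha> \<in> A"
      then have x: "norm (x \<alpha>) \<le> 1" and l: "l \<alpha> > 0"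
        using cub by (auto simp: cubature_formula_def)
      show "l \<alpha> \<ge> 0" using l by simp
      have "\<bar>fibre_average m (poly (gegenbauer_kernel s n)) (x \<alpha>) y\<bar> \<le> fibre_average m (poly G) (x \<alpha>) y"
        by (intro fibre_average_abs_le m kernel_le continuous_intros)
      then show "\<bar>reproducing_kernel (gegenbauer_weight (real m / 2)) n (x \<alpha>) y\<bar> \<le> f (x \<alpha>) / M"
        unfolding reproducing_kernel_ball[OF m x y] s_def[symmetric] M_def[symmetric] f(2)[OF x]
        using M by (simp add: abs_divide divide_right_mono)
    qed
    also have "\<dots> = (\<Sum>\<alpha>\<in>A. l \<alpha> * f (x \<alpha>)) / M"
      by (simp add: sum_divide_distrib)
    also have "(\<Sum>\<alpha>\<in>A. l \<alpha> * f (x \<alpha>)) = ball_moment m f"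
      using cub f(1) by (simp add: cubature_formula_def ball_moment_def)
    also have "\<dots> = ball_moment m (\<lambda>x. fibre_average m (poly G) x y)"
      by (rule ball_moment_cong) (rule f(2))
    also have "\<dots> = M * sin_integral (real D - 1) (poly G) / j"
      using ball_moment_fibre_average_eq[OF m y, of G] j by (simp add: M_def j_def D_def field_simps)
    also have "\<dots> / M = sin_integral (real D - 1) (poly G) / j"
      using M by simp
    also have "sin_integral (real D - 1) (poly G) = 2 * sin_integral (real D - 1) (\<lambda>t. \<Sum>k\<le>n. (poly (gegenbauer ((D + 1) / 4) k) t)\<^sup>2)"
    proof -
      have "poly G = (\<lambda>t. 2 * (\<Sum>k\<le>n. (poly (gegenbauer ((D + 1) / 4) k) t)\<^sup>2))"
        by (rule ext) (rule polyG)
      then show ?thesis by (simp only: sin_integral_cmult)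
    qed
    also have "\<dots> \<le> 2 * (c0 * (2 * real n) powr s)"
    proof (rule mult_left_mono)
      have "(real n + 1) powr s \<le> (2 * real n) powr s"
        using n s0 by (intro powr_mono2) auto
      then have "c0 * (real n + 1) powr s \<le> c0 * (2 * real n) powr s"
        using c0(1) by (intro mult_left_mono) auto
      moreover have "real (D - 1) / 2 = s" using D by (simp add: sD of_nat_diff)
      ultimately show "sin_integral (real D - 1) (\<lambda>t. \<Sum>k\<le>n. (poly (gegenbauer ((D + 1) / 4) k) t)\<^sup>2) \<le> c0 * (2 * real n) powr s"
        using c0(2)[of n] by simp
    qed simp
    finally show ?thesis
      using j by (simp add: c_def powr_mult divide_right_mono field_simps)
  qed
  ultimately show thesis
    by (rule that[unfolded s_def[symmetric]])
qed

text \<open>The kernel is evaluated at two antipodal boundary points \<open>\<plusminus> e\<close>, since for a single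
  one all other nodes could be zeros of the kernel (Gauss--Radau nodes for \<open>CARD('n) = 1\<close>).\<close>

lemma kernel_sum_lower_bound:
  fixes m :: nat
  assumes m: "m \<ge> 1"
  obtains b where "b > 0"
    "\<And>n (A :: 'i set) l (x :: 'i \<Rightarrow> real ^ 'n). n \<ge> 1 \<Longrightarrow>
      cubature_formula (gegenbauer_weight (real m / 2)) (2 * n) A l x \<Longrightarrow>
      \<exists>y. norm y \<le> 1 \<and> b * real n powr ((real CARD('n) + m - 1) / 2)
        \<le> (\<Sum>\<alpha>\<in>A. l \<alpha> * \<bar>reproducing_kernel (gegenbauer_weight (real m / 2)) n (x \<alpha>) y\<bar>)"
proof -
  define s where "s = (real CARD('n) + m - 1) / 2"
  have "real CARD('n) > 0" "real m \<ge> 1" using m by simp_all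
  then have "real CARD('n) + m - 1 > 0" by linarith
  then have s0: "s > 0" unfolding s_def by (rule half_gt_zero)
  obtain b where b: "b > 0" "\<And>n t. \<bar>t\<bar> \<le> 1 \<Longrightarrow> b * (real n + 1) powr s
       \<le> \<bar>poly (gegenbauer_kernel s (Suc n)) t\<bar> + \<bar>poly (gegenbauer_kernel s (Suc n)) (- t)\<bar>"
    by (rule gegenbauer_kernel_lower_bound[OF s0]) (rule that)
  have "b / 2 > 0" using b(1) by simp
  moreover have "\<exists>y. norm y \<le> 1 \<and> b / 2 * real n powr s \<le> (\<Sum>\<alpha>\<in>A. l \<alpha> * \<bar>reproducing_kernel (gegenbauer_weight (real m / 2)) n (x \<alpha>) y\<bar>)"
    if n: "n \<ge> 1" and cub: "cubature_formula (gegenbauer_weight (real m / 2)) (2 * n) A l x"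
    for n l and A :: "'i set" and x :: "'i \<Rightarrow> real ^ 'n"
  proof -
    define M where "M = ball_moment m (\<lambda>_ :: real ^ 'n. 1)"
    have M: "M > 0" unfolding M_def by (rule ball_moment_1_pos[OF m])
    define S where "S y = (\<Sum>\<alpha>\<in>A. l \<alpha> * \<bar>reproducing_kernel (gegenbauer_weight (real m / 2)) n (x \<alpha>) y\<bar>)" for y
    obtain k where k: "n = Suc k" using n by (cases n) auto
    obtain e :: "real ^ 'n" where e: "norm e = 1" using norm_axis_1 by blast
    have "\<forall>f\<in>poly_space (2 * n). (\<Sum>\<alpha>\<in>A. l \<alpha> * f (x \<alpha>)) = ball_moment m f"
      using cub unfolding cubature_formula_def ball_moment_def by blast
    from bspec[OF this poly_space_const[of 1]] have "(\<Sum>\<alpha>\<in>A. l \<alpha>) = M"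
      by (simp add: M_def)
    then have "b * real n powr s = (\<Sum>\<alpha>\<in>A. l \<alpha>) * (b * real n powr s / M)"
      using M by simp
    also have "\<dots> = (\<Sum>\<alpha>\<in>A. l \<alpha> * (b * real n powr s / M))"
      by (rule sum_distrib_right)
    also have "\<dots> \<le> (\<Sum>\<alpha>\<in>A. l \<alpha> * (\<bar>reproducing_kernel (gegenbauer_weight (real m / 2)) n (x \<alpha>) e\<bar>
        + \<bar>reproducing_kernel (gegenbauer_weight (real m / 2)) n (x \<alpha>) (- e)\<bar>))"
    proof (intro sum_mono mult_left_mono)
      fix \<alpha> assume "\<alpha> \<in> A"
      then have x: "norm (x \<alpha>) \<le> 1" and l: "l \<alpha> > 0"
        using cub by (auto simp: cubature_formula_def)
      show "l \<alpha> \<ge> 0" using l by simp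
      have "\<bar>x \<alpha> \<bullet> e\<bar> \<le> 1"
        using Cauchy_Schwarz_ineq2[of "x \<alpha>" e] x e by simp
      from b(2)[OF this, of k] have "b * real n powr s / M \<le>
          (\<bar>poly (gegenbauer_kernel s n) (x \<alpha> \<bullet> e)\<bar> + \<bar>poly (gegenbauer_kernel s n) (- (x \<alpha> \<bullet> e))\<bar>) / M"
        using M by (intro divide_right_mono) (auto simp: k add.commute)
      also have "\<dots> = \<bar>reproducing_kernel (gegenbauer_weight (real m / 2)) n (x \<alpha>) e\<bar>
          + \<bar>reproducing_kernel (gegenbauer_weight (real m / 2)) n (x \<alpha>) (- e)\<bar>"
        using M e by (simp add: reproducing_kernel_ball[OF m x] fibre_average_boundary[OF m]
            add_divide_distrib abs_divide flip: s_def M_def)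
      finally show "b * real n powr s / M \<le> \<bar>reproducing_kernel (gegenbauer_weight (real m / 2)) n (x \<alpha>) e\<bar>
          + \<bar>reproducing_kernel (gegenbauer_weight (real m / 2)) n (x \<alpha>) (- e)\<bar>" .
    qed
    also have "\<dots> = S e + S (- e)"
      by (simp add: S_def distrib_left sum.distrib)
    finally have "b / 2 * real n powr s \<le> S e \<or> b / 2 * real n powr s \<le> S (- e)"
      by linarith
    moreover have "norm e \<le> 1" "norm (- e) \<le> 1" using e by simp_all
    ultimately show ?thesis
      unfolding S_def by blast
  qed
  ultimately show thesis
    by (rule that[unfolded s_def[symmetric]])
qed

theorem theorem3p1:
  fixes \<mu> :: real and m :: nat
  assumes "m \<ge> 1" and "\<mu> = real m / 2"
  shows "\<exists>b>0. \<exists>c>0. \<forall>n\<ge>1. \<forall>(A :: nat set) (l :: nat \<Rightarrow> real) (x :: nat \<Rightarrow> real ^ 'n).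
    cubature_formula (gegenbauer_weight \<mu>) (2 * n) A l x \<longrightarrow>
      b * real n powr ((real CARD('n) - 1) / 2 + \<mu>)
        \<le> lebesgue_constant (hyperinterpolation (gegenbauer_weight \<mu>) n A l x) \<and>
      lebesgue_constant (hyperinterpolation (gegenbauer_weight \<mu>) n A l x)
        \<le> c * real n powr ((real CARD('n) - 1) / 2 + \<mu>)"
proof -
  have exponent: "(real CARD('n) - 1) / 2 + real m / 2 = (real CARD('n) + m - 1) / 2"
    by (simp add: field_simps)
  obtain b where b: "b > 0"
    "\<And>n (A :: nat set) l (x :: nat \<Rightarrow> real ^ 'n). n \<ge> 1 \<Longrightarrow>
      cubature_formula (gegenbauer_weight (real m / 2)) (2 * n) A l x \<Longrightarrow>
      \<exists>y. norm y \<le> 1 \<and> b * real n powr ((real CARD('n) + m - 1) / 2)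
        \<le> (\<Sum>\<alpha>\<in>A. l \<alpha> * \<bar>reproducing_kernel (gegenbauer_weight (real m / 2)) n (x \<alpha>) y\<bar>)"
    by (rule kernel_sum_lower_bound[OF assms(1), where 'i=nat and 'n='n]) (rule that)
  obtain c where c: "c > 0"
    "\<And>n (A :: nat set) l (x :: nat \<Rightarrow> real ^ 'n) y. n \<ge> 1 \<Longrightarrow>
      cubature_formula (gegenbauer_weight (real m / 2)) (2 * n) A l x \<Longrightarrow> norm y \<le> 1 \<Longrightarrow>
      (\<Sum>\<alpha>\<in>A. l \<alpha> * \<bar>reproducing_kernel (gegenbauer_weight (real m / 2)) n (x \<alpha>) y\<bar>)
        \<le> c * real n powr ((real CARD('n) + m - 1) / 2)"
    by (rule kernel_sum_upper_bound[OF assms(1), where 'i=nat and 'n='n]) (rule that)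
  show ?thesis
    unfolding assms(2) exponent
  proof (rule exI[of _ b], rule conjI[OF b(1)], rule exI[of _ c], rule conjI[OF c(1)], intro allI impI conjI)
    fix n :: nat and A :: "nat set" and l :: "nat \<Rightarrow> real" and x :: "nat \<Rightarrow> real ^ 'n"
    assume n: "n \<ge> 1" and cub: "cubature_formula (gegenbauer_weight (real m / 2)) (2 * n) A l x"
    from cub have A: "finite A" "\<And>\<alpha>. \<alpha> \<in> A \<Longrightarrow> l \<alpha> > 0" "\<And>\<alpha>. \<alpha> \<in> A \<Longrightarrow> norm (x \<alpha>) \<le> 1"
      by (auto simp: cubature_formula_def)
    show "lebesgue_constant (hyperinterpolation (gegenbauer_weight (real m / 2)) n A l x)
        \<le> c * real n powr ((real CARD('n) + m - 1) / 2)"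
      by (rule lebesgue_constant_hyperinterpolation(1)[OF A c(2)[OF n cub]])
    obtain y where y: "norm y \<le> 1" "b * real n powr ((real CARD('n) + m - 1) / 2)
        \<le> (\<Sum>\<alpha>\<in>A. l \<alpha> * \<bar>reproducing_kernel (gegenbauer_weight (real m / 2)) n (x \<alpha>) y\<bar>)"
      using b(2)[OF n cub] by blast
    \<comment> \<open>The upper bound is used here as well, as the finite bound that makes the
      suprema meaningful.\<close>
    note y(2)
    also have "(\<Sum>\<alpha>\<in>A. l \<alpha> * \<bar>reproducing_kernel (gegenbauer_weight (real m / 2)) n (x \<alpha>) y\<bar>)
        \<le> lebesgue_constant (hyperinterpolation (gegenbauer_weight (real m / 2)) n A l x)"
      using y(1) by (rule lebesgue_constant_hyperinterpolation(2)[OF A c(2)[OF n cub], rotated -1])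
    finally show "b * real n powr ((real CARD('n) + m - 1) / 2)
        \<le> lebesgue_constant (hyperinterpolation (gegenbauer_weight (real m / 2)) n A l x)" .
  qed
qed

end
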